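(* Let $T:[0,1]\to[0,1]$ be a $\lambda$-expanding map with $\lambda>1$ having a unique SBR measure $\mu_T$. Fix $n\ge1$ and slopes $\alpha_1,\dots,\alpha_n>0$ with $2\bigl(n+1+\sum_i\frac1{\alpha_i}\bigr)<\lambda$. For intervals $A_i=[a_i,a_i']$ with $0\le a_1<a_1'\le\dots\le a_n<a_n'\le1$ and total length $m(A)=\delta$, $A=\bigcup A_i$, let $\tau$ be the piecewise linear map with $\tau x=\alpha_ix+c_i$ on $A_i$, $\tau(A_i)\subseteq A_i$, and $\tau x=x$ off $A$. Then for every sufficiently small $\delta>0$ the map $\tau\circ T$ has a unique invariant probability measure $\mu_\delta$ of bounded variation (absolutely continuous w.r.t. Lebesgue), and $\mu_\delta\to\mu_T$ as $\delta\to0$.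
   Context: A map $\tau:[0,1]\to[0,1]$ is $\lambda$-expanding if there is a finite partition of $[0,1]$ into intervals $X_i$ such that on each $X_i$ it is injective and $C^2$, $\inf_x|\tau'(x)|\ge\lambda$ and $\sup_x|(1/\tau'(x))'|<\infty$. Bounded variation means $\|\mu\|:=\sup\{\int\phi'\,d\mu:\phi\in C^1([0,1]),\sup|\phi|\le1\}<\infty$. SBR measure (reference Lebesgue measure): a probability $\nu$ such that for some open $U$ every Lebesgue-absolutely continuous probability $\mu$ with $\mu(U)=1$ satisfies $\frac1k\sum_{t<k}(T^t)_*\mu\to\nu$ weakly. *)

theory Defs
  imports "HOL-Probability.Probability"
begin

definition M01 :: "real measure" where
  "M01 = restrict_space borel {0..1}"

definition prob01 :: "real measure \<Rightarrow> bool" where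
  "prob01 \<mu> \<longleftrightarrow> sets \<mu> = sets M01 \<and> prob_space \<mu>"

definition good_piece :: "real \<Rightarrow> (real \<Rightarrow> real) \<Rightarrow> real set \<Rightarrow> bool" where
  "good_piece lam T X \<longleftrightarrow> inj_on T X \<and>
     (\<exists>T' T'' D. (\<forall>x\<in>X. (T has_real_derivative T' x) (at x within X)) \<and>
              (\<forall>x\<in>X. (T' has_real_derivative T'' x) (at x within X)) \<and>
              continuous_on X T'' \<and>
              (\<forall>x\<in>X. \<bar>T' x\<bar> \<ge> lam) \<and>
              (\<forall>x\<in>X. ((\<lambda>y. 1 / T' y) has_real_derivative D x) (at x within X)) \<and>
              (\<exists>K. \<forall>x\<in>X. \<bar>D x\<bar> \<le> K))"

definition expanding :: "real \<Rightarrow> (real \<Rightarrow> real) \<Rightarrow> bool" where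
  "expanding lam T \<longleftrightarrow> (\<forall>x\<in>{0..1}. T x \<in> {0..1}) \<and>
     (\<exists>k::nat. \<exists>p::nat \<Rightarrow> real. \<exists>X::nat \<Rightarrow> real set.
        p 0 = 0 \<and> p k = 1 \<and> (\<forall>j<k. p j < p (Suc j)) \<and>
        (\<forall>j<k. {p j<..<p (Suc j)} \<subseteq> X j \<and> X j \<subseteq> {p j..p (Suc j)}) \<and>
        (\<forall>j<k. \<forall>j'<k. j \<noteq> j' \<longrightarrow> X j \<inter> X j' = {}) \<and>
        (\<Union>j<k. X j) = {0..1} \<and>
        (\<forall>j<k. good_piece lam T (X j)))"

definition bv01 :: "real measure \<Rightarrow> bool" where
  "bv01 \<mu> \<longleftrightarrow> (\<exists>B. \<forall>\<phi> \<phi>'.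
      (\<forall>x\<in>{0..1}. (\<phi> has_real_derivative \<phi>' x) (at x within {0..1})) \<and>
      continuous_on {0..1} \<phi>' \<and> (\<forall>x\<in>{0..1}. \<bar>\<phi> x\<bar> \<le> 1)
      \<longrightarrow> integral\<^sup>L \<mu> \<phi>' \<le> B)"

definition weak_conv01 :: "(nat \<Rightarrow> real measure) \<Rightarrow> real measure \<Rightarrow> bool" where
  "weak_conv01 \<mu>s \<nu> \<longleftrightarrow> (\<forall>f::real \<Rightarrow> real. continuous_on {0..1} f \<longrightarrow>
      (\<lambda>k. integral\<^sup>L (\<mu>s k) f) \<longlonglongrightarrow> integral\<^sup>L \<nu> f)"

definition cesaro :: "(real \<Rightarrow> real) \<Rightarrow> real measure \<Rightarrow> nat \<Rightarrow> real measure" where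
  "cesaro T \<mu> k = measure_of (space \<mu>) (sets \<mu>)
     (\<lambda>A. (\<Sum>t<k. emeasure (distr \<mu> \<mu> (T ^^ t)) A) / of_nat k)"

definition SBR :: "(real \<Rightarrow> real) \<Rightarrow> real measure \<Rightarrow> bool" where
  "SBR T \<nu> \<longleftrightarrow> prob01 \<nu> \<and>
     (\<exists>U. open U \<and> U \<inter> {0..1} \<noteq> {} \<and>
        (\<forall>\<mu>. prob01 \<mu> \<and> absolutely_continuous (restrict_space lborel {0..1}) \<mu> \<and>
              emeasure \<mu> (U \<inter> {0..1}) = 1 \<longrightarrow> weak_conv01 (cesaro T \<mu>) \<nu>))"

definition invariant01 :: "(real \<Rightarrow> real) \<Rightarrow> real measure \<Rightarrow> bool" where
  "invariant01 S \<mu> \<longleftrightarrow> distr \<mu> \<mu> S = \<mu>"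

definition admissible :: "nat \<Rightarrow> (nat \<Rightarrow> real) \<Rightarrow> (nat \<Rightarrow> real) \<Rightarrow> (nat \<Rightarrow> real)
     \<Rightarrow> (nat \<Rightarrow> real) \<Rightarrow> real \<Rightarrow> bool" where
  "admissible n \<alpha> a a' c \<delta> \<longleftrightarrow>
     0 \<le> a 0 \<and> a' (n - 1) \<le> 1 \<and> (\<forall>i<n. a i < a' i) \<and>
     (\<forall>i. Suc i < n \<longrightarrow> a' i \<le> a (Suc i)) \<and>
     (\<Sum>i<n. a' i - a i) = \<delta> \<and>
     (\<forall>i<n. \<forall>x\<in>{a i..a' i}. \<alpha> i * x + c i \<in> {a i..a' i})"

text \<open>The piecewise linear map \<tau> (at a shared endpoint the lowest index is used).\<close>
definition tau :: "nat \<Rightarrow> (nat \<Rightarrow> real) \<Rightarrow> (nat \<Rightarrow> real) \<Rightarrow> (nat \<Rightarrow> real)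
     \<Rightarrow> (nat \<Rightarrow> real) \<Rightarrow> real \<Rightarrow> real" where
  "tau n \<alpha> a a' c x = (if \<exists>i<n. x \<in> {a i..a' i}
      then (let j = (LEAST i. i < n \<and> x \<in> {a i..a' i}) in \<alpha> j * x + c j)
      else x)"

end

theory Submission
  imports Defs
begin

text \<open>
  Everything is done in the dual formulation: a measure is of bounded variation with constant
  \<open>B\<close> iff \<open>\<integral>g d\<mu> \<le> B * M\<close> for all bounded measurable \<open>g\<close> all of whose integrals over
  subintervals are at most \<open>M\<close> in absolute value. Pulling test functions back along \<open>T\<close> and
  \<open>\<tau>\<close> gives a Lasota--Yorke inequality for \<open>\<tau> \<circ> T\<close> with contraction factor
  \<open>2 (n + 1 + \<Sum>i 1 / \<alpha> i) / \<lambda> < 1\<close>, uniformly in the intervals. Hence all absolutely continuous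
  invariant measures have a common variation bound, those of \<open>\<tau> \<circ> T\<close> exist, and as \<open>\<delta> \<rightarrow> 0\<close>
  their limit points are \<open>T\<close>-invariant, because \<open>\<tau>\<close> moves only a set of measure \<open>O(\<delta>)\<close>.

  An absolutely continuous invariant measure dominates an ergodic one (the variation bound gives
  a lower bound on the size of carriers, so splitting terminates), and an ergodic one is SBR
  because it has a density bounded below on some interval. So uniqueness of the SBR measure makes
  \<open>\<mu>T\<close> the only absolutely continuous \<open>T\<close>-invariant measure, hence the only possible limit.
  Finally, if \<open>\<tau> \<circ> T\<close> had two invariant measures, the Hahn decomposition of their difference
  would give two mutually singular ones; for small \<open>\<delta>\<close> both are close to \<open>\<mu>T\<close> in total variation,
  a contradiction.
\<close>


section \<open>Bounded variation on the unit interval\<close>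

text \<open>An estimate made directly for \<open>\<tau> \<circ> T\<close> on its own branch
  partition would have additive constants of the order of the reciprocal branch lengths, which blow
  up as the intervals shrink. So the two maps are treated separately. \<open>T\<close> contributes 2
  / \<lambda> and an additive term from its fixed partition. \<open>\<tau>\<close> contributes only
  a factor: off finitely many points, \<open>g \<circ> \<tau>\<close> is g plus, for each interval,
  the affine pull-back minus g, both restricted to that interval, and restricting a test function to
  an interval does not enlarge the oscillation of its primitive. The costs 1, 1 / \<alpha> i and 1
  add up to n + 1 + \<Sum>i 1 / \<alpha> i, whatever the lengths. Uniqueness for small \<delta> does
  not follow from weak convergence alone, because mutually singular measures can be weakly close.
  Compactness excludes this: under a common variation bound, the masses of finitely many intervals
  determine a measure up to a small error in total variation.\<close>

definition L01 :: "real measure" where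
  "L01 = restrict_space lborel {0..1}"

definition fin01 :: "real measure \<Rightarrow> bool" where
  "fin01 \<mu> \<longleftrightarrow> finite_measure \<mu> \<and> sets \<mu> = sets M01"

definition bdd01 :: "(real \<Rightarrow> real) \<Rightarrow> bool" where
  "bdd01 g \<longleftrightarrow> g \<in> borel_measurable M01 \<and> (\<exists>R. \<forall>x\<in>{0..1}. \<bar>g x\<bar> \<le> R)"

text \<open>Integrals over subintervals are differences of values of a primitive, so M bounds the
  oscillation of that primitive. This replaces the condition on \<open>\<phi>\<close> in
  \<open>bv01\<close>: it involves no derivative and ignores additive constants.\<close>

definition osc_le :: "(real \<Rightarrow> real) \<Rightarrow> real \<Rightarrow> bool" where
  "osc_le g M \<longleftrightarrow> (\<forall>s t. 0 \<le> s \<and> s \<le> t \<and> t \<le> 1 \<longrightarrow> \<bar>LINT x:{s..t}|L01. g x\<bar> \<le> M)"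

definition var_le :: "real measure \<Rightarrow> real \<Rightarrow> bool" where
  "var_le \<mu> B \<longleftrightarrow> (\<forall>g M. bdd01 g \<and> osc_le g M \<longrightarrow> integral\<^sup>L \<mu> g \<le> B * M)"

text \<open>A bound K on the density of \<mu> with respect to \<nu>, phrased setwise so that no
  density has to be chosen.\<close>

definition dominated :: "real measure \<Rightarrow> real measure \<Rightarrow> real \<Rightarrow> bool" where
  "dominated \<mu> \<nu> K \<longleftrightarrow> (\<forall>A\<in>sets M01. measure \<mu> A \<le> K * measure \<nu> A)"

section \<open>Finite measures and bounded test functions\<close>

lemma space_M01 [simp]: "space M01 = {0..1}"
  by (simp add: M01_def space_restrict_space)

lemma sets_L01 [simp, measurable_cong]: "sets L01 = sets M01"
  by (simp add: L01_def M01_def sets_restrict_space)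

lemma space_L01 [simp]: "space L01 = {0..1}"
  by (simp add: L01_def space_restrict_space)

lemma in_sets_M01: "A \<in> sets M01 \<longleftrightarrow> A \<in> sets borel \<and> A \<subseteq> {0..1}"
  by (auto simp: M01_def sets_restrict_space_iff)

lemma prob_space_L01: "prob_space L01"
  by (rule prob_spaceI) (simp add: L01_def space_restrict_space emeasure_restrict_space)

lemma fin01_L01 [simp]: "fin01 L01"
  using prob_space_L01 by (simp add: fin01_def prob_space_def)

lemma measure_L01: "A \<in> sets M01 \<Longrightarrow> measure L01 A = measure lborel A"
  by (simp add: L01_def in_sets_M01 measure_restrict_space)

lemma fin01_sets: "fin01 \<mu> \<Longrightarrow> sets \<mu> = sets M01"
  and fin01_finite: "fin01 \<mu> \<Longrightarrow> finite_measure \<mu>"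
  by (auto simp: fin01_def)

lemma fin01_space: "fin01 \<mu> \<Longrightarrow> space \<mu> = {0..1}"
  using sets_eq_imp_space_eq[of \<mu> M01] by (simp add: fin01_def)

lemma prob01_fin01: "prob01 \<mu> \<Longrightarrow> fin01 \<mu>"
  by (simp add: prob01_def fin01_def prob_space_def)

lemma prob01_measure: "prob01 \<mu> \<Longrightarrow> measure \<mu> {0..1} = 1"
  using fin01_space[OF prob01_fin01, of \<mu>] prob_space.prob_space[of \<mu>] by (auto simp: prob01_def)

lemma prob01I: "fin01 \<mu> \<Longrightarrow> measure \<mu> {0..1} = 1 \<Longrightarrow> prob01 \<mu>"
  by (auto simp: prob01_def fin01_def finite_measure.emeasure_eq_measure fin01_space[unfolded fin01_def]
      intro!: prob_spaceI)

lemma bdd01_bound: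
  assumes "bdd01 g" obtains R where "R > 0" "\<And>x. x \<in> {0..1} \<Longrightarrow> \<bar>g x\<bar> \<le> R"
proof -
  obtain R where "\<forall>x\<in>{0..1}. \<bar>g x\<bar> \<le> R" using assms by (auto simp: bdd01_def)
  then have "\<bar>g x\<bar> \<le> \<bar>R\<bar> + 1" if "x \<in> {0..1}" for x using that by force
  then show ?thesis by (intro that[of "\<bar>R\<bar> + 1"]) auto
qed

lemma bdd01I: "g \<in> borel_measurable M01 \<Longrightarrow> (\<And>x. x \<in> {0..1} \<Longrightarrow> \<bar>g x\<bar> \<le> R) \<Longrightarrow> bdd01 g"
  unfolding bdd01_def by blast

lemma bdd01_const [simp]: "bdd01 (\<lambda>x. c)"
  by (rule bdd01I[of _ "\<bar>c\<bar>"]) auto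

lemma bdd01_indicator: "A \<in> sets M01 \<Longrightarrow> bdd01 (indicator A)"
  by (rule bdd01I[of _ 1]) (auto simp: indicator_def)

lemma bdd01_add: assumes "bdd01 f" "bdd01 g" shows "bdd01 (\<lambda>x. f x + g x)"
proof -
  obtain R where R: "\<And>x. x \<in> {0..1} \<Longrightarrow> \<bar>f x\<bar> \<le> R" using bdd01_bound[OF assms(1)] by blast
  obtain S where S: "\<And>x. x \<in> {0..1} \<Longrightarrow> \<bar>g x\<bar> \<le> S" using bdd01_bound[OF assms(2)] by blast
  have [measurable]: "f \<in> borel_measurable M01" "g \<in> borel_measurable M01"
    using assms by (simp_all add: bdd01_def)
  show ?thesis
  proof (rule bdd01I)
    show "\<bar>f x + g x\<bar> \<le> R + S" if "x \<in> {0..1}" for x using R[OF that] S[OF that] by linarith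
  qed measurable
qed

lemma bdd01_mult: assumes "bdd01 f" "bdd01 g" shows "bdd01 (\<lambda>x. f x * g x)"
proof -
  obtain R where R: "R > 0" "\<And>x. x \<in> {0..1} \<Longrightarrow> \<bar>f x\<bar> \<le> R" using bdd01_bound[OF assms(1)] by blast
  obtain S where S: "\<And>x. x \<in> {0..1} \<Longrightarrow> \<bar>g x\<bar> \<le> S" using bdd01_bound[OF assms(2)] by blast
  have [measurable]: "f \<in> borel_measurable M01" "g \<in> borel_measurable M01"
    using assms by (simp_all add: bdd01_def)
  show ?thesis
  proof (rule bdd01I)
    show "\<bar>f x * g x\<bar> \<le> R * S" if "x \<in> {0..1}" for x
      unfolding abs_mult using R(1) R(2)[OF that] S[OF that] by (intro mult_mono) auto
  qed measurable
qed

lemma bdd01_uminus: "bdd01 f \<Longrightarrow> bdd01 (\<lambda>x. - f x)"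
  using bdd01_mult[OF bdd01_const[of "-1"]] by simp

lemma bdd01_diff: "bdd01 f \<Longrightarrow> bdd01 g \<Longrightarrow> bdd01 (\<lambda>x. f x - g x)"
  using bdd01_add[OF _ bdd01_uminus] by simp

lemma bdd01_sum: "(\<And>i. i \<in> I \<Longrightarrow> bdd01 (f i)) \<Longrightarrow> bdd01 (\<lambda>x. \<Sum>i\<in>I. f i x)"
  by (induction I rule: infinite_finite_induct) (auto intro: bdd01_add)

lemma bdd01_abs: "bdd01 f \<Longrightarrow> bdd01 (\<lambda>x. \<bar>f x\<bar>)"
  by (auto simp: bdd01_def)

lemma bdd01_compose:
  assumes "bdd01 f" "S \<in> measurable M01 M01" shows "bdd01 (\<lambda>x. f (S x))"
proof -
  obtain R where R: "\<And>x. x \<in> {0..1} \<Longrightarrow> \<bar>f x\<bar> \<le> R" using bdd01_bound[OF assms(1)] by blast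
  have "S x \<in> {0..1}" if "x \<in> {0..1}" for x using measurable_space[OF assms(2)] that by simp
  then show ?thesis
    using R assms by (intro bdd01I[of _ R] measurable_compose[OF assms(2)]) (auto simp: bdd01_def)
qed

lemma bdd01_continuous:
  assumes "continuous_on {0..1} f" shows "bdd01 f"
proof -
  have "bounded (f ` {0..1})" using assms by (intro compact_imp_bounded compact_continuous_image) auto
  then obtain R where "\<And>x. x \<in> {0..1} \<Longrightarrow> \<bar>f x\<bar> \<le> R" unfolding bounded_iff by fastforce
  then show ?thesis using borel_measurable_continuous_on_restrict[OF assms]
    by (intro bdd01I) (auto simp: M01_def)
qed

lemmas bdd01_intros = bdd01_add bdd01_mult bdd01_uminus bdd01_diff bdd01_sum bdd01_abs bdd01_const
  bdd01_indicator

lemma bdd01_integrable: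
  assumes "fin01 \<mu>" "bdd01 g" shows "integrable \<mu> g"
proof -
  interpret finite_measure \<mu> using assms by (simp add: fin01_def)
  obtain R where "\<And>x. x \<in> {0..1} \<Longrightarrow> \<bar>g x\<bar> \<le> R" using bdd01_bound[OF assms(2)] by blast
  moreover have "g \<in> borel_measurable \<mu>"
    using assms by (simp add: bdd01_def fin01_def cong: measurable_cong_sets)
  ultimately show ?thesis
    by (intro integrable_const_bound[of _ R]) (auto simp: fin01_space[OF assms(1)])
qed

lemma bdd01_borel: "fin01 \<mu> \<Longrightarrow> bdd01 g \<Longrightarrow> g \<in> borel_measurable \<mu>"
  by (rule borel_measurable_integrable[OF bdd01_integrable])

lemma integral_mono_01:
  assumes "fin01 \<mu>" "bdd01 f" "bdd01 g" "\<And>x. x \<in> {0..1} \<Longrightarrow> f x \<le> g x"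
  shows "integral\<^sup>L \<mu> f \<le> integral\<^sup>L \<mu> g"
  using assms by (intro integral_mono bdd01_integrable) (auto simp: fin01_space)

lemma integral_abs_le_01:
  assumes "fin01 \<mu>" "bdd01 g" "\<And>x. x \<in> {0..1} \<Longrightarrow> \<bar>g x\<bar> \<le> R"
  shows "\<bar>integral\<^sup>L \<mu> g\<bar> \<le> R * measure \<mu> {0..1}"
proof -
  interpret finite_measure \<mu> using assms by (simp add: fin01_def)
  have "\<bar>integral\<^sup>L \<mu> g\<bar> \<le> integral\<^sup>L \<mu> (\<lambda>x. \<bar>g x\<bar>)" by (rule integral_abs_bound)
  also have "\<dots> \<le> integral\<^sup>L \<mu> (\<lambda>x. R)"
    using assms by (intro integral_mono_01 bdd01_intros)
  finally show ?thesis using fin01_space[OF assms(1)] by (simp add: mult.commute)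
qed

lemma integral_indicator_01:
  "fin01 \<mu> \<Longrightarrow> A \<in> sets M01 \<Longrightarrow> integral\<^sup>L \<mu> (indicator A) = measure \<mu> A"
  using fin01_sets[of \<mu>] fin01_finite[of \<mu>] by simp

lemma integral_add_01: "fin01 \<mu> \<Longrightarrow> bdd01 f \<Longrightarrow> bdd01 g \<Longrightarrow>
    integral\<^sup>L \<mu> (\<lambda>x. f x + g x) = integral\<^sup>L \<mu> f + integral\<^sup>L \<mu> g"
  and integral_diff_01: "fin01 \<mu> \<Longrightarrow> bdd01 f \<Longrightarrow> bdd01 g \<Longrightarrow>
    integral\<^sup>L \<mu> (\<lambda>x. f x - g x) = integral\<^sup>L \<mu> f - integral\<^sup>L \<mu> g"
  by (auto intro!: Bochner_Integration.integral_add Bochner_Integration.integral_diff bdd01_integrable)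

lemma integral_sum_01: "fin01 \<mu> \<Longrightarrow> (\<And>i. i \<in> I \<Longrightarrow> bdd01 (f i)) \<Longrightarrow>
    integral\<^sup>L \<mu> (\<lambda>x. \<Sum>i\<in>I. f i x) = (\<Sum>i\<in>I. integral\<^sup>L \<mu> (f i))"
  by (intro Bochner_Integration.integral_sum bdd01_integrable)

lemma AE_dominated:
  assumes "fin01 \<mu>" "dominated \<mu> L01 K" "AE x in L01. P x" shows "AE x in \<mu>. P x"
proof -
  obtain N where N: "{x \<in> space L01. \<not> P x} \<subseteq> N" "emeasure L01 N = 0" "N \<in> sets L01"
    using assms(3) by (rule AE_E)
  have "measure \<mu> N \<le> K * measure L01 N" using assms(2) N(3) by (simp add: dominated_def)
  then have "measure \<mu> N = 0" using N(2) measure_nonneg[of \<mu> N] by (simp add: measure_def del: enn2real_nonneg)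
  then have "emeasure \<mu> N = 0"
    using assms(1) by (simp add: fin01_def finite_measure.emeasure_eq_measure)
  then show ?thesis using N assms(1) by (intro AE_I'[of N]) (auto simp: fin01_sets fin01_space null_sets_def)
qed

lemma set_integrable_01:
  assumes "bdd01 g" "{s..t} \<subseteq> {0..1}" shows "set_integrable L01 {s..t} g"
  unfolding set_integrable_def real_scaleR_def
  using assms by (intro bdd01_integrable bdd01_intros) (auto simp: in_sets_M01)

lemma set_integral_01_HK:
  assumes "bdd01 g" "{s..t} \<subseteq> {0..1}"
  shows "(LINT x:{s..t}|L01. g x) = integral {s..t} g" "g integrable_on {s..t}"
proof -
  have *: "indicat_real {0..1} x * (indicator {s..t} x * g x) = indicator {s..t} x * g x" for x
    using assms(2) by (auto simp: indicator_def)
  have "set_integrable lborel {s..t} g"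
    using set_integrable_01[OF assms] unfolding set_integrable_def L01_def
    by (subst (asm) integrable_restrict_space) (auto simp: *)
  moreover have "(LINT x:{s..t}|L01. g x) = (LINT x:{s..t}|lborel. g x)"
    unfolding set_lebesgue_integral_def L01_def by (subst integral_restrict_space) (auto simp: *)
  ultimately show "(LINT x:{s..t}|L01. g x) = integral {s..t} g" "g integrable_on {s..t}"
    using set_borel_integral_eq_integral by auto
qed

lemma abs_set_integral_le_01:
  assumes "bdd01 g" "0 \<le> s" "t \<le> 1" shows "\<bar>LINT x:{s..t}|L01. g x\<bar> \<le> integral\<^sup>L L01 (\<lambda>x. \<bar>g x\<bar>)"
proof -
  have "{s..t} \<in> sets M01" using assms by (auto simp: in_sets_M01)
  then have "\<bar>LINT x:{s..t}|L01. g x\<bar> \<le> (\<integral>x. \<bar>indicator {s..t} x * g x\<bar> \<partial>L01)"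
    unfolding set_lebesgue_integral_def real_scaleR_def by (intro integral_abs_bound)
  also have "\<dots> \<le> integral\<^sup>L L01 (\<lambda>x. \<bar>g x\<bar>)"
    using assms \<open>{s..t} \<in> sets M01\<close> by (intro integral_mono_01 bdd01_intros) (auto simp: indicator_def)
  finally show ?thesis .
qed

lemma set_integral_diff_01:
  assumes "bdd01 f" "bdd01 g" "{s..t} \<subseteq> {0..1}"
  shows "(LINT x:{s..t}|L01. f x - g x) = (LINT x:{s..t}|L01. f x) - (LINT x:{s..t}|L01. g x)"
  using assms by (intro set_integral_diff set_integrable_01)

lemma integral_convergence_01:
  assumes "fin01 \<mu>" "\<And>k. bdd01 (f k)" "bdd01 g" "\<And>k x. x \<in> {0..1} \<Longrightarrow> \<bar>f k x\<bar> \<le> R"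
    "AE x in \<mu>. (\<lambda>k. f k x) \<longlonglongrightarrow> g x"
  shows "(\<lambda>k. integral\<^sup>L \<mu> (f k)) \<longlonglongrightarrow> integral\<^sup>L \<mu> g"
proof (rule integral_dominated_convergence[where w = "\<lambda>x. R"])
  show "g \<in> borel_measurable \<mu>" "\<And>k. f k \<in> borel_measurable \<mu>"
    using assms by (auto intro!: borel_measurable_integrable bdd01_integrable)
  show "integrable \<mu> (\<lambda>x. R)" using assms(1) by (intro bdd01_integrable) auto
  show "AE x in \<mu>. norm (f k x) \<le> R" for k
    using assms(1,4) by (intro AE_I2) (auto simp: fin01_space)
qed (use assms in auto)

section \<open>Domination of measures and continuous approximation\<close>

lemma integral_dominated:
  assumes "fin01 \<mu>" "fin01 \<nu>" "dominated \<mu> \<nu> K" "K \<ge> 0" "bdd01 f" "\<And>x. x \<in> {0..1} \<Longrightarrow> f x \<ge> 0"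
  shows "integral\<^sup>L \<mu> f \<le> K * integral\<^sup>L \<nu> f"
proof -
  have sets: "sets \<mu> = sets (scale_measure (ennreal K) \<nu>)" using assms by (simp add: fin01_sets)
  have "emeasure \<mu> A \<le> emeasure (scale_measure (ennreal K) \<nu>) A" for A
  proof (cases "A \<in> sets M01")
    case True
    then have "ennreal (measure \<mu> A) \<le> ennreal (K * measure \<nu> A)"
      using assms(3) by (auto simp: dominated_def intro: ennreal_leI)
    then show ?thesis using assms(1,2,4)
      by (simp add: fin01_def finite_measure.emeasure_eq_measure ennreal_mult)
  qed (use assms in \<open>auto simp: fin01_sets emeasure_notin_sets\<close>)
  then have "\<mu> \<le> scale_measure (ennreal K) \<nu>" using sets by (simp add: le_measure)
  then have "(\<integral>\<^sup>+x. ennreal (f x) \<partial>\<mu>) \<le> (\<integral>\<^sup>+x. ennreal (f x) \<partial>scale_measure (ennreal K) \<nu>)"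
    using sets by (intro nn_integral_mono_measure) auto
  also have "\<dots> = ennreal K * (\<integral>\<^sup>+x. ennreal (f x) \<partial>\<nu>)"
    using bdd01_borel[OF assms(2,5)] by (subst nn_integral_scale_measure) auto
  also have "(\<integral>\<^sup>+x. ennreal (f x) \<partial>\<mu>) = ennreal (integral\<^sup>L \<mu> f)"
    using assms(1,5,6) by (intro nn_integral_eq_integral bdd01_integrable AE_I2) (auto simp: fin01_space)
  also have "(\<integral>\<^sup>+x. ennreal (f x) \<partial>\<nu>) = ennreal (integral\<^sup>L \<nu> f)"
    using assms(2,5,6) by (intro nn_integral_eq_integral bdd01_integrable AE_I2) (auto simp: fin01_space)
  finally have "ennreal (integral\<^sup>L \<mu> f) \<le> ennreal (K * integral\<^sup>L \<nu> f)"
    using assms(4) by (simp add: ennreal_mult')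
  moreover have "integral\<^sup>L \<nu> f \<ge> 0"
    using assms by (intro integral_nonneg_AE AE_I2) (auto simp: fin01_space)
  ultimately show ?thesis using assms(4) by (simp add: ennreal_le_iff)
qed

text \<open>Measurability gives continuous functions converging to g off a null set, but without a
  common bound. Clamping them to [L, R] restores the bound, and the choice L = 0 keeps them
  nonnegative when g is.\<close>

lemma approx_continuous:
  assumes g: "bdd01 g" and R: "\<And>x. x \<in> {0..1} \<Longrightarrow> \<bar>g x\<bar> \<le> R"
  obtains f :: "nat \<Rightarrow> real \<Rightarrow> real" where
    "\<And>k. continuous_on {0..1} (f k)" "\<And>k x. \<bar>f k x\<bar> \<le> R"
    "AE x in L01. (\<lambda>k. f k x) \<longlonglongrightarrow> g x"
    "(\<forall>x\<in>{0..1}. g x \<ge> 0) \<longrightarrow> (\<forall>k x. f k x \<ge> 0)"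
proof -
  have R0: "R \<ge> 0" using R[of 0] by force
  let ?h = "\<lambda>x. indicator {0..1} x *\<^sub>R g x"
  have "?h \<in> borel_measurable borel"
    using g by (subst borel_measurable_restrict_space_iff[symmetric]) (auto simp: bdd01_def M01_def)
  then have "?h measurable_on UNIV"
    by (intro lebesgue_measurable_imp_measurable_on_real)
      (auto intro: measurable_completion borel_measurable_if_I)
  then obtain N f where f: "negligible N" "\<And>n. continuous_on UNIV (f n)"
      "\<And>x. x \<notin> N \<Longrightarrow> (\<lambda>n. f n x) \<longlonglongrightarrow> ?h x"
    unfolding measurable_on_def by auto
  define L where "L = (if \<forall>x\<in>{0..1}. g x \<ge> 0 then 0 else - R)"
  define F where "F = (\<lambda>k x. max L (min R (f k x)))"
  show thesis
  proof (rule that[of F])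
    show "continuous_on {0..1} (F k)" for k
      unfolding F_def by (intro continuous_intros continuous_on_subset[OF f(2)]) auto
    show "\<bar>F k x\<bar> \<le> R" for k x using R0 by (auto simp: F_def L_def)
    show "(\<forall>x\<in>{0..1}. g x \<ge> 0) \<longrightarrow> (\<forall>k x. F k x \<ge> 0)"
      using R0 by (auto simp: F_def L_def)
    have "N \<in> null_sets lebesgue" using f(1) by (simp add: negligible_iff_null_sets)
    then have "AE x in lebesgue. x \<notin> N" by (rule AE_not_in)
    then have "AE x in lborel. x \<notin> N" by (simp add: AE_completion_iff)
    then have "AE x in L01. x \<notin> N" unfolding L01_def
      by (subst AE_restrict_space_iff) auto
    moreover have "AE x in L01. x \<in> {0..1}" by (rule AE_I2) simp
    ultimately show "AE x in L01. (\<lambda>k. F k x) \<longlonglongrightarrow> g x"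
    proof eventually_elim
      case (elim x)
      then have "(\<lambda>n. f n x) \<longlonglongrightarrow> g x" using f(3)[of x] by simp
      then have "(\<lambda>k. F k x) \<longlonglongrightarrow> max L (min R (g x))" unfolding F_def
        by (intro tendsto_intros)
      also have "max L (min R (g x)) = g x" using R[of x] elim by (auto simp: L_def)
      finally show ?case .
    qed
  qed
qed

lemma approx_continuous_L1:
  assumes "bdd01 g" "e > 0"
  obtains f where "continuous_on {0..1} f" "integral\<^sup>L L01 (\<lambda>x. \<bar>f x - g x\<bar>) < e"
    "(\<forall>x\<in>{0..1}. g x \<ge> 0) \<longrightarrow> (\<forall>x. f x \<ge> 0)"
proof -
  obtain R where R: "\<And>x. x \<in> {0..1} \<Longrightarrow> \<bar>g x\<bar> \<le> R" using bdd01_bound[OF assms(1)] by blast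
  obtain f :: "nat \<Rightarrow> real \<Rightarrow> real" where f: "\<And>k. continuous_on {0..1} (f k)" "\<And>k x. \<bar>f k x\<bar> \<le> R"
      "AE x in L01. (\<lambda>k. f k x) \<longlonglongrightarrow> g x"
      "(\<forall>x\<in>{0..1}. g x \<ge> 0) \<longrightarrow> (\<forall>k x. f k x \<ge> 0)"
    by (rule approx_continuous[OF assms(1) R]) blast+
  note b = bdd01_continuous[OF f(1)]
  have "(\<lambda>k. integral\<^sup>L L01 (\<lambda>x. \<bar>f k x - g x\<bar>)) \<longlonglongrightarrow> integral\<^sup>L L01 (\<lambda>x. 0)"
  proof (rule integral_convergence_01[where R = "2 * R"])
    show "\<bar>\<bar>f k x - g x\<bar>\<bar> \<le> 2 * R" if "x \<in> {0..1}" for k x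
      using f(2)[of k x] R(1)[OF that] by linarith
    show "AE x in L01. (\<lambda>k. \<bar>f k x - g x\<bar>) \<longlonglongrightarrow> 0"
      using f(3) by eventually_elim (simp add: LIM_zero tendsto_rabs_zero)
  qed (use b assms in \<open>auto intro!: bdd01_intros\<close>)
  then have "(\<lambda>k. integral\<^sup>L L01 (\<lambda>x. \<bar>f k x - g x\<bar>)) \<longlonglongrightarrow> 0" by simp
  from order_tendstoD(2)[OF this assms(2)] obtain k where "integral\<^sup>L L01 (\<lambda>x. \<bar>f k x - g x\<bar>) < e"
    by (auto simp: eventually_sequentially)
  then show thesis using that[of "f k"] f by blast
qed

lemma fin01_measure_mono: "fin01 \<mu> \<Longrightarrow> A \<subseteq> B \<Longrightarrow> B \<in> sets M01 \<Longrightarrow> measure \<mu> A \<le> measure \<mu> B"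
  by (rule finite_measure.finite_measure_mono) (auto simp: fin01_def)

lemma measure_split_01:
  assumes "fin01 \<mu>" "A \<in> sets M01" "E \<in> sets M01"
  shows "measure \<mu> A = measure \<mu> (A \<inter> E) + measure \<mu> (A - E)"
  using finite_measure.finite_measure_Union[OF fin01_finite[OF assms(1)], of "A \<inter> E" "A - E"] assms
  by (simp add: fin01_sets Int_Diff_Un Diff_Int_distrib Int_Diff)

lemma measure_compl_01:
  assumes "prob01 \<mu>" "E \<in> sets M01" shows "measure \<mu> ({0..1} - E) = 1 - measure \<mu> E"
proof -
  have "{0..1} \<inter> E = E" "{0..1} \<in> sets M01" using assms(2) by (auto simp: in_sets_M01)
  then show ?thesis
    using measure_split_01[OF prob01_fin01[OF assms(1)] _ assms(2), of "{0..1}"] prob01_measure[OF assms(1)] by simp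
qed

text \<open>The indicator of an open set is a limit of continuous functions below it. Outer
  regularity of Lebesgue measure then reaches every Borel set A, since replacing A by a larger open
  set can only increase its mass under \<mu>.\<close>

lemma dominated_continuous:
  assumes \<mu>: "fin01 \<mu>" and "K \<ge> 0" and le: "\<And>f. continuous_on {0..1} f \<Longrightarrow> (\<And>x. x \<in> {0..1} \<Longrightarrow> f x \<ge> 0) \<Longrightarrow>
      integral\<^sup>L \<mu> f \<le> K * integral\<^sup>L L01 f"
  shows "dominated \<mu> L01 K"
proof -
  have op: "measure \<mu> (V \<inter> {0..1}) \<le> K * measure L01 (V \<inter> {0..1})" if V: "open V" for V :: "real set"
  proof -
    have VM: "V \<inter> {0..1} \<in> sets M01" using V by (auto simp: in_sets_M01)
    obtain f :: "nat \<Rightarrow> real \<Rightarrow> real" where f: "\<And>k. continuous_on UNIV (f k)"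
      "\<And>k x. 0 \<le> f k x" "\<And>k x. f k x \<le> indicator V x" "\<And>x. (\<lambda>k. f k x) \<longlonglongrightarrow> indicator V x"
    \<comment> \<open>\<open>infdist\<close> to the empty set is 0, so for V = UNIV the distance
      construction would produce the zero function.\<close>
    proof (cases "V = UNIV")
      case True then show ?thesis by (intro that[of "\<lambda>_ _. 1"]) auto
    next
      case False
      show ?thesis
      proof (rule that[of "\<lambda>k x. min 1 (real k * infdist x (-V))"])
        fix x
        show "(\<lambda>k. min 1 (real k * infdist x (- V))) \<longlonglongrightarrow> indicator V x"
        proof (cases "x \<in> V")
          case True
          then have pos: "infdist x (-V) > 0"
            using V False by (intro infdist_pos_not_in_closed) auto
          have "eventually (\<lambda>k. real k \<ge> 1 / infdist x (-V)) sequentially"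
            using filterlim_at_top filterlim_real_sequentially by blast
          then have "eventually (\<lambda>k. min 1 (real k * infdist x (- V)) = indicator V x) sequentially"
            by eventually_elim (use pos True in \<open>auto simp: field_simps\<close>)
          then show ?thesis by (rule tendsto_eventually)
        qed (auto)
      qed (auto simp: indicator_def infdist_nonneg intro!: continuous_intros)
    qed
    have b: "bdd01 (f k)" for k using f(1)[of k] by (intro bdd01_continuous) (auto intro: continuous_on_subset)
    have "(\<lambda>k. integral\<^sup>L \<mu> (f k)) \<longlonglongrightarrow> integral\<^sup>L \<mu> (indicator (V \<inter> {0..1}))"
    proof (rule integral_convergence_01[where R=1])
      show "\<bar>f k x\<bar> \<le> 1" for k x using f(2,3)[of k x] indicator_le_1[of V x] by (smt (verit))
      show "AE x in \<mu>. (\<lambda>k. f k x) \<longlonglongrightarrow> indicator (V \<inter> {0..1}) x"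
        by (rule AE_I2) (use f(4) \<mu> in \<open>simp add: fin01_space indicator_inter_arith\<close>)
    qed (use b \<mu> VM in \<open>auto intro: bdd01_intros\<close>)
    moreover have "integral\<^sup>L \<mu> (f k) \<le> K * measure L01 (V \<inter> {0..1})" for k
    proof -
      have "integral\<^sup>L \<mu> (f k) \<le> K * integral\<^sup>L L01 (f k)"
        using f by (intro le) (auto intro: continuous_on_subset)
      also have "integral\<^sup>L L01 (f k) \<le> integral\<^sup>L L01 (indicator (V \<inter> {0..1}))"
        by (rule integral_mono_01) (use f(3)[of k] b VM in \<open>auto intro: bdd01_intros simp: indicator_inter_arith\<close>)
      finally show ?thesis using VM \<open>K \<ge> 0\<close> by (simp add: integral_indicator_01 mult_left_mono)
    qed
    ultimately show ?thesis using \<mu> VM by (subst integral_indicator_01[symmetric]) (auto intro: LIMSEQ_le_const2)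
  qed
  show ?thesis unfolding dominated_def
  proof
    fix A assume A: "A \<in> sets M01"
    show "measure \<mu> A \<le> K * measure L01 A"
    proof (rule field_le_epsilon)
      fix e :: real assume "e > 0"
      then have e': "e / (K + 1) > 0" using \<open>K \<ge> 0\<close> by simp
      obtain U where U: "open U" "A \<subseteq> U" "emeasure lborel (U - A) < e / (K + 1)"
        using outer_regular_lborel[OF _ e', of A] A by (auto simp: in_sets_M01)
      have UM: "U \<inter> {0..1} \<in> sets M01" using U by (auto simp: in_sets_M01)
      have "emeasure L01 (U \<inter> {0..1} - A) \<le> emeasure lborel (U - A)"
        unfolding L01_def using A U by (subst emeasure_restrict_space) (auto intro!: emeasure_mono simp: in_sets_M01)
      also note U(3)
      finally have "emeasure L01 (U \<inter> {0..1} - A) < e / (K + 1)" .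
      then have "measure L01 (U \<inter> {0..1} - A) \<le> e / (K + 1)"
        using e' by (simp add: finite_measure.emeasure_eq_measure[OF fin01_finite] ennreal_less_iff)
      moreover have "measure L01 (U \<inter> {0..1} - A) = measure L01 (U \<inter> {0..1}) - measure L01 A"
        using A UM U by (intro finite_measure.finite_measure_Diff) (auto simp: fin01_finite in_sets_M01)
      ultimately have "K * measure L01 (U \<inter> {0..1}) \<le> K * (measure L01 A + e / (K + 1))"
        using \<open>K \<ge> 0\<close> by (intro mult_left_mono) auto
      also have "\<dots> \<le> K * measure L01 A + e" using \<open>K \<ge> 0\<close> \<open>e > 0\<close> by (auto simp: field_simps)
      finally have "K * measure L01 (U \<inter> {0..1}) \<le> K * measure L01 A + e" .
      moreover have "measure \<mu> A \<le> measure \<mu> (U \<inter> {0..1})"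
        using \<mu> UM U A by (intro fin01_measure_mono) (auto simp: in_sets_M01)
      ultimately show "measure \<mu> A \<le> K * measure L01 A + e" using op[OF U(1)] by linarith
    qed
  qed
qed

section \<open>Oscillation of primitives and the variation bound\<close>

lemma osc_leD: "osc_le g M \<Longrightarrow> 0 \<le> s \<Longrightarrow> s \<le> t \<Longrightarrow> t \<le> 1 \<Longrightarrow> \<bar>LINT x:{s..t}|L01. g x\<bar> \<le> M"
  by (simp add: osc_le_def)

lemma osc_le_nonneg: assumes "osc_le g M" shows "M \<ge> 0"
  using osc_leD[OF assms, of 0 0] by linarith

lemma osc_le_integral_abs: "bdd01 g \<Longrightarrow> osc_le g (integral\<^sup>L L01 (\<lambda>x. \<bar>g x\<bar>))"
  unfolding osc_le_def using abs_set_integral_le_01 by blast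

lemma osc_le_perturb:
  assumes "bdd01 f" "bdd01 g" "osc_le g M"
  shows "osc_le f (M + integral\<^sup>L L01 (\<lambda>x. \<bar>f x - g x\<bar>))"
  unfolding osc_le_def
proof (intro allI impI)
  fix s t :: real assume st: "0 \<le> s \<and> s \<le> t \<and> t \<le> 1"
  have "(LINT x:{s..t}|L01. f x) = (LINT x:{s..t}|L01. g x) + (LINT x:{s..t}|L01. f x - g x)"
    using assms st by (subst set_integral_diff_01) auto
  moreover have "\<bar>LINT x:{s..t}|L01. f x - g x\<bar> \<le> integral\<^sup>L L01 (\<lambda>x. \<bar>f x - g x\<bar>)"
    using assms st by (intro abs_set_integral_le_01 bdd01_intros) auto
  moreover have "\<bar>LINT x:{s..t}|L01. g x\<bar> \<le> M" using assms st by (auto intro: osc_leD)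
  ultimately show "\<bar>LINT x:{s..t}|L01. f x\<bar> \<le> M + integral\<^sup>L L01 (\<lambda>x. \<bar>f x - g x\<bar>)" by linarith
qed

lemma var_leD: "var_le \<mu> B \<Longrightarrow> bdd01 g \<Longrightarrow> osc_le g M \<Longrightarrow> integral\<^sup>L \<mu> g \<le> B * M"
  by (auto simp: var_le_def)

lemma var_le_mono: assumes "var_le \<mu> B" "B \<le> B'" shows "var_le \<mu> B'"
  unfolding var_le_def
proof (intro allI impI)
  fix g M assume g: "bdd01 g \<and> osc_le g M"
  then have "integral\<^sup>L \<mu> g \<le> B * M" using var_leD[OF assms(1)] by blast
  also have "\<dots> \<le> B' * M" using g assms(2) osc_le_nonneg by (intro mult_right_mono) auto
  finally show "integral\<^sup>L \<mu> g \<le> B' * M" .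
qed

text \<open>An indicator is a test function whose interval integrals are at most the measure of its
  set. Thus the variation bound is also a bound on the density.\<close>

lemma var_le_dominated:
  assumes "fin01 \<mu>" "var_le \<mu> B" shows "dominated \<mu> L01 B"
  unfolding dominated_def
proof
  fix A assume A: "A \<in> sets M01"
  have "osc_le (indicator A) (measure L01 A)"
    using osc_le_integral_abs[OF bdd01_indicator[OF A]] integral_indicator_01[OF fin01_L01 A] by simp
  from var_leD[OF assms(2) bdd01_indicator[OF A] this] show "measure \<mu> A \<le> B * measure L01 A"
    unfolding integral_indicator_01[OF assms(1) A] .
qed

lemma var_le_mass: assumes "fin01 \<mu>" "var_le \<mu> B" shows "measure \<mu> {0..1} \<le> B" "B \<ge> 0"
proof -
  show "measure \<mu> {0..1} \<le> B"
    using var_le_dominated[OF assms] prob01_measure[of L01] sets.top[of M01]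
    by (auto simp: dominated_def prob01_def prob_space_L01 dest!: bspec[of _ _ "{0..1}"])
  then show "B \<ge> 0" using measure_nonneg order_trans by blast
qed

text \<open>Approximating g in L1 of Lebesgue measure changes the oscillation by at most the L1
  error, but it controls the \<mu>-integral only if \<mu> has bounded density. Continuous test
  functions already force that density bound, so it is derived first. Asking only for M > 0 lets
  applications divide by M.\<close>

lemma var_le_continuous:
  assumes \<mu>: "fin01 \<mu>" and le: "\<And>g M. continuous_on {0..1} g \<Longrightarrow> osc_le g M \<Longrightarrow> M > 0 \<Longrightarrow> integral\<^sup>L \<mu> g \<le> B * M"
  shows "var_le \<mu> B"
proof -
  have le0: "integral\<^sup>L \<mu> g \<le> B * M" if "continuous_on {0..1} g" "osc_le g M" for g M
  proof -
    have "M \<ge> 0" using that osc_le_nonneg by blast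
    have "integral\<^sup>L \<mu> g \<le> B * (M + 1 / real (Suc n))" for n
    proof (rule le)
      have "1 / real (Suc n) > 0" by simp
      then show "osc_le g (M + 1 / real (Suc n))" using that(2) unfolding osc_le_def
        by (meson add_increasing2 less_imp_le order_refl order_trans)
      show "0 < M + 1 / real (Suc n)" using \<open>M \<ge> 0\<close> by (simp add: add_nonneg_pos)
    qed (use that in auto)
    moreover have "(\<lambda>n. B * (M + 1 / real (Suc n))) \<longlonglongrightarrow> B * (M + 0)"
      by (intro tendsto_intros LIMSEQ_Suc lim_1_over_n)
    ultimately show ?thesis by (intro LIMSEQ_le_const[where X = "\<lambda>n. B * (M + 1 / real (Suc n))"]) auto
  qed
  have "osc_le (\<lambda>x. 1) 1" using osc_le_integral_abs[of "\<lambda>x. 1"] prob_space.prob_space[OF prob_space_L01] by simp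
  then have "integral\<^sup>L \<mu> (\<lambda>x. 1) \<le> B * 1" by (intro le) auto
  moreover have "integral\<^sup>L \<mu> (\<lambda>x. 1) \<ge> (0::real)" by simp
  ultimately have "B \<ge> 0" by linarith
  have dom: "dominated \<mu> L01 B"
  proof (rule dominated_continuous[OF \<mu> \<open>B \<ge> 0\<close>])
    fix f :: "real \<Rightarrow> real" assume f: "continuous_on {0..1} f" "\<And>x. x \<in> {0..1} \<Longrightarrow> f x \<ge> 0"
    have "integral\<^sup>L L01 (\<lambda>x. \<bar>f x\<bar>) = integral\<^sup>L L01 f"
      by (rule Bochner_Integration.integral_cong) (use f in auto)
    then show "integral\<^sup>L \<mu> f \<le> B * integral\<^sup>L L01 f"
      using osc_le_integral_abs[OF bdd01_continuous[OF f(1)]] f(1) by (intro le0) auto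
  qed
  show ?thesis unfolding var_le_def
  proof (intro allI impI, elim conjE)
    fix g M assume g: "bdd01 g" "osc_le g M"
    show "integral\<^sup>L \<mu> g \<le> B * M"
    proof (rule field_le_epsilon)
      fix e :: real assume "e > 0"
      then have e': "e / (2 * (B + 1)) > 0" using \<open>B \<ge> 0\<close> by simp
      obtain f where f: "continuous_on {0..1} f" "integral\<^sup>L L01 (\<lambda>x. \<bar>f x - g x\<bar>) < e / (2 * (B + 1))"
        using approx_continuous_L1[OF g(1) e'] by metis
      note b = bdd01_continuous[OF f(1)]
      let ?d = "integral\<^sup>L L01 (\<lambda>x. \<bar>f x - g x\<bar>)"
      have "integral\<^sup>L \<mu> g - integral\<^sup>L \<mu> f \<le> integral\<^sup>L \<mu> (\<lambda>x. \<bar>f x - g x\<bar>)"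
        unfolding integral_diff_01[OF \<mu> g(1) b, symmetric] by (intro integral_mono_01 \<mu> bdd01_intros b g) auto
      also have "\<dots> \<le> B * ?d" using \<mu> b g \<open>B \<ge> 0\<close> by (intro integral_dominated[OF \<mu> fin01_L01 dom] bdd01_intros) auto
      finally have "integral\<^sup>L \<mu> g \<le> integral\<^sup>L \<mu> f + B * ?d" by simp
      also have "integral\<^sup>L \<mu> f \<le> B * (M + ?d)" by (intro le0 f osc_le_perturb b g)
      finally have "integral\<^sup>L \<mu> g \<le> B * M + 2 * B * ?d" by (simp add: algebra_simps)
      also have "2 * B * ?d \<le> 2 * B * (e / (2 * (B + 1)))" using f(2) \<open>B \<ge> 0\<close> by (intro mult_left_mono) auto
      also have "\<dots> \<le> e" using \<open>B \<ge> 0\<close> \<open>e > 0\<close> by (simp add: field_simps)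
      finally show "integral\<^sup>L \<mu> g \<le> B * M + e" by simp
    qed
  qed
qed

lemma bv01_imp_var_le:
  assumes \<mu>: "fin01 \<mu>" and "bv01 \<mu>" obtains B where "var_le \<mu> B"
proof -
  obtain B where B: "\<And>\<phi> \<phi>'. (\<And>x. x\<in>{0..1} \<Longrightarrow> (\<phi> has_real_derivative \<phi>' x) (at x within {0..1})) \<Longrightarrow>
      continuous_on {0..1} \<phi>' \<Longrightarrow> (\<And>x. x\<in>{0..1} \<Longrightarrow> \<bar>\<phi> x\<bar> \<le> 1) \<Longrightarrow> integral\<^sup>L \<mu> \<phi>' \<le> B"
    using assms(2) unfolding bv01_def by metis
  have "var_le \<mu> B"
  proof (rule var_le_continuous[OF \<mu>])
    fix g M assume g: "continuous_on {0..1} g" "osc_le g M" "(M::real) > 0"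
    have "integral\<^sup>L \<mu> (\<lambda>x. g x / M) \<le> B"
    \<comment> \<open>The primitive from 0 is itself an interval integral, so after division by M it
      is bounded by 1.\<close>
    proof (rule B[of "\<lambda>x. integral {0..x} g / M"])
      show "continuous_on {0..1} (\<lambda>x. g x / M)" using g by (intro continuous_intros) auto
      fix x :: real assume x: "x \<in> {0..1}"
      show "((\<lambda>x. integral {0..x} g / M) has_real_derivative g x / M) (at x within {0..1})"
        by (intro DERIV_cdivide integral_has_real_derivative g x)
      have "\<bar>integral {0..x} g\<bar> \<le> M"
        using osc_leD[OF g(2), of 0 x] x bdd01_continuous[OF g(1)] by (simp add: set_integral_01_HK)
      then show "\<bar>integral {0..x} g / M\<bar> \<le> 1" using g(3) by (simp add: field_simps abs_div)
    qed
    then show "integral\<^sup>L \<mu> g \<le> B * M" using g(3) by (simp add: field_simps)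
  qed
  then show ?thesis by (rule that)
qed

lemma var_le_imp_bv01:
  assumes \<mu>: "fin01 \<mu>" and "var_le \<mu> B" shows "bv01 \<mu>"
  unfolding bv01_def
\<comment> \<open>Values in [-1, 1] bound the oscillation only by 2.\<close>
proof (intro exI[of _ "B * 2"] allI impI, elim conjE)
  fix \<phi> \<phi>' :: "real \<Rightarrow> real"
  assume d: "\<forall>x\<in>{0..1}. (\<phi> has_real_derivative \<phi>' x) (at x within {0..1})"
    and c: "continuous_on {0..1} \<phi>'" and b: "\<forall>x\<in>{0..1}. \<bar>\<phi> x\<bar> \<le> 1"
  have "osc_le \<phi>' 2" unfolding osc_le_def
  proof (intro allI impI)
    fix s t :: real assume st: "0 \<le> s \<and> s \<le> t \<and> t \<le> 1"
    have "(\<phi>' has_integral \<phi> t - \<phi> s) {s..t}"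
    proof (rule fundamental_theorem_of_calculus)
      fix x assume "x \<in> {s..t}"
      then have "(\<phi> has_real_derivative \<phi>' x) (at x within {0..1})" using d st by auto
      then show "(\<phi> has_vector_derivative \<phi>' x) (at x within {s..t})"
        using st by (auto intro: DERIV_subset simp flip: has_real_derivative_iff_has_vector_derivative)
    qed (use st in auto)
    then have "(LINT x:{s..t}|L01. \<phi>' x) = \<phi> t - \<phi> s"
      using st bdd01_continuous[OF c] by (subst set_integral_01_HK) (auto simp: integral_unique)
    moreover have "\<bar>\<phi> s\<bar> \<le> 1" "\<bar>\<phi> t\<bar> \<le> 1" using b st by auto
    ultimately show "\<bar>LINT x:{s..t}|L01. \<phi>' x\<bar> \<le> 2" by linarith
  qed
  then show "integral\<^sup>L \<mu> \<phi>' \<le> B * 2" using var_leD[OF assms(2) bdd01_continuous[OF c]] by simp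
qed

section \<open>Weak limits and partitions\<close>

lemma dominated_weak_limit:
  assumes "\<And>k. fin01 (\<mu> k)" "\<And>k. dominated (\<mu> k) L01 K" "K \<ge> 0" "fin01 \<sigma>" "weak_conv01 \<mu> \<sigma>"
  shows "dominated \<sigma> L01 K"
proof (rule dominated_continuous)
  fix f :: "real \<Rightarrow> real" assume f: "continuous_on {0..1} f" "\<And>x. x \<in> {0..1} \<Longrightarrow> f x \<ge> 0"
  have "integral\<^sup>L (\<mu> k) f \<le> K * integral\<^sup>L L01 f" for k
    using assms f by (intro integral_dominated bdd01_continuous) auto
  moreover have "(\<lambda>k. integral\<^sup>L (\<mu> k) f) \<longlonglongrightarrow> integral\<^sup>L \<sigma> f" using assms f by (simp add: weak_conv01_def)
  ultimately show "integral\<^sup>L \<sigma> f \<le> K * integral\<^sup>L L01 f" by (intro LIMSEQ_le_const2) auto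
qed (use assms in auto)

text \<open>Uniform domination makes one L1 approximation of g by a continuous function good for the
  whole sequence and for its limit. It is used for indicators, about which weak convergence by
  itself says nothing in general.\<close>

lemma weak_limit_bdd01:
  assumes \<mu>: "\<And>k. fin01 (\<mu> k)" "\<And>k. dominated (\<mu> k) L01 K" and K: "K \<ge> 0"
    and \<sigma>: "fin01 \<sigma>" "weak_conv01 \<mu> \<sigma>" and g: "bdd01 g"
  shows "(\<lambda>k. integral\<^sup>L (\<mu> k) g) \<longlonglongrightarrow> integral\<^sup>L \<sigma> g"
proof (rule LIMSEQ_I)
  fix e :: real assume "e > 0"
  then have e': "e / (3 * (K + 1)) > 0" using K by simp
  obtain f where f: "continuous_on {0..1} f" "integral\<^sup>L L01 (\<lambda>x. \<bar>f x - g x\<bar>) < e / (3 * (K + 1))"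
    using approx_continuous_L1[OF g e'] by metis
  note b = bdd01_continuous[OF f(1)]
  have close: "\<bar>integral\<^sup>L \<nu> f - integral\<^sup>L \<nu> g\<bar> < e / 3" if \<nu>: "fin01 \<nu>" "dominated \<nu> L01 K" for \<nu>
  proof -
    have "\<bar>integral\<^sup>L \<nu> f - integral\<^sup>L \<nu> g\<bar> = \<bar>integral\<^sup>L \<nu> (\<lambda>x. f x - g x)\<bar>"
      using \<nu> b g by (simp add: integral_diff_01)
    also have "\<dots> \<le> integral\<^sup>L \<nu> (\<lambda>x. \<bar>f x - g x\<bar>)" by (rule integral_abs_bound)
    also have "\<dots> \<le> K * integral\<^sup>L L01 (\<lambda>x. \<bar>f x - g x\<bar>)"
      using \<nu> b g K by (intro integral_dominated bdd01_intros) auto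
    also have "\<dots> \<le> K * (e / (3 * (K + 1)))" using f(2) K by (intro mult_left_mono) auto
    also have "\<dots> < e / 3" using K \<open>e > 0\<close> by (simp add: field_simps)
    finally show ?thesis .
  qed
  have "(\<lambda>k. integral\<^sup>L (\<mu> k) f) \<longlonglongrightarrow> integral\<^sup>L \<sigma> f" using \<sigma> f by (simp add: weak_conv01_def)
  from LIMSEQ_D[OF this, of "e / 3"] \<open>e > 0\<close> obtain n where
    n: "\<And>k. k \<ge> n \<Longrightarrow> \<bar>integral\<^sup>L (\<mu> k) f - integral\<^sup>L \<sigma> f\<bar> < e / 3" by auto
  have "norm (integral\<^sup>L (\<mu> k) g - integral\<^sup>L \<sigma> g) < e" if "k \<ge> n" for k
    using n[OF that] close[OF \<mu>[of k]] close[OF \<sigma>(1) dominated_weak_limit[OF \<mu> K \<sigma>]]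
    unfolding real_norm_def by linarith
  then show "\<exists>n. \<forall>k\<ge>n. norm (integral\<^sup>L (\<mu> k) g - integral\<^sup>L \<sigma> g) < e" by blast
qed

text \<open>Viewed on the line, the measures are tight because [0,1] carries them. The limit is
  brought back to [0,1] by the clamp \<open>?cl\<close>, and this agrees with the limit of integrals
  because test functions are extended to the line through the same clamp.\<close>

lemma helly01:
  assumes "\<And>k. prob01 (\<mu> k)"
  obtains r \<sigma> where "strict_mono (r :: nat \<Rightarrow> nat)" "prob01 \<sigma>" "weak_conv01 (\<mu> \<circ> r) \<sigma>"
proof -
  define m where "m = (\<lambda>k. distr (\<mu> k) borel (\<lambda>x. x))"
  have f: "fin01 (\<mu> k)" for k using assms prob01_fin01 by blast
  have id: "(\<lambda>x. x) \<in> measurable (\<mu> k) borel" for k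
  proof -
    have "(\<lambda>x. x) \<in> measurable M01 (borel :: real measure)"
      unfolding M01_def by (rule measurable_restrict_space1) simp
    then show ?thesis using measurable_cong_sets[OF fin01_sets[OF f] refl, of k "borel :: real measure"] by simp
  qed
  have rd: "real_distribution (m k)" for k
    using assms[of k] id[of k] unfolding m_def prob01_def by (intro prob_space.real_distribution_distr) auto
  have "tight m" unfolding tight_def
  proof (intro conjI allI impI rd)
    fix e :: real assume "e > 0"
    \<comment> \<open>Tightness uses intervals open on the left; starting at -1 keeps a possible
      atom at 0.\<close>
    have "measure (m k) {-1<..1} > 1 - e" for k
    proof -
      have "measure (m k) {-1<..1} = measure (\<mu> k) {0..1}"
        unfolding m_def using id[of k] by (subst measure_distr) (auto simp: fin01_space[OF f] intro!: arg_cong[where f = "measure (\<mu> k)"])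
      then show ?thesis using prob01_measure[OF assms, of k] \<open>e > 0\<close> by simp
    qed
    then show "\<exists>a b::real. a < b \<and> (\<forall>k. 1 - e < measure (m k) {a<..b})"
      by (intro exI[of _ "-1"] exI[of _ 1]) auto
  qed
  from tight_imp_convergent_subsubsequence[OF this strict_mono_id]
  obtain r M where r: "strict_mono (r :: nat \<Rightarrow> nat)" "real_distribution M" "weak_conv_m (m \<circ> r) M" by auto
  have r3: "weak_conv_m (\<lambda>k. m (r k)) M" using r(3) by (simp add: comp_def)
  interpret M: real_distribution M by fact
  let ?cl = "\<lambda>x::real. max 0 (min 1 x)"
  have cl: "?cl \<in> measurable M M01" unfolding M01_def
    by (intro measurable_restrict_space2) auto
  define \<sigma> where "\<sigma> = distr M M01 ?cl"
  have "prob01 \<sigma>" unfolding prob01_def \<sigma>_def by (auto intro: M.prob_space_distr cl)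
  moreover have "weak_conv01 (\<mu> \<circ> r) \<sigma>" unfolding weak_conv01_def
  proof (intro allI impI)
    fix h :: "real \<Rightarrow> real" assume h: "continuous_on {0..1} h"
    obtain R where R: "\<And>x. x \<in> {0..1} \<Longrightarrow> \<bar>h x\<bar> \<le> R" using bdd01_bound[OF bdd01_continuous[OF h]] by blast
    have c: "continuous_on UNIV (\<lambda>x. h (?cl x))"
      by (intro continuous_on_compose2[OF h] continuous_intros) auto
    then have hm: "(\<lambda>x. h (?cl x)) \<in> borel_measurable borel" by (rule borel_measurable_continuous_onI)
    have "(\<lambda>k. integral\<^sup>L ((m \<circ> r) k) (\<lambda>x. h (?cl x))) \<longlonglongrightarrow> integral\<^sup>L M (\<lambda>x. h (?cl x))"
      using rd r3 r(2) c R
      by (intro weak_conv_imp_integral_bdd_continuous_conv[where B = R]) (auto simp: continuous_on_eq_continuous_at)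
    also have "integral\<^sup>L M (\<lambda>x. h (?cl x)) = integral\<^sup>L \<sigma> h"
      unfolding \<sigma>_def using bdd01_continuous[OF h] by (subst integral_distr[OF cl]) (auto simp: bdd01_def)
    also have "(\<lambda>k. integral\<^sup>L ((m \<circ> r) k) (\<lambda>x. h (?cl x))) = (\<lambda>k. integral\<^sup>L ((\<mu> \<circ> r) k) h)"
    proof
      fix k
      show "integral\<^sup>L ((m \<circ> r) k) (\<lambda>x. h (?cl x)) = integral\<^sup>L ((\<mu> \<circ> r) k) h"
        unfolding m_def o_def
        by (subst integral_distr[OF id hm], rule Bochner_Integration.integral_cong) (auto simp: fin01_space[OF f])
    qed
    finally show "(\<lambda>k. integral\<^sup>L ((\<mu> \<circ> r) k) h) \<longlonglongrightarrow> integral\<^sup>L \<sigma> h" .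
  qed
  ultimately show thesis using that r(1) by blast
qed

section \<open>Partitions and densities of bounded variation\<close>

lemma set_integral_combine_01:
  assumes "bdd01 g" "0 \<le> a" "a \<le> b" "b \<le> c" "c \<le> 1"
  shows "(LINT x:{a..c}|L01. g x) = (LINT x:{a..b}|L01. g x) + (LINT x:{b..c}|L01. g x)"
  using assms set_integral_01_HK[OF assms(1)]
    Henstock_Kurzweil_Integration.integral_combine[of a b c g] by simp

lemma partition_locate:
  fixes p :: "nat \<Rightarrow> real"
  assumes "p 0 = 0" "p k = 1" "0 \<le> t" "t \<le> 1" "k > 0"
  obtains j where "j < k" "p j \<le> t" "t \<le> p (Suc j)"
proof -
  have "k > 0 \<Longrightarrow> t \<le> p k \<Longrightarrow> \<exists>j<k. p j \<le> t \<and> t \<le> p (Suc j)" for k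
  proof (induction k)
    case (Suc k)
    show ?case
    proof (cases "k > 0 \<and> t \<le> p k")
      case True then show ?thesis using Suc.IH less_SucI by blast
    next
      case False then show ?thesis using Suc.prems assms by (intro exI[of _ k]) auto
    qed
  qed simp
  from this[of k] show ?thesis using assms that by auto
qed

lemma partition_mono:
  fixes p :: "nat \<Rightarrow> real"
  assumes "\<And>j. j < k \<Longrightarrow> p j < p (Suc j)" "i \<le> j" "j \<le> k" shows "p i \<le> p j"
  using assms(2,3)
proof (induction j rule: dec_induct)
  case (step n) then show ?case using assms(1)[of n] by linarith
qed simp

text \<open>Vanishing integrals over the pieces make the primitive from 0 return to 0 at each
  partition point, so it is bounded by M everywhere. The difference of two of its values costs the
  factor 2.\<close>

lemma osc_le_partition:
  fixes p :: "nat \<Rightarrow> real"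
  assumes p: "p 0 = 0" "p k = 1" "\<And>j. j < k \<Longrightarrow> p j < p (Suc j)" and g: "bdd01 g"
    and zero: "\<And>j. j < k \<Longrightarrow> (LINT x:{p j..p (Suc j)}|L01. g x) = 0"
    and le: "\<And>j t. j < k \<Longrightarrow> p j \<le> t \<Longrightarrow> t \<le> p (Suc j) \<Longrightarrow> \<bar>LINT x:{p j..t}|L01. g x\<bar> \<le> M"
  shows "osc_le g (2 * M)"
proof -
  have "k > 0" using p by (cases k) auto
  have p01: "0 \<le> p j" "p j \<le> 1" if "j \<le> k" for j
    using partition_mono[of k p 0 j] partition_mono[of k p j k] p that by auto
  have z: "(LINT x:{0..p j}|L01. g x) = 0" if "j \<le> k" for j
    using that
  proof (induction j)
    case 0
    have "(LINT x:{0..0}|L01. g x) = integral {0..0} g" using g by (intro set_integral_01_HK) auto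
    then show ?case using p(1) by simp
  next
    case (Suc j)
    then show ?case using p01[of j] p01[of "Suc j"] p(3)[of j] zero[of j] g
      by (subst set_integral_combine_01[of g 0 "p j"]) auto
  qed
  have G: "\<bar>LINT x:{0..t}|L01. g x\<bar> \<le> M" if t: "0 \<le> t" "t \<le> 1" for t
  proof -
    obtain j where j: "j < k" "p j \<le> t" "t \<le> p (Suc j)" using partition_locate[OF p(1,2) t \<open>k > 0\<close>] .
    then show ?thesis using z[of j] p01[of j] g t le[OF j]
      by (subst set_integral_combine_01[of g 0 "p j"]) auto
  qed
  show ?thesis unfolding osc_le_def
  proof (intro allI impI)
    fix s t :: real assume st: "0 \<le> s \<and> s \<le> t \<and> t \<le> 1"
    have "(LINT x:{0..t}|L01. g x) = (LINT x:{0..s}|L01. g x) + (LINT x:{s..t}|L01. g x)"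
      using st g by (intro set_integral_combine_01) auto
    then show "\<bar>LINT x:{s..t}|L01. g x\<bar> \<le> 2 * M" using G[of s] G[of t] st by linarith
  qed
qed

lemma set_integral_indicator_01:
  assumes "A \<in> sets M01" "0 \<le> s" "t \<le> 1"
  shows "(LINT x:{s..t}|L01. indicator A x) = measure L01 (A \<inter> {s..t})"
proof -
  have "A \<inter> {s..t} \<in> sets M01" using assms by (auto simp: in_sets_M01)
  from integral_indicator_01[OF fin01_L01 this] show ?thesis
    unfolding set_lebesgue_integral_def indicator_inter_arith by (simp add: mult.commute)
qed

lemma set_integral_partition_sum:
  fixes p :: "nat \<Rightarrow> real"
  assumes p: "p 0 = 0" "p k = 1" "\<And>j. j < k \<Longrightarrow> p j < p (Suc j)"
    and A: "\<And>i. i < k \<Longrightarrow> A i \<in> sets M01" "\<And>i. i < k \<Longrightarrow> A i \<subseteq> {p i..p (Suc i)}"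
    and j: "j < k" "p j \<le> t" "t \<le> p (Suc j)"
  shows "(LINT x:{p j..t}|L01. (\<Sum>i<k. a i * indicator (A i) x)) = a j * measure L01 (A j \<inter> {p j..t})"
proof -
  have p01: "0 \<le> p i" "p i \<le> 1" if "i \<le> k" for i
    using partition_mono[of k p 0 i] partition_mono[of k p i k] p that by auto
  have t: "t \<le> 1" using p01[of "Suc j"] j by auto
  have "(LINT x:{p j..t}|L01. (\<Sum>i<k. a i * indicator (A i) x))
      = (\<Sum>i<k. LINT x:{p j..t}|L01. a i * indicator (A i) x)"
    unfolding set_lebesgue_integral_def scaleR_sum_right
    by (rule integral_sum_01) (use p01[of j] j t A in \<open>auto intro!: bdd01_intros simp: in_sets_M01\<close>)
  also have "\<dots> = (\<Sum>i<k. if i = j then a j * measure L01 (A j \<inter> {p j..t}) else 0)"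
  proof (rule sum.cong[OF refl])
    fix i assume "i \<in> {..<k}"
    then have i: "i < k" by simp
    have eq: "(LINT x:{p j..t}|L01. a i * indicator (A i) x) = a i * measure L01 (A i \<inter> {p j..t})"
      using set_integral_indicator_01[OF A(1)[OF i], of "p j" t] p01[of j] j t by simp
    have "measure L01 (A i \<inter> {p j..t}) = 0" if "i \<noteq> j"
    proof -
      \<comment> \<open>Neighbouring closed pieces may share an endpoint, so the overlap is null
        rather than empty.\<close>
      have "A i \<inter> {p j..t} \<subseteq> {p j, p (Suc j)}"
      proof (cases "i < j")
        case True
        then have "p (Suc i) \<le> p j" using partition_mono[of k p "Suc i" j] p(3) j by simp
        then show ?thesis using A(2)[OF i] by force
      next
        case False
        then have "p (Suc j) \<le> p i" using partition_mono[of k p "Suc j" i] p(3) i that by simp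
        then show ?thesis using A(2)[OF i] j by force
      qed
      moreover have "{p j, p (Suc j)} \<in> sets M01" using p01[of j] p01[of "Suc j"] j by (auto simp: in_sets_M01)
      moreover have "measure L01 {p j, p (Suc j)} = 0"
        using \<open>{p j, p (Suc j)} \<in> sets M01\<close> by (simp add: measure_L01 measure_eq_0_null_sets finite_imp_null_set_lborel)
      ultimately show ?thesis using fin01_measure_mono[OF fin01_L01, of "A i \<inter> {p j..t}"] measure_nonneg
        by (metis order_antisym)
    qed
    then show "(LINT x:{p j..t}|L01. a i * indicator (A i) x) = (if i = j then a j * measure L01 (A j \<inter> {p j..t}) else 0)"
      unfolding eq by auto
  qed
  also have "\<dots> = a j * measure L01 (A j \<inter> {p j..t})" using j by (simp add: sum.delta)
  finally show ?thesis .
qed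

lemma measure_L01_interval: "0 \<le> a \<Longrightarrow> a \<le> b \<Longrightarrow> b \<le> 1 \<Longrightarrow> measure L01 {a..b} = b - a"
  by (simp add: measure_L01 in_sets_M01)

lemma abs_set_integral_le_length:
  assumes "bdd01 g" "\<And>x. x \<in> {0..1} \<Longrightarrow> \<bar>g x\<bar> \<le> R" "0 \<le> a" "a \<le> b" "b \<le> 1"
  shows "\<bar>LINT x:{a..b}|L01. g x\<bar> \<le> R * (b - a)"
proof -
  have s: "{a..b} \<in> sets M01" using assms by (auto simp: in_sets_M01)
  have "\<bar>LINT x:{a..b}|L01. g x\<bar> \<le> (\<integral>x. \<bar>indicator {a..b} x * g x\<bar> \<partial>L01)"
    unfolding set_lebesgue_integral_def real_scaleR_def by (intro integral_abs_bound)
  also have "\<dots> \<le> (\<integral>x. R * indicator {a..b} x \<partial>L01)"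
    using assms(2) by (intro integral_mono_01 bdd01_intros assms s fin01_L01) (auto simp: indicator_def)
  also have "\<dots> = R * (b - a)" using integral_indicator_01[OF fin01_L01 s] measure_L01_interval[OF assms(3-5)] by simp
  finally show ?thesis .
qed

lemma uniform_partition:
  fixes N :: nat assumes "N > 0"
  shows "real 0 / real N = 0" "real N / real N = 1" "real j / real N < real (Suc j) / real N"
    "real (Suc j) / real N - real j / real N = 1 / real N"
    "j < N \<Longrightarrow> {real j / real N..real (Suc j) / real N} \<in> sets M01"
  using assms by (auto simp: field_simps in_sets_M01 intro: order_trans)

lemma osc_le_uminus: "osc_le g M \<Longrightarrow> osc_le (\<lambda>x. - g x) M"
  unfolding osc_le_def set_lebesgue_integral_def scaleR_minus_right Bochner_Integration.integral_minus abs_minus_cancel .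

text \<open>A density of bounded variation and mass 1 is at least 1/2 almost everywhere on some
  interval. Otherwise each of N equal intervals contains a set A j with more than twice as much
  Lebesgue measure as \<nu>-measure. Moving the Lebesgue mass of every interval onto its A j gives a
  test function g with primitive of size 1 / N, yet the integral of g under \<nu> stays at least
  1/2.\<close>

lemma var_le_interval_lower_bound:
  assumes \<nu>: "prob01 \<nu>" "var_le \<nu> B"
  obtains a b where "0 \<le> a" "a < b" "b \<le> 1"
    "\<And>A. A \<in> sets M01 \<Longrightarrow> A \<subseteq> {a..b} \<Longrightarrow> measure L01 A \<le> 2 * measure \<nu> A"
proof -
  note interval = that
  \<comment> \<open>N > 4 * B makes the variation estimate 2 * B / N smaller than 1/2.\<close>
  obtain N :: nat where N: "real N > 4 * B" "N > 0"
    using reals_Archimedean2[of "max 1 (4 * B)"] by (metis (no_types) gr0I max_less_iff_conj not_one_less_zero of_nat_0)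
  define p where "p = (\<lambda>j. real j / real N)"
  have p: "real j / real N = p j" for j by (simp add: p_def)
  note up = uniform_partition[OF N(2), unfolded p]
  note f\<nu> = prob01_fin01[OF \<nu>(1)]
  show thesis
  proof (rule ccontr)
    assume neg: "\<not> thesis"
    have "\<exists>A. A \<in> sets M01 \<and> A \<subseteq> {p j..p (Suc j)} \<and> measure L01 A > 2 * measure \<nu> A" if "j < N" for j
    proof (rule ccontr)
      assume "\<nexists>A. A \<in> sets M01 \<and> A \<subseteq> {p j..p (Suc j)} \<and> 2 * measure \<nu> A < measure L01 A"
      then have "\<And>A. A \<in> sets M01 \<Longrightarrow> A \<subseteq> {p j..p (Suc j)} \<Longrightarrow> measure L01 A \<le> 2 * measure \<nu> A"
        by (meson linorder_not_less)
      moreover have "0 \<le> p j" "p (Suc j) \<le> 1" using up(5)[OF that] up(3)[of j] by (auto simp: in_sets_M01)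
      ultimately show False using neg interval up(3)[of j] by blast
    qed
    then obtain A where A: "\<And>j. j < N \<Longrightarrow> A j \<in> sets M01" "\<And>j. j < N \<Longrightarrow> A j \<subseteq> {p j..p (Suc j)}"
      "\<And>j. j < N \<Longrightarrow> measure L01 (A j) > 2 * measure \<nu> (A j)" by metis
    have mp: "measure L01 (A j) > 0" if "j < N" for j
      using A(3)[OF that] measure_nonneg[of \<nu> "A j"] by linarith
    \<comment> \<open>With these weights g has Lebesgue integral 0 over each piece, while each A i
      contributes at most 1 / (2 * N) to the subtracted \<nu>-mass.\<close>
    define a where "a = (\<lambda>j. 1 / (real N * measure L01 (A j)))"
    define g where "g = (\<lambda>x. 1 - (\<Sum>i<N. a i * indicator (A i) x))"
    have bs: "bdd01 (\<lambda>x. (\<Sum>i<N. a i * indicator (A i) x))" by (intro bdd01_intros A) simp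
    then have bg: "bdd01 g" unfolding g_def by (auto intro!: bdd01_intros)
    have int: "(LINT x:{p j..t}|L01. g x) = (t - p j) - a j * measure L01 (A j \<inter> {p j..t})"
      if j: "j < N" "p j \<le> t" "t \<le> p (Suc j)" for j t
    proof -
      have s: "{p j..t} \<subseteq> {0..1}" "0 \<le> p j" "t \<le> 1" using up(5)[OF j(1)] j by (auto simp: in_sets_M01)
      have "(LINT x:{p j..t}|L01. g x) = (LINT x:{p j..t}|L01. (1::real)) - (LINT x:{p j..t}|L01. (\<Sum>i<N. a i * indicator (A i) x))"
        unfolding g_def by (intro set_integral_diff_01 bs s) auto
      also have "(LINT x:{p j..t}|L01. (1::real)) = integral {p j..t} (\<lambda>x. 1)"
        using s by (intro set_integral_01_HK) auto
      also have "\<dots> = t - p j" using j by simp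
      also have "(LINT x:{p j..t}|L01. (\<Sum>i<N. a i * indicator (A i) x)) = a j * measure L01 (A j \<inter> {p j..t})"
        by (rule set_integral_partition_sum[where k = N and p = p]) (use up A j in auto)
      finally show ?thesis .
    qed
    have "osc_le g (2 * (1 / real N))"
    proof (rule osc_le_partition[where k = N and p = p])
      show "(LINT x:{p j..p (Suc j)}|L01. g x) = 0" if "j < N" for j
        using int[of j "p (Suc j)"] up(3,4)[of j] A(2)[OF that] mp[OF that] that
        by (simp add: Int_absorb2 a_def)
      fix j t assume j: "j < N" "p j \<le> t" "t \<le> p (Suc j)"
      have "measure L01 (A j \<inter> {p j..t}) \<le> measure L01 (A j)"
        using A j by (intro fin01_measure_mono) auto
      then have "a j * measure L01 (A j \<inter> {p j..t}) \<le> 1 / real N" "a j * measure L01 (A j \<inter> {p j..t}) \<ge> 0"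
        using mp[OF j(1)] N(2) by (auto simp: a_def field_simps)
      then show "\<bar>LINT x:{p j..t}|L01. g x\<bar> \<le> 1 / real N"
        unfolding int[OF j] using j up(4)[of j] by linarith
    qed (use up bg in auto)
    then have "integral\<^sup>L \<nu> g \<le> B * (2 * (1 / real N))" using \<nu>(2) bg by (intro var_leD)
    also have "\<dots> < 1 / 2" using N by (simp add: field_simps)
    finally have "integral\<^sup>L \<nu> g < 1 / 2" .
    moreover have "integral\<^sup>L \<nu> g = integral\<^sup>L \<nu> (\<lambda>x. 1) - (\<Sum>i<N. a i * measure \<nu> (A i))"
      unfolding g_def
    proof (subst integral_diff_01[OF f\<nu> _ bs])
      have "integral\<^sup>L \<nu> (\<lambda>x. \<Sum>i<N. a i * indicator (A i) x) = (\<Sum>i<N. integral\<^sup>L \<nu> (\<lambda>x. a i * indicator (A i) x))"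
        using A f\<nu> by (intro integral_sum_01) (auto intro!: bdd01_intros)
      also have "\<dots> = (\<Sum>i<N. a i * measure \<nu> (A i))"
        using A f\<nu> by (intro sum.cong refl) (simp add: integral_indicator_01[unfolded fin01_space] fin01_sets)
      finally show "integral\<^sup>L \<nu> (\<lambda>x. 1) - integral\<^sup>L \<nu> (\<lambda>x. \<Sum>i<N. a i * indicator (A i) x) =
        integral\<^sup>L \<nu> (\<lambda>x. 1) - (\<Sum>i<N. a i * measure \<nu> (A i))" by simp
    qed auto
    moreover have "integral\<^sup>L \<nu> (\<lambda>x. 1) = (1::real)" using prob01_measure[OF \<nu>(1)] fin01_space[OF f\<nu>] by simp
    moreover have "(\<Sum>i<N. a i * measure \<nu> (A i)) \<le> (\<Sum>i<N. 1 / (2 * real N))"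
    proof (rule sum_mono)
      fix i assume "i \<in> {..<N}"
      then show "a i * measure \<nu> (A i) \<le> 1 / (2 * real N)"
        using A(3)[of i] mp[of i] N(2) by (simp add: a_def field_simps)
    qed
    ultimately show False using N(2) by simp
  qed
qed

text \<open>Let s replace g by its averages over N equal intervals. Uniformly in g, the primitive of
  g - s has size at most 2 / N, hence oscillation at most 4 / N, so g - s contributes at most 4 * B
  / N under either measure. The integrals of s depend only on N interval masses. This is how
  finitely many limits control the total variation distance.\<close>

lemma var_le_step_approx:
  assumes \<mu>: "fin01 \<mu>" "var_le \<mu> B" and \<nu>: "fin01 \<nu>" "var_le \<nu> B" and N: "N > 0"
    and g: "bdd01 g" "\<And>x. x \<in> {0..1} \<Longrightarrow> \<bar>g x\<bar> \<le> 1"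
  shows "\<bar>integral\<^sup>L \<mu> g - integral\<^sup>L \<nu> g\<bar> \<le> 8 * B / real N
    + (\<Sum>j<N. \<bar>measure \<mu> {real j / real N..real (Suc j) / real N} - measure \<nu> {real j / real N..real (Suc j) / real N}\<bar>)"
proof -
  define p where "p = (\<lambda>j. real j / real N)"
  have p: "real j / real N = p j" for j by (simp add: p_def)
  note up = uniform_partition[OF N, unfolded p]
  define I where "I = (\<lambda>j. {p j..p (Suc j)})"
  have I: "I j \<in> sets M01" if "j < N" for j using up(5)[OF that] unfolding I_def .
  have I01: "I j \<subseteq> {0..1}" if "j < N" for j using I[OF that] by (simp add: in_sets_M01)
  have le: "\<bar>LINT x:{p j..t}|L01. g x\<bar> \<le> 1 / real N" if j: "j < N" "p j \<le> t" "t \<le> p (Suc j)" for j t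
  proof -
    have "\<bar>LINT x:{p j..t}|L01. g x\<bar> \<le> 1 * (t - p j)"
      using I01[OF j(1)] j by (intro abs_set_integral_le_length[OF g]) (auto simp: I_def)
    also have "\<dots> \<le> p (Suc j) - p j" using j by simp
    finally show ?thesis unfolding up(4) .
  qed
  define c where "c = (\<lambda>j. real N * (LINT x:I j|L01. g x))"
  have c: "\<bar>c j\<bar> \<le> 1" if "j < N" for j
    using le[OF that, of "p (Suc j)"] up(3)[of j] N by (simp add: c_def I_def abs_mult field_simps)
  define s where "s = (\<lambda>x. \<Sum>i<N. c i * indicator (I i) x)"
  have bs: "bdd01 s" unfolding s_def by (intro bdd01_intros I) simp
  have int: "(LINT x:{p j..t}|L01. g x - s x) = (LINT x:{p j..t}|L01. g x) - c j * (t - p j)"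
      if j: "j < N" "p j \<le> t" "t \<le> p (Suc j)" for j t
  proof -
    have st: "{p j..t} \<subseteq> {0..1}" using I01[OF j(1)] j by (auto simp: I_def)
    have "(LINT x:{p j..t}|L01. s x) = c j * measure L01 (I j \<inter> {p j..t})" unfolding s_def
      by (rule set_integral_partition_sum[where k = N and p = p]) (use up I j in \<open>auto simp: I_def\<close>)
    also have "I j \<inter> {p j..t} = {p j..t}" using j by (auto simp: I_def)
    also have "measure L01 {p j..t} = t - p j" using st j by (subst measure_L01_interval) auto
    finally show ?thesis using set_integral_diff_01[OF g(1) bs st] by simp
  qed
  have osc: "osc_le (\<lambda>x. g x - s x) (2 * (2 / real N))"
  proof (rule osc_le_partition[where k = N and p = p])
    show "(LINT x:{p j..p (Suc j)}|L01. g x - s x) = 0" if "j < N" for j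
      using int[of j "p (Suc j)"] up(3,4)[of j] that N by (simp add: c_def I_def)
    fix j t assume j: "j < N" "p j \<le> t" "t \<le> p (Suc j)"
    have "\<bar>c j * (t - p j)\<bar> \<le> 1 * (1 / real N)" unfolding abs_mult
      using c[OF j(1)] j up(4)[of j] by (intro mult_mono) auto
    then show "\<bar>LINT x:{p j..t}|L01. g x - s x\<bar> \<le> 2 / real N"
      unfolding int[OF j] using le[OF j] by linarith
  qed (use up g bs in \<open>auto intro: bdd01_intros\<close>)
  have osc': "osc_le (\<lambda>x. - (g x - s x)) (2 * (2 / real N))"
    by (rule osc_le_uminus[OF osc])
  have b: "bdd01 (\<lambda>x. g x - s x)" using g bs by (intro bdd01_intros)
  have small: "\<bar>integral\<^sup>L \<rho> (\<lambda>x. g x - s x)\<bar> \<le> 4 * B / real N" if "var_le \<rho> B" for \<rho>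
  proof -
    have "B * (2 * (2 / real N)) = 4 * B / real N" by simp
    then show ?thesis using var_leD[OF that b osc]
        var_leD[OF that bdd01_uminus[OF b] osc', unfolded Bochner_Integration.integral_minus] by linarith
  qed
  have split: "integral\<^sup>L \<rho> g = integral\<^sup>L \<rho> (\<lambda>x. g x - s x) + (\<Sum>j<N. c j * measure \<rho> (I j))" if \<rho>: "fin01 \<rho>" for \<rho>
  proof -
    have "integral\<^sup>L \<rho> s = (\<Sum>j<N. integral\<^sup>L \<rho> (\<lambda>x. c j * indicator (I j) x))" unfolding s_def
      using I \<rho> by (intro integral_sum_01) (auto intro!: bdd01_intros)
    also have "\<dots> = (\<Sum>j<N. c j * measure \<rho> (I j))"
      using integral_indicator_01[OF \<rho> I] by (intro sum.cong refl) simp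
    finally show ?thesis using integral_diff_01[OF \<rho> g(1) bs] by simp
  qed
  have "\<bar>(\<Sum>j<N. c j * measure \<mu> (I j)) - (\<Sum>j<N. c j * measure \<nu> (I j))\<bar>
      = \<bar>\<Sum>j<N. c j * (measure \<mu> (I j) - measure \<nu> (I j))\<bar>" by (simp add: sum_subtractf right_diff_distrib)
  also have "\<dots> \<le> (\<Sum>j<N. \<bar>c j * (measure \<mu> (I j) - measure \<nu> (I j))\<bar>)" by (rule sum_abs)
  also have "\<dots> \<le> (\<Sum>j<N. \<bar>measure \<mu> (I j) - measure \<nu> (I j)\<bar>)"
    using c by (intro sum_mono) (auto simp: abs_mult intro!: mult_left_le_one_le)
  finally show ?thesis
    using split[OF \<mu>(1)] split[OF \<nu>(1)] small[OF \<mu>(2)] small[OF \<nu>(2)] unfolding I_def p_def by argo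
qed

section \<open>Image measures and the Lasota-Yorke inequality\<close>

lemma integral_distr_01:
  assumes "fin01 \<mu>" "S \<in> measurable M01 M01" "bdd01 g"
  shows "integral\<^sup>L (distr \<mu> M01 S) g = integral\<^sup>L \<mu> (\<lambda>x. g (S x))"
  using assms by (intro integral_distr) (auto simp: bdd01_def fin01_sets cong: measurable_cong_sets)

lemma fin01_distr:
  assumes "fin01 \<mu>" "S \<in> measurable M01 M01" shows "fin01 (distr \<mu> M01 S)"
  using assms unfolding fin01_def
  by (auto intro!: finite_measure.finite_measure_distr cong: measurable_cong_sets)

lemma measure_distr_01:
  assumes "fin01 \<mu>" "S \<in> measurable M01 M01" "A \<in> sets M01"
  shows "measure (distr \<mu> M01 S) A = measure \<mu> (S -` A \<inter> {0..1})"
  using assms by (subst measure_distr) (auto simp: fin01_sets fin01_space cong: measurable_cong_sets)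

lemma vimage_sets_01: "S \<in> measurable M01 M01 \<Longrightarrow> A \<in> sets M01 \<Longrightarrow> S -` A \<inter> {0..1} \<in> sets M01"
  using measurable_sets[of S M01 M01 A] by simp

lemma maps_01: "S \<in> measurable M01 M01 \<Longrightarrow> x \<in> {0..1} \<Longrightarrow> S x \<in> {0..1}"
  using measurable_space[of S M01 M01 x] by simp

lemma integral_indicator_compose_01:
  assumes "fin01 \<mu>" "S \<in> measurable M01 M01" "A \<in> sets M01"
  shows "(\<integral>x. indicator A (S x) \<partial>\<mu>) = measure \<mu> (S -` A \<inter> {0..1})"
  using integral_distr_01[OF assms(1,2) bdd01_indicator[OF assms(3)]] measure_distr_01[OF assms]
    integral_indicator_01[OF fin01_distr[OF assms(1,2)] assms(3)] by simp

lemma measurable_funpow_01: "S \<in> measurable M01 M01 \<Longrightarrow> (S ^^ t) \<in> measurable M01 M01"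
  by (induction t) (auto intro: measurable_comp)

lemma distr_mass_01: "fin01 \<mu> \<Longrightarrow> S \<in> measurable M01 M01 \<Longrightarrow> measure (distr \<mu> M01 S) {0..1} = measure \<mu> {0..1}"
  using measure_distr_01[of \<mu> S "{0..1}"] maps_01[of S] sets.top[of M01]
  by (auto intro!: arg_cong[where f = "measure \<mu>"])

text \<open>Variation plays the strong norm and total mass the weak one. The inequality is phrased
  for image measures, so that no transfer operator on densities appears.\<close>

definition lasota_yorke :: "(real \<Rightarrow> real) \<Rightarrow> real \<Rightarrow> real \<Rightarrow> bool" where
  "lasota_yorke S \<rho> C \<longleftrightarrow> S \<in> measurable M01 M01 \<and> 0 \<le> \<rho> \<and> \<rho> < 1 \<and> 0 \<le> C \<and>
    (\<forall>\<mu> B. fin01 \<mu> \<and> var_le \<mu> B \<longrightarrow> var_le (distr \<mu> M01 S) (\<rho> * B + C * measure \<mu> {0..1}))"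

lemma lasota_yorke_measurable: "lasota_yorke S \<rho> C \<Longrightarrow> S \<in> measurable M01 M01"
  by (simp add: lasota_yorke_def)

text \<open>D = C / (1 - \<rho>) solves D = \<rho> * D + C, so the mass term reproduces itself
  exactly while the initial bound B decays like \<rho> ^ t.\<close>

lemma lasota_yorke_iterate:
  assumes S: "lasota_yorke S \<rho> C" and \<mu>: "fin01 \<mu>" "var_le \<mu> B"
  shows "var_le (distr \<mu> M01 (S ^^ t)) (\<rho> ^ t * B + C / (1 - \<rho>) * measure \<mu> {0..1})"
proof (induction t)
  case 0
  have "distr \<mu> M01 (S ^^ 0) = \<mu>" using fin01_sets[OF \<mu>(1)] by (simp add: id_def distr_id2)
  moreover have "C / (1 - \<rho>) * measure \<mu> {0..1} \<ge> 0" using S by (simp add: lasota_yorke_def)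
  moreover have "var_le \<mu> (B + D)" if "D \<ge> 0" for D using that by (intro var_le_mono[OF \<mu>(2)]) simp
  ultimately show ?case by (simp only: power_0 mult_1)
next
  case (Suc t)
  note m = lasota_yorke_measurable[OF S]
  note mt = measurable_funpow_01[OF m, of t]
  let ?m = "measure \<mu> {0..1}"
  have "distr (distr \<mu> M01 (S ^^ t)) M01 S = distr \<mu> M01 (S ^^ Suc t)"
    using m mt \<mu>(1) by (subst distr_distr) (auto simp: fin01_sets cong: measurable_cong_sets)
  moreover have "var_le (distr (distr \<mu> M01 (S ^^ t)) M01 S)
      (\<rho> * (\<rho> ^ t * B + C / (1 - \<rho>) * ?m) + C * ?m)"
    using S Suc fin01_distr[OF \<mu>(1) mt] distr_mass_01[OF \<mu>(1) mt] unfolding lasota_yorke_def by metis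
  moreover have "\<rho> * (\<rho> ^ t * B + C / (1 - \<rho>) * ?m) + C * ?m = \<rho> ^ Suc t * B + C / (1 - \<rho>) * ?m"
    using S by (simp add: lasota_yorke_def field_simps)
  ultimately show ?case by metis
qed

section \<open>Absolutely continuous invariant measures\<close>

text \<open>Only absolute continuity is demanded, because it visibly passes to the positive part of
  a difference of measures; bounded variation is recovered by \<open>inv01_var_le\<close>.\<close>

definition inv01 :: "(real \<Rightarrow> real) \<Rightarrow> real measure \<Rightarrow> bool" where
  "inv01 S \<mu> \<longleftrightarrow> prob01 \<mu> \<and> absolutely_continuous L01 \<mu> \<and> distr \<mu> M01 S = \<mu>"

text \<open>Ergodicity expressed as minimality for absolute continuity. In this form it identifies
  limit points of Cesaro means, which are known only to be invariant and dominated by a multiple of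
  \<nu>.\<close>

definition ergodic01 :: "(real \<Rightarrow> real) \<Rightarrow> real measure \<Rightarrow> bool" where
  "ergodic01 S \<nu> \<longleftrightarrow> inv01 S \<nu> \<and> (\<forall>\<mu>. inv01 S \<mu> \<and> absolutely_continuous \<nu> \<mu> \<longrightarrow> \<mu> = \<nu>)"

lemma inv01D: "inv01 S \<mu> \<Longrightarrow> prob01 \<mu>" "inv01 S \<mu> \<Longrightarrow> fin01 \<mu>" "inv01 S \<mu> \<Longrightarrow> absolutely_continuous L01 \<mu>"
  by (auto simp: inv01_def prob01_fin01)

lemma null_sets_01: "fin01 \<mu> \<Longrightarrow> A \<in> null_sets \<mu> \<longleftrightarrow> A \<in> sets M01 \<and> measure \<mu> A = 0"
  using fin01_finite[of \<mu>] by (auto simp: null_sets_def fin01_sets finite_measure.emeasure_eq_measure)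

lemma absolutely_continuous_01:
  "fin01 \<nu> \<Longrightarrow> fin01 \<mu> \<Longrightarrow> absolutely_continuous \<nu> \<mu> \<longleftrightarrow> (\<forall>A\<in>sets M01. measure \<nu> A = 0 \<longrightarrow> measure \<mu> A = 0)"
  unfolding absolutely_continuous_def by (auto simp: null_sets_01 subset_iff)

lemma dominated_absolutely_continuous:
  assumes "fin01 \<nu>" "fin01 \<mu>" "dominated \<mu> \<nu> K" shows "absolutely_continuous \<nu> \<mu>"
  unfolding absolutely_continuous_01[OF assms(1,2)]
proof (intro ballI impI)
  fix A assume "A \<in> sets M01" "measure \<nu> A = 0"
  then have "measure \<mu> A \<le> 0" using assms(3) by (auto simp: dominated_def)
  then show "measure \<mu> A = 0" using measure_nonneg[of \<mu> A] by linarith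
qed

section \<open>Approximation by smooth densities\<close>

lemma density_01:
  assumes \<mu>: "fin01 \<mu>" and ac: "absolutely_continuous L01 \<mu>"
  obtains h where "h \<in> borel_measurable M01" "\<And>x. 0 \<le> h x" "integrable L01 h"
    "\<And>g. bdd01 g \<Longrightarrow> integral\<^sup>L \<mu> g = (\<integral>x. h x * g x \<partial>L01)"
proof -
  interpret L: prob_space L01 by (rule prob_space_L01)
  have s: "sets \<mu> = sets L01" using \<mu> by (simp add: fin01_sets)
  obtain h where h: "h \<in> borel_measurable L01" "AE x in L01. RN_deriv L01 \<mu> x = ennreal (h x)" "\<And>x. 0 \<le> h x"
    using L.real_RN_deriv[OF fin01_finite[OF \<mu>] ac s] by metis
  have "\<mu> = density L01 (RN_deriv L01 \<mu>)" using L.density_RN_deriv[OF ac s] by simp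
  also have "\<dots> = density L01 (\<lambda>x. ennreal (h x))" using h by (intro density_cong) auto
  finally have eq: "\<mu> = density L01 (\<lambda>x. ennreal (h x))" .
  have "(\<integral>\<^sup>+x. ennreal (h x) \<partial>L01) = emeasure \<mu> {0..1}"
    using h(1) sets.top[of M01] by (subst eq, subst emeasure_density) (auto intro!: nn_integral_cong simp: indicator_def)
  also have "\<dots> < \<infinity>" using \<mu> by (simp add: fin01_def finite_measure.emeasure_eq_measure)
  finally have "integrable L01 h" using h by (intro integrableI_nonneg) auto
  moreover have "integral\<^sup>L \<mu> g = (\<integral>x. h x * g x \<partial>L01)" if "bdd01 g" for g
    using h bdd01_borel[OF fin01_L01 that] by (subst eq) (simp add: integral_density)
  moreover have "h \<in> borel_measurable M01" using h(1) by (simp cong: measurable_cong_sets)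
  ultimately show thesis using that h(3) by blast
qed

text \<open>Subtracting the mid-range of a primitive turns oscillation M into sup norm M / 2. This
  saves a factor 2: the two end terms on a branch of an expanding map then add up to M /
  \<lambda>.\<close>

lemma centered_primitive:
  assumes g: "continuous_on {0..1} g" "osc_le g M"
  obtains \<phi> where "\<And>x. x \<in> {0..1} \<Longrightarrow> (\<phi> has_real_derivative g x) (at x)"
    "\<And>x. x \<in> {0..1} \<Longrightarrow> \<bar>\<phi> x\<bar> \<le> M / 2"
proof -
  \<comment> \<open>Extending g by constants makes the primitive differentiable from both sides at 0
    and 1.\<close>
  define G where "G = (\<lambda>x. g (max 0 (min 1 x)))"
  have G: "continuous_on S G" for S unfolding G_def
    by (intro continuous_on_compose2[OF g(1)] continuous_intros) auto
  define F where "F = (\<lambda>x. integral {-1..x} G)"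
  have F: "(F has_real_derivative g x) (at x)" if "x \<in> {0..1}" for x
  proof -
    have "(F has_real_derivative G x) (at x within {-1..2})" unfolding F_def
      using that by (intro integral_has_real_derivative G) auto
    moreover have "at x within {-1..2} = at x" using that by (intro at_within_interior) auto
    ultimately show ?thesis using that by (simp add: G_def)
  qed
  have diff: "F t - F s = (LINT x:{s..t}|L01. g x)" if "0 \<le> s" "s \<le> t" "t \<le> 1" for s t
  proof -
    have "(g has_integral F t - F s) {s..t}"
    proof (rule fundamental_theorem_of_calculus)
      fix x assume "x \<in> {s..t}"
      then show "(F has_vector_derivative g x) (at x within {s..t})"
        using F[of x] that by (auto intro: has_field_derivative_at_within simp flip: has_real_derivative_iff_has_vector_derivative)
    qed (use that in auto)
    then show ?thesis using that bdd01_continuous[OF g(1)] by (simp add: set_integral_01_HK(1) integral_unique)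
  qed
  have osc: "\<bar>F t - F s\<bar> \<le> M" if "s \<in> {0..1}" "t \<in> {0..1}" for s t
    using that diff[of s t] diff[of t s] osc_leD[OF g(2), of s t] osc_leD[OF g(2), of t s]
    by (cases "s \<le> t") auto
  have cF: "continuous_on {0..1} F" by (intro continuous_at_imp_continuous_on ballI DERIV_isCont[OF F])
  obtain u where u: "u \<in> {0..1}" "\<And>x. x \<in> {0..1} \<Longrightarrow> F x \<le> F u"
    using continuous_attains_sup[OF compact_Icc _ cF] by auto
  obtain l where l: "l \<in> {0..1}" "\<And>x. x \<in> {0..1} \<Longrightarrow> F l \<le> F x"
    using continuous_attains_inf[OF compact_Icc _ cF] by auto
  show thesis
  proof (rule that[of "\<lambda>x. F x - (F u + F l) / 2"])
    fix x :: real assume x: "x \<in> {0..1}"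
    show "((\<lambda>x. F x - (F u + F l) / 2) has_real_derivative g x) (at x)"
      using DERIV_diff[OF F[OF x] DERIV_const] by simp
    show "\<bar>F x - (F u + F l) / 2\<bar> \<le> M / 2"
      using u(2)[OF x] l(2)[OF x] osc[OF l(1) u(1)] by (auto simp: abs_le_iff field_simps)
  qed
qed

text \<open>Integration by parts against the centered primitive: the boundary values cost (p 0 + p
  1) * M / 2 and the integral containing p' costs R * M / 2.\<close>

lemma var_le_density_C1:
  assumes p: "\<And>x. x \<in> {0..1} \<Longrightarrow> p x \<ge> 0" "\<And>x. x \<in> {0..1} \<Longrightarrow> (p has_real_derivative p' x) (at x)"
    and p': "continuous_on {0..1} p'"
  obtains B where "fin01 (density L01 p)" "var_le (density L01 p) B"
    "\<And>g. bdd01 g \<Longrightarrow> integral\<^sup>L (density L01 p) g = (\<integral>x. p x * g x \<partial>L01)"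
proof -
  have b: "bdd01 p" by (intro bdd01_continuous continuous_at_imp_continuous_on ballI DERIV_isCont[OF p(2)])
  have int: "integral\<^sup>L (density L01 p) g = (\<integral>x. p x * g x \<partial>L01)" if "bdd01 g" for g
  proof -
    have "AE x in L01. 0 \<le> p x" using p(1) by (intro AE_I2) simp
    then show ?thesis
      using bdd01_borel[OF fin01_L01 that] bdd01_borel[OF fin01_L01 b] by (simp add: integral_density)
  qed
  have "emeasure (density L01 p) (space L01) = (\<integral>\<^sup>+x. ennreal (p x) \<partial>L01)"
    using bdd01_borel[OF fin01_L01 b] sets.top[of M01]
    by (subst emeasure_density) (auto intro!: nn_integral_cong simp: indicator_def)
  also have "\<dots> = ennreal (integral\<^sup>L L01 p)"
    using p(1) by (intro nn_integral_eq_integral bdd01_integrable b AE_I2) auto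
  finally have f: "fin01 (density L01 p)" by (auto simp: fin01_def intro!: finite_measureI)
  obtain R where R: "\<And>x. x \<in> {0..1} \<Longrightarrow> \<bar>p' x\<bar> \<le> R" using bdd01_bound[OF bdd01_continuous[OF p']] by blast
  have "var_le (density L01 p) ((p 0 + p 1 + R) / 2)"
  proof (rule var_le_continuous[OF f])
    fix g M assume g: "continuous_on {0..1} g" "osc_le g M" "(M::real) > 0"
    note bg = bdd01_continuous[OF g(1)]
    obtain \<phi> where \<phi>: "\<And>x. x \<in> {0..1} \<Longrightarrow> (\<phi> has_real_derivative g x) (at x)"
      "\<And>x. x \<in> {0..1} \<Longrightarrow> \<bar>\<phi> x\<bar> \<le> M / 2" using centered_primitive[OF g(1,2)] by blast
    have b\<phi>: "bdd01 \<phi>" by (intro bdd01_continuous continuous_at_imp_continuous_on ballI DERIV_isCont[OF \<phi>(1)])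
    have b1: "bdd01 (\<lambda>x. p x * g x)" and b2: "bdd01 (\<lambda>x. \<phi> x * p' x)"
      by (intro bdd01_intros b b\<phi> bg bdd01_continuous[OF p'])+
    have "((\<lambda>x. p x * g x + \<phi> x * p' x) has_integral \<phi> 1 * p 1 - \<phi> 0 * p 0) {0..1}"
    proof (rule fundamental_theorem_of_calculus)
      fix x :: real assume x: "x \<in> {0..1}"
      have "((\<lambda>x. \<phi> x * p x) has_real_derivative p x * g x + \<phi> x * p' x) (at x)"
        by (rule DERIV_mult'[OF \<phi>(1)[OF x] p(2)[OF x], THEN DERIV_cong]) simp
      then show "((\<lambda>x. \<phi> x * p x) has_vector_derivative p x * g x + \<phi> x * p' x) (at x within {0..1})"
        by (auto intro: has_field_derivative_at_within simp flip: has_real_derivative_iff_has_vector_derivative)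
    qed simp
    then have "(LINT x:{0..1}|L01. p x * g x + \<phi> x * p' x) = \<phi> 1 * p 1 - \<phi> 0 * p 0"
      using set_integral_01_HK(1)[OF bdd01_add[OF b1 b2], of 0 1] by (simp add: integral_unique)
    also have "(LINT x:{0..1}|L01. p x * g x + \<phi> x * p' x) = (\<integral>x. p x * g x + \<phi> x * p' x \<partial>L01)"
      unfolding set_lebesgue_integral_def by (rule Bochner_Integration.integral_cong) auto
    finally have "(\<integral>x. p x * g x \<partial>L01) = \<phi> 1 * p 1 - \<phi> 0 * p 0 - (\<integral>x. \<phi> x * p' x \<partial>L01)"
      using integral_add_01[OF fin01_L01 b1 b2] by simp
    moreover have "\<phi> 1 * p 1 \<le> M / 2 * p 1" "- \<phi> 0 * p 0 \<le> M / 2 * p 0"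
      by (rule mult_right_mono; use p(1) \<phi>(2)[of 0] \<phi>(2)[of 1] in force)+
    moreover have "\<bar>\<integral>x. \<phi> x * p' x \<partial>L01\<bar> \<le> M / 2 * R * measure L01 {0..1}"
      using R \<phi>(2) g(3) by (intro integral_abs_le_01 fin01_L01 b2) (auto simp only: abs_mult intro!: mult_mono)
    then have "\<bar>\<integral>x. \<phi> x * p' x \<partial>L01\<bar> \<le> M / 2 * R" by (simp add: measure_L01_interval)
    ultimately show "integral\<^sup>L (density L01 p) g \<le> (p 0 + p 1 + R) / 2 * M"
      unfolding int[OF bg] by (simp add: field_simps abs_le_iff)
  qed
  then show thesis using that f int by blast
qed

text \<open>The density is truncated, replaced by a continuous function, and then by a polynomial.
  The result need be neither invariant nor of mass 1: it only provides a start of bounded variation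
  for the Lasota-Yorke iteration.\<close>

lemma approx_by_var_le:
  assumes \<mu>: "fin01 \<mu>" "absolutely_continuous L01 \<mu>" and "e > 0"
  obtains \<nu> B where "fin01 \<nu>" "var_le \<nu> B"
    "\<And>g R. bdd01 g \<Longrightarrow> (\<And>x. x \<in> {0..1} \<Longrightarrow> \<bar>g x\<bar> \<le> R) \<Longrightarrow> \<bar>integral\<^sup>L \<mu> g - integral\<^sup>L \<nu> g\<bar> \<le> R * e"
proof -
  obtain h where h: "h \<in> borel_measurable M01" "\<And>x. 0 \<le> h x" "integrable L01 h"
    "\<And>g. bdd01 g \<Longrightarrow> integral\<^sup>L \<mu> g = (\<integral>x. h x * g x \<partial>L01)" using density_01[OF \<mu>] by blast
  have hb: "bdd01 (\<lambda>x. min (h x) (real K))" for K :: nat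
    using h(1,2) by (intro bdd01I[of _ "real K"]) auto
  have hi: "integrable L01 (\<lambda>x. h x - min (h x) (real K))" for K :: nat
    using h(3) bdd01_integrable[OF fin01_L01 hb] by (rule Bochner_Integration.integrable_diff)
  have "(\<lambda>K. \<integral>x. \<bar>h x - min (h x) (real K)\<bar> \<partial>L01) \<longlonglongrightarrow> (\<integral>x. 0 \<partial>L01)"
  proof (rule integral_dominated_convergence[where w = h])
    show "AE x in L01. (\<lambda>K. \<bar>h x - min (h x) (real K)\<bar>) \<longlonglongrightarrow> 0"
    proof (rule AE_I2)
      fix x
      have "eventually (\<lambda>K. real K \<ge> h x) sequentially"
        using filterlim_at_top filterlim_real_sequentially by blast
      then have "eventually (\<lambda>K. \<bar>h x - min (h x) (real K)\<bar> = 0) sequentially"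
        by eventually_elim auto
      then show "(\<lambda>K. \<bar>h x - min (h x) (real K)\<bar>) \<longlonglongrightarrow> 0" by (rule tendsto_eventually)
    qed
    show "AE x in L01. norm \<bar>h x - min (h x) (real K)\<bar> \<le> h x" for K
      by (rule AE_I2) (use h(2) in auto)
    show "(\<lambda>x. \<bar>h x - min (h x) (real K)\<bar>) \<in> borel_measurable L01" for K
      using borel_measurable_integrable[OF hi] by measurable
  qed (use h in auto)
  then have "(\<lambda>K. \<integral>x. \<bar>h x - min (h x) (real K)\<bar> \<partial>L01) \<longlonglongrightarrow> 0" by simp
  from order_tendstoD(2)[OF this, of "e / 3"] \<open>e > 0\<close>
  obtain K :: nat where K: "(\<integral>x. \<bar>h x - min (h x) (real K)\<bar> \<partial>L01) < e / 3"
    by (auto simp: eventually_sequentially)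
  obtain f where f: "continuous_on {0..1} f" "(\<integral>x. \<bar>f x - min (h x) (real K)\<bar> \<partial>L01) < e / 3" "\<And>x. f x \<ge> 0"
  proof (rule approx_continuous_L1[OF hb, of "e / 3" K])
    fix f assume f: "continuous_on {0..1} f" "(\<integral>x. \<bar>f x - min (h x) (real K)\<bar> \<partial>L01) < e / 3"
      "(\<forall>x\<in>{0..1}. 0 \<le> min (h x) (real K)) \<longrightarrow> (\<forall>x. 0 \<le> f x)"
    then show thesis using h(2) by (intro that[of f]) auto
  qed (use \<open>e > 0\<close> in auto)
  \<comment> \<open>Lifting f by e / 6 keeps a polynomial within e / 6 of the lifted function
    nonnegative and within e / 3 of f.\<close>
  have "continuous_on {0..1} (\<lambda>x. f x + e / 6)" using f(1) by (intro continuous_intros)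
  with compact_Icc obtain s where "real_polynomial_function s"
    and s: "\<And>x. x \<in> {0..1} \<Longrightarrow> \<bar>f x + e / 6 - s x\<bar> < e / 6"
    using Stone_Weierstrass_real_polynomial_function[of "{0..1}" "\<lambda>x. f x + e / 6" "e / 6"] \<open>e > 0\<close> by auto
  from has_real_derivative_polynomial_function[OF this(1)] obtain s' where
    s': "real_polynomial_function s'" "\<And>x. (s has_real_derivative s' x) (at x)" by blast
  have sf: "\<bar>s x - f x\<bar> \<le> e / 3" "s x \<ge> 0" if "x \<in> {0..1}" for x
    using s[OF that] f(3)[of x] by linarith+
  have bs: "bdd01 s" by (intro bdd01_continuous continuous_at_imp_continuous_on ballI DERIV_isCont[OF s'(2)])
  have cs': "continuous_on {0..1} s'"
    by (intro continuous_at_imp_continuous_on ballI continuous_real_polymonial_function s'(1))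
  obtain B where S: "fin01 (density L01 s)" "var_le (density L01 s) B"
    "\<And>g. bdd01 g \<Longrightarrow> integral\<^sup>L (density L01 s) g = (\<integral>x. s x * g x \<partial>L01)"
    using var_le_density_C1[OF sf(2) s'(2) cs'] by blast
  show thesis
  proof (rule that[OF S(1,2)])
    fix g R assume g: "bdd01 g" "\<And>x. x \<in> {0..1} \<Longrightarrow> \<bar>g x\<bar> \<le> R"
    have R0: "R \<ge> 0" using g(2)[of 0] by auto
    have bf: "bdd01 f" by (rule bdd01_continuous[OF f(1)])
    let ?D = "\<lambda>x. \<bar>h x - min (h x) (real K)\<bar> + \<bar>f x - min (h x) (real K)\<bar> + e / 3"
    have Di: "integrable L01 ?D"
      by (intro Bochner_Integration.integrable_add integrable_abs hi bdd01_integrable[OF fin01_L01] bdd01_intros bf hb)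
    have hg: "integrable L01 (\<lambda>x. h x * g x)"
    proof (rule Bochner_Integration.integrable_bound[of _ "\<lambda>x. R * h x"])
      show "AE x in L01. norm (h x * g x) \<le> norm (R * h x)"
        using g(2) R0 h(2) by (intro AE_I2) (auto simp: abs_mult mult.commute[of R] intro!: mult_left_mono)
    qed (use h(3) bdd01_borel[OF fin01_L01 g(1)] in auto)
    have sg: "integrable L01 (\<lambda>x. s x * g x)" by (intro bdd01_integrable[OF fin01_L01] bdd01_intros bs g)
    have "\<bar>integral\<^sup>L \<mu> g - integral\<^sup>L (density L01 s) g\<bar> = \<bar>\<integral>x. h x * g x - s x * g x \<partial>L01\<bar>"
      unfolding h(4)[OF g(1)] S(3)[OF g(1)] by (simp add: Bochner_Integration.integral_diff[OF hg sg])
    also have "\<dots> \<le> (\<integral>x. \<bar>h x * g x - s x * g x\<bar> \<partial>L01)" by (rule integral_abs_bound)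
    also have "\<dots> \<le> (\<integral>x. R * ?D x \<partial>L01)"
    proof (rule integral_mono)
      fix x assume "x \<in> space L01"
      then have x: "x \<in> {0..1}" by simp
      have "\<bar>h x * g x - s x * g x\<bar> = \<bar>g x\<bar> * \<bar>h x - s x\<bar>" by (simp add: abs_mult[symmetric] algebra_simps)
      also have "\<dots> \<le> R * ?D x" using g(2)[OF x] R0 sf(1)[OF x] by (intro mult_mono) linarith+
      finally show "\<bar>h x * g x - s x * g x\<bar> \<le> R * ?D x" .
    qed (use hg sg Di in auto)
    also have "\<dots> = R * integral\<^sup>L L01 ?D" by simp
    also have "integral\<^sup>L L01 ?D = (\<integral>x. \<bar>h x - min (h x) (real K)\<bar> \<partial>L01) + (\<integral>x. \<bar>f x - min (h x) (real K)\<bar> \<partial>L01) + e / 3"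
      using hi[of K] bdd01_integrable[OF fin01_L01 bdd01_diff[OF bf hb], of K] prob_space.prob_space[OF prob_space_L01]
      by (simp add: bdd01_integrable)
    also have "R * \<dots> \<le> R * e" using K f(2) R0 by (intro mult_left_mono) auto
    finally show "\<bar>integral\<^sup>L \<mu> g - integral\<^sup>L (density L01 s) g\<bar> \<le> R * e" .
  qed
qed

lemma inv01_funpow:
  assumes "inv01 S \<mu>" "S \<in> measurable M01 M01" shows "distr \<mu> M01 (S ^^ t) = \<mu>"
proof (induction t)
  case 0 then show ?case using fin01_sets[OF inv01D(2)[OF assms(1)]] by (simp add: id_def distr_id2)
next
  case (Suc t)
  have "distr \<mu> M01 (S ^^ Suc t) = distr (distr \<mu> M01 (S ^^ t)) M01 S"
    using assms(2) measurable_funpow_01[OF assms(2), of t] inv01D(2)[OF assms(1)]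
    by (subst distr_distr) (auto simp: fin01_sets cong: measurable_cong_sets)
  also have "\<dots> = \<mu>" using Suc assms(1) by (simp add: inv01_def)
  finally show ?case .
qed

text \<open>Approximate \<mu> by some \<nu> of bounded variation and push both forward t times.
  \<mu> does not change, the error does not grow because composition preserves the sup bound of the
  test function, and the uncontrolled variation B of \<nu> enters only as \<rho> ^ t * B. Letting t
  grow removes B; shrinking e then removes the error and the excess mass of \<nu>.\<close>

lemma inv01_var_le:
  assumes S: "lasota_yorke S \<rho> C" and \<mu>: "inv01 S \<mu>"
  shows "var_le \<mu> (C / (1 - \<rho>))"
  unfolding var_le_def
proof (intro allI impI, elim conjE)
  fix g M assume g: "bdd01 g" "osc_le g M"
  note f\<mu> = inv01D(2)[OF \<mu>] and m = lasota_yorke_measurable[OF S]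
  define D where "D = C / (1 - \<rho>)"
  have D0: "D \<ge> 0" and \<rho>: "0 \<le> \<rho>" "\<rho> < 1" using S by (auto simp: lasota_yorke_def D_def)
  have M0: "M \<ge> 0" using osc_le_nonneg[OF g(2)] .
  obtain R where R: "R > 0" "\<And>x. x \<in> {0..1} \<Longrightarrow> \<bar>g x\<bar> \<le> R" using bdd01_bound[OF g(1)] by blast
  have *: "integral\<^sup>L \<mu> g \<le> D * (1 + e) * M + R * e" if e: "e > 0" for e
  proof -
    obtain \<nu> B where \<nu>: "fin01 \<nu>" "var_le \<nu> B"
      "\<And>g R. bdd01 g \<Longrightarrow> (\<And>x. x \<in> {0..1} \<Longrightarrow> \<bar>g x\<bar> \<le> R) \<Longrightarrow> \<bar>integral\<^sup>L \<mu> g - integral\<^sup>L \<nu> g\<bar> \<le> R * e"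
      using approx_by_var_le[OF f\<mu> inv01D(3)[OF \<mu>] e] by blast
    have "\<bar>integral\<^sup>L \<mu> (\<lambda>x. 1) - integral\<^sup>L \<nu> (\<lambda>x. 1)\<bar> \<le> 1 * e" by (rule \<nu>(3)) auto
    then have mass: "measure \<nu> {0..1} \<le> 1 + e"
      using prob01_measure[OF inv01D(1)[OF \<mu>]] f\<mu> \<nu>(1) by (simp add: fin01_space)
    have le: "integral\<^sup>L \<mu> g \<le> (\<rho> ^ t * B + D * (1 + e)) * M + R * e" for t
    proof -
      note mt = measurable_funpow_01[OF m, of t]
      have "integral\<^sup>L \<mu> g = integral\<^sup>L \<mu> (\<lambda>x. g ((S ^^ t) x))"
        using integral_distr_01[OF f\<mu> mt g(1)] inv01_funpow[OF \<mu> m, of t] by simp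
      also have "\<dots> \<le> integral\<^sup>L \<nu> (\<lambda>x. g ((S ^^ t) x)) + R * e"
        using \<nu>(3)[OF bdd01_compose[OF g(1) mt], of R] R(2) maps_01[OF mt] by fastforce
      also have "integral\<^sup>L \<nu> (\<lambda>x. g ((S ^^ t) x)) = integral\<^sup>L (distr \<nu> M01 (S ^^ t)) g"
        using integral_distr_01[OF \<nu>(1) mt g(1)] by simp
      also have "\<dots> \<le> (\<rho> ^ t * B + D * measure \<nu> {0..1}) * M"
        using var_leD[OF lasota_yorke_iterate[OF S \<nu>(1,2), of t] g] by (simp add: D_def)
      also have "\<dots> \<le> (\<rho> ^ t * B + D * (1 + e)) * M"
        using mass D0 M0 by (intro mult_right_mono add_left_mono mult_left_mono) auto
      finally show ?thesis by simp
    qed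
    have "(\<lambda>t. (\<rho> ^ t * B + D * (1 + e)) * M + R * e) \<longlonglongrightarrow> (0 * B + D * (1 + e)) * M + R * e"
      using \<rho> by (intro tendsto_intros LIMSEQ_power_zero) auto
    then have "integral\<^sup>L \<mu> g \<le> (0 * B + D * (1 + e)) * M + R * e"
      by (rule LIMSEQ_le_const) (use le in auto)
    then show ?thesis by simp
  qed
  have pos: "D * M + R > 0" using D0 M0 R(1) by (simp add: add_nonneg_pos)
  have "integral\<^sup>L \<mu> g \<le> D * M"
  proof (rule field_le_epsilon)
    fix e :: real assume "e > 0"
    define q where "q = e / (D * M + R)"
    have q: "q > 0" "q * (D * M + R) = e" using \<open>e > 0\<close> pos by (auto simp: q_def)
    have "D * (1 + q) * M + R * q = D * M + q * (D * M + R)" by (simp add: algebra_simps)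
    then show "integral\<^sup>L \<mu> g \<le> D * M + e" using *[OF q(1)] q(2) by simp
  qed
  then show "integral\<^sup>L \<mu> g \<le> C / (1 - \<rho>) * M" by (simp add: D_def)
qed

section \<open>Splitting invariant measures into singular parts\<close>

lemma inv01_measure:
  assumes "inv01 S \<mu>" "S \<in> measurable M01 M01" "A \<in> sets M01"
  shows "measure \<mu> (S -` A \<inter> {0..1}) = measure \<mu> A"
  using measure_distr_01[OF inv01D(2)[OF assms(1)] assms(2,3)] assms(1) by (simp add: inv01_def)

lemma measure_eqI_01:
  assumes "fin01 \<mu>" "fin01 \<nu>" "\<And>A. A \<in> sets M01 \<Longrightarrow> measure \<mu> A = measure \<nu> A" shows "\<mu> = \<nu>"
proof (rule measure_eqI)
  fix A assume "A \<in> sets \<mu>"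
  then show "emeasure \<mu> A = emeasure \<nu> A" using assms
    by (simp add: fin01_sets finite_measure.emeasure_eq_measure[OF fin01_finite])
qed (use assms in \<open>simp add: fin01_sets\<close>)

lemma inv01I:
  assumes "prob01 \<mu>" "absolutely_continuous L01 \<mu>" "S \<in> measurable M01 M01"
    "\<And>A. A \<in> sets M01 \<Longrightarrow> measure \<mu> (S -` A \<inter> {0..1}) = measure \<mu> A"
  shows "inv01 S \<mu>"
  unfolding inv01_def using assms prob01_fin01[OF assms(1)]
  by (auto intro!: measure_eqI_01 fin01_distr simp: measure_distr_01)

text \<open>E is a Hahn set for the invariant difference d. Pulling A \<inter> E back preserves d,
  and cutting the preimage down to E discards only nonpositive mass. Hence the normalised
  restriction of d to E does not decrease under preimages.\<close>

lemma inv01_positive_part: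
  assumes S: "S \<in> measurable M01 M01" and \<nu>: "inv01 S \<nu>1" "inv01 S \<nu>2" and E: "E \<in> sets M01"
    and ge: "\<And>X. X \<in> sets M01 \<Longrightarrow> X \<subseteq> E \<Longrightarrow> measure \<nu>2 X \<le> measure \<nu>1 X"
    and le: "\<And>X. X \<in> sets M01 \<Longrightarrow> X \<inter> E = {} \<Longrightarrow> measure \<nu>1 X \<le> measure \<nu>2 X"
    and pos: "measure \<nu>2 E < measure \<nu>1 E"
  obtains \<mu> where "inv01 S \<mu>" "measure \<mu> E = 1" "absolutely_continuous \<nu>1 \<mu>"
proof -
  note f = inv01D(2)[OF \<nu>(1)] inv01D(2)[OF \<nu>(2)]
  note em = finite_measure.emeasure_eq_measure[OF fin01_finite[OF f(1)]]
    finite_measure.emeasure_eq_measure[OF fin01_finite[OF f(2)]]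
  define d where "d = (\<lambda>A. measure \<nu>1 A - measure \<nu>2 A)"
  define c where "c = d E"
  have c: "c > 0" using pos by (simp add: c_def d_def)
  define D where "D = diff_measure (density \<nu>1 (indicator E)) (density \<nu>2 (indicator E))"
  have emD: "emeasure D A = ennreal (d (A \<inter> E))" if A: "A \<in> sets M01" for A
  proof -
    have r: "emeasure (density \<nu>1 (indicator E)) A = ennreal (measure \<nu>1 (A \<inter> E))"
      "emeasure (density \<nu>2 (indicator E)) A = ennreal (measure \<nu>2 (A \<inter> E))" if "A \<in> sets M01" for A
      using that E f by (simp_all add: emeasure_restricted fin01_sets em Int_commute)
    have fd: "finite_measure (density \<nu>1 (indicator E))" "finite_measure (density \<nu>2 (indicator E))"
      using f r[of "{0..1}"] sets.top[of M01] by (auto intro!: finite_measureI simp: fin01_space)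
    have "emeasure D A = emeasure (density \<nu>1 (indicator E)) A - emeasure (density \<nu>2 (indicator E)) A"
      unfolding D_def
    proof (rule emeasure_diff_measure[OF fd])
      fix B assume "B \<in> sets (density \<nu>1 (indicator E))"
      then have "B \<in> sets M01" using f by (simp add: fin01_sets)
      then show "emeasure (density \<nu>2 (indicator E)) B \<le> emeasure (density \<nu>1 (indicator E)) B"
        using ge[of "B \<inter> E"] E by (simp add: r ennreal_leI sets.Int)
    qed (use f A in \<open>auto simp: fin01_sets\<close>)
    then show ?thesis using r[OF A] by (simp add: d_def ennreal_minus)
  qed
  have sD: "sets D = sets M01" unfolding D_def using f by (simp add: fin01_sets)
  have spD: "space D = {0..1}" unfolding D_def using f by (simp add: fin01_space)
  define \<mu> where "\<mu> = scale_measure (ennreal (1 / c)) D"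
  have dE: "d (A \<inter> E) \<ge> 0" if "A \<in> sets M01" for A using ge[of "A \<inter> E"] that E by (auto simp: d_def)
  have em\<mu>: "emeasure \<mu> A = ennreal (d (A \<inter> E) / c)" if "A \<in> sets M01" for A
    using emD[OF that] dE[OF that] c by (simp add: \<mu>_def ennreal_mult[symmetric])
  have s\<mu>: "sets \<mu> = sets M01" "space \<mu> = {0..1}" using sD spD by (simp_all add: \<mu>_def space_scale_measure)
  have f\<mu>: "fin01 \<mu>" unfolding fin01_def using s\<mu> em\<mu>[of "{0..1}"] sets.top[of M01]
    by (auto intro!: finite_measureI)
  have m\<mu>: "measure \<mu> A = d (A \<inter> E) / c" if "A \<in> sets M01" for A
    using em\<mu>[OF that] dE[OF that] c by (simp add: measure_def)
  have "{0..1} \<inter> E = E" using E by (auto simp: in_sets_M01)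
  then have p\<mu>: "prob01 \<mu>" using c sets.top[of M01] by (intro prob01I f\<mu>) (simp add: m\<mu> c_def)
  have ac: "absolutely_continuous \<nu>1 \<mu>" unfolding absolutely_continuous_01[OF f(1) f\<mu>]
  proof (intro ballI impI)
    fix A assume A: "A \<in> sets M01" "measure \<nu>1 A = 0"
    have "measure \<nu>1 (A \<inter> E) \<le> measure \<nu>1 A" using A by (intro fin01_measure_mono f) auto
    then have "d (A \<inter> E) \<le> 0" using A measure_nonneg[of \<nu>2 "A \<inter> E"] unfolding d_def by linarith
    then show "measure \<mu> A = 0" using dE[OF A(1)] by (simp add: m\<mu> A)
  qed
  have split: "d X = d (X \<inter> E) + d (X - E)" if "X \<in> sets M01" for X
    using measure_split_01[OF f(1) that E] measure_split_01[OF f(2) that E] by (simp add: d_def)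
  have dinv: "d (S -` A \<inter> {0..1}) = d A" if "A \<in> sets M01" for A
    using inv01_measure[OF \<nu>(1) S that] inv01_measure[OF \<nu>(2) S that] by (simp add: d_def)
  have sub: "d (A \<inter> E) \<le> d (S -` A \<inter> {0..1} \<inter> E)" if A: "A \<in> sets M01" for A
  proof -
    let ?X = "S -` (A \<inter> E) \<inter> {0..1}" and ?Y = "S -` A \<inter> {0..1}"
    have m: "?X \<in> sets M01" "?Y \<in> sets M01" using A E by (intro vimage_sets_01[OF S] sets.Int; simp)+
    have "d (A \<inter> E) = d ?X" using dinv[of "A \<inter> E"] A E by auto
    also have "\<dots> \<le> d (?X \<inter> E)" using split[OF m(1)] le[of "?X - E"] m E by (auto simp: d_def)
    also have "\<dots> \<le> d (?Y \<inter> E)"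
    proof -
      have "?Y \<inter> E = (?X \<inter> E) \<union> ((?Y - ?X) \<inter> E)" by auto
      moreover have "measure \<nu> ((?X \<inter> E) \<union> ((?Y - ?X) \<inter> E)) = measure \<nu> (?X \<inter> E) + measure \<nu> ((?Y - ?X) \<inter> E)"
        if "fin01 \<nu>" for \<nu>
        using that m E by (intro finite_measure.finite_measure_Union) (auto simp: fin01_sets fin01_finite)
      moreover have "d ((?Y - ?X) \<inter> E) \<ge> 0" using m by (intro dE) auto
      ultimately show ?thesis using f by (simp add: d_def)
    qed
    finally show ?thesis .
  qed
  have "inv01 S \<mu>"
  proof (rule inv01I[OF p\<mu> _ S])
    show "absolutely_continuous L01 \<mu>"
      using ac inv01D(3)[OF \<nu>(1)] unfolding absolutely_continuous_def by blast
    fix A assume A: "A \<in> sets M01"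
    have S1: "S -` A \<inter> {0..1} \<in> sets M01" by (rule vimage_sets_01[OF S A])
    \<comment> \<open>One inequality suffices: applied to A and to its complement, with total mass
      1, it gives equality.\<close>
    have le: "measure \<mu> B \<le> measure \<mu> (S -` B \<inter> {0..1})" if "B \<in> sets M01" for B
      using sub[OF that] m\<mu>[OF that] m\<mu>[OF vimage_sets_01[OF S that]] c by (simp add: divide_right_mono)
    note compl = measure_compl_01[OF p\<mu>]
    have "S -` ({0..1} - A) \<inter> {0..1} = {0..1} - (S -` A \<inter> {0..1})" using maps_01[OF S] by auto
    then have "1 - measure \<mu> A \<le> 1 - measure \<mu> (S -` A \<inter> {0..1})"
      using le[of "{0..1} - A"] compl[OF A] compl[OF S1] A sets.top[of M01] by auto
    then show "measure \<mu> (S -` A \<inter> {0..1}) = measure \<mu> A" using le[OF A] by simp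
  qed
  moreover have "measure \<mu> E = 1" using m\<mu>[OF E] c by (simp add: c_def)
  ultimately show thesis using that ac by blast
qed

text \<open>The positive parts of both differences, taken with respect to one Hahn set, live on
  complementary sets.\<close>

lemma inv01_singular_pair:
  assumes S: "S \<in> measurable M01 M01" and \<nu>: "inv01 S \<nu>1" "inv01 S \<nu>2" "\<nu>1 \<noteq> \<nu>2"
  obtains \<mu>1 \<mu>2 E where "inv01 S \<mu>1" "inv01 S \<mu>2" "E \<in> sets M01" "measure \<mu>1 E = 1" "measure \<mu>2 ({0..1} - E) = 1"
    "absolutely_continuous \<nu>1 \<mu>1" "absolutely_continuous \<nu>2 \<mu>2"
proof -
  note f = inv01D(2)[OF \<nu>(1)] inv01D(2)[OF \<nu>(2)]
  note em = finite_measure.emeasure_eq_measure[OF fin01_finite[OF f(1)]]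
    finite_measure.emeasure_eq_measure[OF fin01_finite[OF f(2)]]
  obtain E where E: "E \<in> sets M01" "\<And>X. X \<in> sets M01 \<Longrightarrow> X \<subseteq> E \<Longrightarrow> measure \<nu>2 X \<le> measure \<nu>1 X"
    "\<And>X. X \<in> sets M01 \<Longrightarrow> X \<inter> E = {} \<Longrightarrow> measure \<nu>1 X \<le> measure \<nu>2 X"
    using finite_unsigned_Hahn_decomposition[OF fin01_finite[OF f(1)] fin01_finite[OF f(2)]] f
    by (auto simp: fin01_sets em)
  let ?F = "{0..1} - E"
  have F: "?F \<in> sets M01" using E(1) sets.top[of M01] by auto
  note compl = measure_compl_01[OF _ E(1)] and split = measure_split_01[OF _ _ E(1)]
  have pos: "measure \<nu>2 E < measure \<nu>1 E"
  proof (rule ccontr)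
    assume "\<not> measure \<nu>2 E < measure \<nu>1 E"
    \<comment> \<open>Equal mass on E, hence also on its complement, forces equality in every
      one-sided Hahn inequality, so the two measures would coincide.\<close>
    then have eq: "measure \<nu>2 E = measure \<nu>1 E" using E by force
    have "measure \<nu>1 A = measure \<nu>2 A" if A: "A \<in> sets M01" for A
    proof -
      have "A \<inter> E \<in> sets M01" "E - A \<in> sets M01" "A - E \<in> sets M01" "?F - A \<in> sets M01" using A E(1) F by auto
      then have 1: "measure \<nu>2 (A \<inter> E) \<le> measure \<nu>1 (A \<inter> E)" "measure \<nu>2 (E - A) \<le> measure \<nu>1 (E - A)"
        "measure \<nu>1 (A - E) \<le> measure \<nu>2 (A - E)" "measure \<nu>1 (?F - A) \<le> measure \<nu>2 (?F - A)"
        by (auto intro!: E)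
      have "?F \<inter> A = A - E" using A by (auto simp: in_sets_M01)
      then have u: "measure \<nu> E = measure \<nu> (A \<inter> E) + measure \<nu> (E - A)"
        "measure \<nu> ?F = measure \<nu> (A - E) + measure \<nu> (?F - A)" if "fin01 \<nu>" for \<nu>
        using measure_split_01[OF that E(1) A] measure_split_01[OF that F A] by (simp_all add: Int_commute)
      show ?thesis using 1 u[OF f(1)] u[OF f(2)] eq compl[OF inv01D(1)[OF \<nu>(1)]] compl[OF inv01D(1)[OF \<nu>(2)]]
          split[OF f(1) A] split[OF f(2) A] by linarith
    qed
    then show False using measure_eqI_01[OF f] \<nu>(3) by blast
  qed
  obtain \<mu>1 where \<mu>1: "inv01 S \<mu>1" "measure \<mu>1 E = 1" "absolutely_continuous \<nu>1 \<mu>1"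
    using inv01_positive_part[OF S \<nu>(1,2) E pos] by blast
  have "measure \<nu>1 ?F < measure \<nu>2 ?F"
    using pos compl[OF inv01D(1)[OF \<nu>(1)]] compl[OF inv01D(1)[OF \<nu>(2)]] by simp
  then obtain \<mu>2 where \<mu>2: "inv01 S \<mu>2" "measure \<mu>2 ?F = 1" "absolutely_continuous \<nu>2 \<mu>2"
  proof (rule inv01_positive_part[OF S \<nu>(2,1) F, rotated 2])
    fix X assume X: "X \<in> sets M01"
    show "X \<subseteq> ?F \<Longrightarrow> measure \<nu>1 X \<le> measure \<nu>2 X" using X by (intro E) auto
    show "X \<inter> ?F = {} \<Longrightarrow> measure \<nu>2 X \<le> measure \<nu>1 X" using X by (intro E) (auto simp: in_sets_M01)
  qed
  show thesis using that[OF \<mu>1(1) \<mu>2(1) E(1) \<mu>1(2) \<mu>2(2) \<mu>1(3) \<mu>2(3)] .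
qed

text \<open>With D = C / (1 - \<rho>) as density bound, every carrier F of an invariant measure has
  \<open>1 \<le> D * measure L01 F\<close>. If \<sigma> is not minimal, two disjoint parts of E are
  carriers; the discarded part uses up at least one unit of \<open>D * measure L01 E\<close>, so m
  bounds the number of splittings. The carrier stays in the conclusion in order to find ergodic
  measures on disjoint sets later.\<close>

lemma ergodic01_exists:
  assumes S: "lasota_yorke S \<rho> C"
  shows "inv01 S \<sigma> \<Longrightarrow> E \<in> sets M01 \<Longrightarrow> measure \<sigma> E = 1 \<Longrightarrow> C / (1 - \<rho>) * measure L01 E < real m
    \<Longrightarrow> \<exists>\<nu>. ergodic01 S \<nu> \<and> measure \<nu> E = 1"
proof (induction m arbitrary: \<sigma> E)
  case 0
  then show ?case using S measure_nonneg[of L01 E] unfolding lasota_yorke_def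
    by (metis diff_ge_0_iff_ge divide_nonneg_nonneg less_imp_le linorder_not_less mult_nonneg_nonneg of_nat_0)
next
  case (Suc m)
  note m = lasota_yorke_measurable[OF S]
  show ?case
  proof (cases "ergodic01 S \<sigma>")
    case True then show ?thesis using Suc.prems by blast
  next
    case False
    then obtain \<sigma>' where \<sigma>': "inv01 S \<sigma>'" "absolutely_continuous \<sigma> \<sigma>'" "\<sigma>' \<noteq> \<sigma>"
      using Suc.prems(1) by (auto simp: ergodic01_def)
    obtain \<mu>1 \<mu>2 F where \<mu>: "inv01 S \<mu>1" "inv01 S \<mu>2" "F \<in> sets M01" "measure \<mu>1 F = 1" "measure \<mu>2 ({0..1} - F) = 1"
      "absolutely_continuous \<sigma> \<mu>1" "absolutely_continuous \<sigma>' \<mu>2"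
      using inv01_singular_pair[OF m Suc.prems(1) \<sigma>'(1)] \<sigma>'(3) by metis
    have ac: "absolutely_continuous \<sigma> \<mu>2" using \<mu>(7) \<sigma>'(2) unfolding absolutely_continuous_def by blast
    \<comment> \<open>A measure absolutely continuous with respect to \<sigma> is still carried by
      E, so both singular parts can be cut down to subsets of E.\<close>
    have full: "measure \<nu> (A \<inter> E) = 1" if \<nu>: "inv01 S \<nu>" "absolutely_continuous \<sigma> \<nu>" and A: "A \<in> sets M01" "measure \<nu> A = 1" for \<nu> A
    proof -
      note f = inv01D(2)[OF \<nu>(1)] inv01D(2)[OF Suc.prems(1)]
      have "measure \<sigma> ({0..1} - E) = 0"
        using measure_compl_01[OF inv01D(1)[OF Suc.prems(1)] Suc.prems(2)] Suc.prems(3) by simp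
      then have 0: "measure \<nu> ({0..1} - E) = 0"
        using \<nu>(2) Suc.prems(2) sets.top[of M01] unfolding absolutely_continuous_01[OF f(2,1)] by auto
      have "measure \<nu> A = measure \<nu> (A \<inter> E) + measure \<nu> (A - E)"
        by (rule measure_split_01[OF f(1) A(1) Suc.prems(2)])
      moreover have "measure \<nu> (A - E) \<le> measure \<nu> ({0..1} - E)"
        using A(1) Suc.prems(2) sets.top[of M01] by (intro fin01_measure_mono f) (auto simp: in_sets_M01)
      ultimately show ?thesis using 0 A(2) measure_nonneg[of \<nu> "A - E"] by linarith
    qed
    have sF: "{0..1} - F \<in> sets M01" using \<mu>(3) sets.top[of M01] by auto
    have 1: "measure \<mu>1 (F \<inter> E) = 1" by (rule full[OF \<mu>(1,6,3,4)])
    have 2: "measure \<mu>2 (({0..1} - F) \<inter> E) = 1" by (rule full[OF \<mu>(2) ac sF \<mu>(5)])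
    have FE: "F \<inter> E \<in> sets M01" "({0..1} - F) \<inter> E \<in> sets M01" using \<mu>(3) sF Suc.prems(2) by auto
    have "1 \<le> C / (1 - \<rho>) * measure L01 (({0..1} - F) \<inter> E)"
      using var_le_dominated[OF inv01D(2)[OF \<mu>(2)] inv01_var_le[OF S \<mu>(2)]] FE(2) 2 by (auto simp: dominated_def)
    moreover have "({0..1} - F) \<inter> E = E - F" using Suc.prems(2) by (auto simp: in_sets_M01)
    then have "measure L01 E = measure L01 (F \<inter> E) + measure L01 (({0..1} - F) \<inter> E)"
      using measure_split_01[OF fin01_L01 Suc.prems(2) \<mu>(3)] by (simp add: Int_commute)
    ultimately have "C / (1 - \<rho>) * measure L01 (F \<inter> E) < real m"
      using Suc.prems(4) by (simp add: distrib_left)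
    from Suc.IH[OF \<mu>(1) FE(1) 1 this] obtain \<nu> where \<nu>: "ergodic01 S \<nu>" "measure \<nu> (F \<inter> E) = 1" by blast
    then have p: "prob01 \<nu>" by (auto simp: ergodic01_def inv01_def)
    have "measure \<nu> (F \<inter> E) \<le> measure \<nu> E" "measure \<nu> E \<le> measure \<nu> {0..1}"
      using prob01_fin01[OF p] Suc.prems(2) sets.top[of M01] by (auto intro!: fin01_measure_mono simp: in_sets_M01)
    then show ?thesis using \<nu> prob01_measure[OF p] by (intro exI[of _ \<nu>]) auto
  qed
qed

section \<open>Cesaro means and SBR measures\<close>

text \<open>S may be discontinuous, so weak convergence alone would not pass to preimages. Uniform
  domination upgrades it to convergence on every Borel set.\<close>

lemma inv01_weak_limit:
  assumes S: "S \<in> measurable M01 M01"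
    and \<mu>: "\<And>i. prob01 (\<mu> i)" "\<And>i. dominated (\<mu> i) L01 K" "K \<ge> 0"
    and \<sigma>: "prob01 \<sigma>" "weak_conv01 \<mu> \<sigma>"
    and almost_inv: "\<And>A. A \<in> sets M01 \<Longrightarrow> (\<lambda>i. measure (\<mu> i) (S -` A \<inter> {0..1}) - measure (\<mu> i) A) \<longlonglongrightarrow> 0"
  shows "inv01 S \<sigma>"
proof (rule inv01I[OF \<sigma>(1) _ S])
  note f\<mu> = prob01_fin01[OF \<mu>(1)] and f\<sigma> = prob01_fin01[OF \<sigma>(1)]
  show "absolutely_continuous L01 \<sigma>"
    by (rule dominated_absolutely_continuous[OF fin01_L01 f\<sigma> dominated_weak_limit[OF f\<mu> \<mu>(2,3) f\<sigma> \<sigma>(2)]])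
  fix A assume A: "A \<in> sets M01"
  have lim: "(\<lambda>i. measure (\<mu> i) B) \<longlonglongrightarrow> measure \<sigma> B" if "B \<in> sets M01" for B
    using weak_limit_bdd01[OF f\<mu> \<mu>(2,3) f\<sigma> \<sigma>(2) bdd01_indicator[OF that]]
    unfolding integral_indicator_01[OF f\<mu> that] integral_indicator_01[OF f\<sigma> that] .
  have "(\<lambda>i. measure (\<mu> i) (S -` A \<inter> {0..1}) - measure (\<mu> i) A) \<longlonglongrightarrow> measure \<sigma> (S -` A \<inter> {0..1}) - measure \<sigma> A"
    by (intro tendsto_diff lim A vimage_sets_01[OF S])
  then show "measure \<sigma> (S -` A \<inter> {0..1}) = measure \<sigma> A"
    using almost_inv[OF A] LIMSEQ_unique by fastforce
qed

lemma tendsto_subsequence: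
  fixes X :: "nat \<Rightarrow> real"
  assumes "\<And>r. strict_mono (r :: nat \<Rightarrow> nat) \<Longrightarrow> \<exists>s. strict_mono (s :: nat \<Rightarrow> nat) \<and> (\<lambda>i. X (r (s i))) \<longlonglongrightarrow> L"
  shows "X \<longlonglongrightarrow> L"
proof (rule ccontr)
  assume "\<not> X \<longlonglongrightarrow> L"
  then obtain e where e: "e > 0" "\<And>n. \<exists>k\<ge>n. \<not> \<bar>X k - L\<bar> < e"
    unfolding LIMSEQ_iff real_norm_def by blast
  then have "infinite {k. \<not> \<bar>X k - L\<bar> < e}" by (auto simp: infinite_nat_iff_unbounded_le)
  from infinite_enumerate[OF this] obtain r where r: "strict_mono (r :: nat \<Rightarrow> nat)" "\<And>n. \<not> \<bar>X (r n) - L\<bar> < e" by auto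
  obtain s where "(\<lambda>i. X (r (s i))) \<longlonglongrightarrow> L" using assms[OF r(1)] by blast
  from LIMSEQ_D[OF this e(1)] r(2) show False by auto
qed

section \<open>Cesaro means as probability measures\<close>

context
  fixes S :: "real \<Rightarrow> real" and \<mu> :: "real measure" and k :: nat
  assumes S: "S \<in> measurable M01 M01" and \<mu>: "prob01 \<mu>" and k: "k > 0"
begin

private definition P where "P = measure_pmf (pmf_of_set {..<k})"
private definition F where "F = (\<lambda>(t, x). (S ^^ t) x)"

private lemma F_measurable: "F \<in> measurable (P \<Otimes>\<^sub>M \<mu>) M01"
proof -
  have "F \<in> measurable (count_space UNIV \<Otimes>\<^sub>M \<mu>) M01"
  proof (rule measurable_pair_measure_countable1)
    show "(\<lambda>y. F (t, y)) \<in> measurable \<mu> M01" for t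
      using measurable_funpow_01[OF S, of t] prob01_fin01[OF \<mu>]
      by (simp add: F_def fin01_sets cong: measurable_cong_sets)
  qed auto
  also have "measurable (count_space UNIV \<Otimes>\<^sub>M \<mu>) M01 = measurable (P \<Otimes>\<^sub>M \<mu>) M01"
    by (intro measurable_cong_sets sets_pair_measure_cong) (auto simp: P_def)
  finally show ?thesis .
qed

text \<open>The Cesaro mean is the law of the orbit point at a uniformly distributed time, which
  makes it a measure and reduces integrals to Fubini's theorem.\<close>
private lemma cesaro_eq: "cesaro S \<mu> k = distr (P \<Otimes>\<^sub>M \<mu>) M01 F"
proof -
  interpret prob_space \<mu> using \<mu> by (simp add: prob01_def)
  note f = prob01_fin01[OF \<mu>]
  let ?C = "distr (P \<Otimes>\<^sub>M \<mu>) M01 F"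
  have em: "emeasure ?C A = (\<Sum>t<k. emeasure (distr \<mu> \<mu> (S ^^ t)) A) / of_nat k" if A: "A \<in> sets M01" for A
  proof -
    have "emeasure ?C A = emeasure (P \<Otimes>\<^sub>M \<mu>) (F -` A \<inter> space (P \<Otimes>\<^sub>M \<mu>))"
      by (rule emeasure_distr[OF F_measurable A])
    also have "\<dots> = (\<integral>\<^sup>+t. emeasure \<mu> (Pair t -` (F -` A \<inter> space (P \<Otimes>\<^sub>M \<mu>))) \<partial>P)"
      by (rule emeasure_pair_measure_alt[OF measurable_sets[OF F_measurable A]])
    also have "\<dots> = (\<Sum>t<k. emeasure \<mu> (Pair t -` (F -` A \<inter> space (P \<Otimes>\<^sub>M \<mu>)))) / of_nat k"
      using k unfolding P_def by (subst nn_integral_pmf_of_set) auto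
    also have "(\<Sum>t<k. emeasure \<mu> (Pair t -` (F -` A \<inter> space (P \<Otimes>\<^sub>M \<mu>)))) = (\<Sum>t<k. emeasure (distr \<mu> \<mu> (S ^^ t)) A)"
    proof (rule sum.cong[OF refl])
      fix t
      have "(S ^^ t) \<in> measurable \<mu> \<mu>"
        using measurable_funpow_01[OF S, of t] f by (simp add: fin01_sets cong: measurable_cong_sets)
      moreover have "Pair t -` (F -` A \<inter> space (P \<Otimes>\<^sub>M \<mu>)) = (S ^^ t) -` A \<inter> space \<mu>"
        by (auto simp: F_def space_pair_measure P_def)
      ultimately show "emeasure \<mu> (Pair t -` (F -` A \<inter> space (P \<Otimes>\<^sub>M \<mu>))) = emeasure (distr \<mu> \<mu> (S ^^ t)) A"
        using A f by (simp add: emeasure_distr fin01_sets)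
    qed
    finally show ?thesis .
  qed
  have "cesaro S \<mu> k = measure_of (space M01) (sets M01) (emeasure ?C)"
    unfolding cesaro_def fin01_sets[OF f] fin01_space[OF f] space_M01[symmetric]
    using em sets.sigma_sets_eq[of M01] by (intro measure_of_eq sets.space_closed) simp
  also have "\<dots> = ?C" using measure_of_of_measure[of ?C] by simp
  finally show ?thesis .
qed

lemma prob01_cesaro: "prob01 (cesaro S \<mu> k)"
proof -
  interpret \<mu>: prob_space \<mu> using \<mu> by (simp add: prob01_def)
  interpret P: prob_space P unfolding P_def by (rule prob_space_measure_pmf)
  interpret PM: pair_prob_space P \<mu> ..
  show ?thesis unfolding cesaro_eq prob01_def
    using PM.prob_space_distr[OF F_measurable] by simp
qed

lemma integral_cesaro:
  assumes g: "bdd01 g"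
  shows "integral\<^sup>L (cesaro S \<mu> k) g = (\<Sum>t<k. integral\<^sup>L \<mu> (\<lambda>x. g ((S ^^ t) x))) / real k"
proof -
  interpret \<mu>: prob_space \<mu> using \<mu> by (simp add: prob01_def)
  interpret P: prob_space P unfolding P_def by (rule prob_space_measure_pmf)
  interpret PM: pair_prob_space P \<mu> ..
  obtain R where R: "\<And>x. x \<in> {0..1} \<Longrightarrow> \<bar>g x\<bar> \<le> R" using bdd01_bound[OF g] by blast
  have gm: "g \<in> borel_measurable M01" using g by (simp add: bdd01_def)
  have "integrable (P \<Otimes>\<^sub>M \<mu>) (\<lambda>z. g (F z))"
  proof (rule PM.integrable_const_bound[of _ R])
    show "AE z in P \<Otimes>\<^sub>M \<mu>. norm (g (F z)) \<le> R"
      using R measurable_space[OF F_measurable] by (intro AE_I2) auto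
    show "(\<lambda>z. g (F z)) \<in> borel_measurable (P \<Otimes>\<^sub>M \<mu>)" by (rule measurable_compose[OF F_measurable gm])
  qed
  note Fub = PM.integral_fst'[OF this]
  have "integral\<^sup>L (cesaro S \<mu> k) g = (\<integral>z. g (F z) \<partial>(P \<Otimes>\<^sub>M \<mu>))"
    unfolding cesaro_eq by (rule integral_distr[OF F_measurable gm])
  also have "\<dots> = (\<integral>t. (\<integral>x. g (F (t, x)) \<partial>\<mu>) \<partial>P)" using Fub by simp
  also have "\<dots> = (\<Sum>t<k. integral\<^sup>L \<mu> (\<lambda>x. g ((S ^^ t) x))) / real k"
    unfolding P_def F_def using k by (subst integral_pmf_of_set) auto
  finally show ?thesis .
qed

lemma cesaro_almost_invariant:
  assumes g: "bdd01 g" "\<And>x. x \<in> {0..1} \<Longrightarrow> \<bar>g x\<bar> \<le> R"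
  shows "\<bar>integral\<^sup>L (cesaro S \<mu> k) (\<lambda>x. g (S x)) - integral\<^sup>L (cesaro S \<mu> k) g\<bar> \<le> 2 * R / real k"
proof -
  note f = prob01_fin01[OF \<mu>]
  define a where "a = (\<lambda>t. integral\<^sup>L \<mu> (\<lambda>x. g ((S ^^ t) x)))"
  have a: "\<bar>a t\<bar> \<le> R" for t
  proof -
    note mt = measurable_funpow_01[OF S, of t]
    have "\<bar>a t\<bar> \<le> R * measure \<mu> {0..1}" unfolding a_def
      using maps_01[OF mt] g(2) by (intro integral_abs_le_01[OF f] bdd01_compose[OF g(1) mt]) auto
    then show ?thesis by (simp add: prob01_measure[OF \<mu>])
  qed
  have "integral\<^sup>L (cesaro S \<mu> k) (\<lambda>x. g (S x)) = (\<Sum>t<k. a (Suc t)) / real k"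
    unfolding a_def by (subst integral_cesaro[OF bdd01_compose[OF g(1) S]]) simp
  moreover have "integral\<^sup>L (cesaro S \<mu> k) g = (\<Sum>t<k. a t) / real k" unfolding a_def by (rule integral_cesaro[OF g(1)])
  ultimately have "integral\<^sup>L (cesaro S \<mu> k) (\<lambda>x. g (S x)) - integral\<^sup>L (cesaro S \<mu> k) g = (a k - a 0) / real k"
    by (simp add: diff_divide_distrib[symmetric] sum_subtractf[symmetric] sum_lessThan_telescope)
  moreover have "\<bar>a k - a 0\<bar> \<le> 2 * R" using a[of k] a[of 0] by linarith
  ultimately show ?thesis by (simp add: divide_right_mono)
qed

end

lemma measure_cesaro:
  assumes "S \<in> measurable M01 M01" "prob01 \<mu>" "k > 0" "A \<in> sets M01"
  shows "measure (cesaro S \<mu> k) A = (\<Sum>t<k. measure \<mu> ((S ^^ t) -` A \<inter> {0..1})) / real k"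
proof -
  note f = prob01_fin01[OF assms(2)]
  have "measure (cesaro S \<mu> k) A = integral\<^sup>L (cesaro S \<mu> k) (indicator A)"
    using integral_indicator_01[OF prob01_fin01[OF prob01_cesaro[OF assms(1-3)]] assms(4)] by simp
  also have "\<dots> = (\<Sum>t<k. integral\<^sup>L \<mu> (\<lambda>x. indicator A ((S ^^ t) x))) / real k"
    by (rule integral_cesaro[OF assms(1-3) bdd01_indicator[OF assms(4)]])
  finally show ?thesis unfolding integral_indicator_compose_01[OF f measurable_funpow_01[OF assms(1)] assms(4)] .
qed

text \<open>The Krylov-Bogolyubov argument, with domination in place of continuity of S. The index
  is shifted by \<open>Suc\<close> to exclude the mean over no times.\<close>

lemma cesaro_limit_inv01:
  assumes S: "S \<in> measurable M01 M01" and \<mu>: "prob01 \<mu>" and r: "strict_mono (r :: nat \<Rightarrow> nat)"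
    and dom: "\<And>k. dominated (cesaro S \<mu> (Suc k)) L01 K" "K \<ge> 0"
    and \<sigma>: "prob01 \<sigma>" "weak_conv01 (\<lambda>i. cesaro S \<mu> (Suc (r i))) \<sigma>"
  shows "inv01 S \<sigma>"
proof (rule inv01_weak_limit[OF S _ dom(1) dom(2) \<sigma>])
  show p: "prob01 (cesaro S \<mu> (Suc (r i)))" for i by (rule prob01_cesaro[OF S \<mu>]) simp
  fix A assume A: "A \<in> sets M01"
  let ?C = "\<lambda>i. cesaro S \<mu> (Suc (r i))"
  have bound: "norm (measure (?C i) (S -` A \<inter> {0..1}) - measure (?C i) A) \<le> 2 * 1 / real (Suc (r i))" for i
  proof -
    note f = prob01_fin01[OF p[of i]]
    have "\<bar>integral\<^sup>L (?C i) (\<lambda>x. indicator A (S x)) - integral\<^sup>L (?C i) (indicator A)\<bar> \<le> 2 * 1 / real (Suc (r i))"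
      by (rule cesaro_almost_invariant[OF S \<mu> _ bdd01_indicator[OF A]]) (auto simp: indicator_def)
    then show ?thesis unfolding integral_indicator_compose_01[OF f S A] integral_indicator_01[OF f A] real_norm_def .
  qed
  have "(\<lambda>i. 2 * 1 / real (Suc (r i))) \<longlonglongrightarrow> 0"
    using LIMSEQ_subseq_LIMSEQ[OF lim_const_over_n[of "2::real", THEN LIMSEQ_Suc] r] by (simp add: o_def)
  then show "(\<lambda>i. measure (?C i) (S -` A \<inter> {0..1}) - measure (?C i) A) \<longlonglongrightarrow> 0"
    by (rule Lim_null_comparison[OF always_eventually[OF allI[OF bound]]])
qed

text \<open>Lebesgue measure has variation bound 1, so the Lasota-Yorke bound holds for all its
  images and therefore for their averages. It makes a limit point of the means absolutely
  continuous.\<close>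

lemma inv01_exists:
  assumes S: "lasota_yorke S \<rho> C" obtains \<sigma> where "inv01 S \<sigma>"
proof -
  note m = lasota_yorke_measurable[OF S]
  have p: "prob01 L01" by (simp add: prob01_def prob_space_L01)
  have v: "var_le L01 1" unfolding var_le_def
  proof (intro allI impI, elim conjE)
    fix g M assume g: "bdd01 g" "osc_le g M"
    have "integral\<^sup>L L01 g = (LINT x:{0..1}|L01. g x)" unfolding set_lebesgue_integral_def
      by (rule Bochner_Integration.integral_cong) auto
    then show "integral\<^sup>L L01 g \<le> 1 * M" using osc_leD[OF g(2), of 0 1] by simp
  qed
  \<comment> \<open>A bound for \<open>\<rho> ^ t * 1 + C / (1 - \<rho>)\<close> valid for every
    t.\<close>
  define B where "B = 1 + C / (1 - \<rho>)"
  have vt: "var_le (distr L01 M01 (S ^^ t)) B" for t unfolding var_le_def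
  proof (intro allI impI, elim conjE)
    fix g M assume g: "bdd01 g" "osc_le g M"
    have "integral\<^sup>L (distr L01 M01 (S ^^ t)) g \<le> (\<rho> ^ t * 1 + C / (1 - \<rho>) * measure L01 {0..1}) * M"
      by (rule var_leD[OF lasota_yorke_iterate[OF S fin01_L01 v] g])
    also have "\<dots> \<le> B * M"
      using S osc_le_nonneg[OF g(2)] prob01_measure[OF p]
      by (intro mult_right_mono) (auto simp: B_def lasota_yorke_def power_le_one)
    finally show "integral\<^sup>L (distr L01 M01 (S ^^ t)) g \<le> B * M" .
  qed
  have pc: "prob01 (cesaro S L01 (Suc k))" for k by (rule prob01_cesaro[OF m p]) simp
  have vc: "var_le (cesaro S L01 (Suc k)) B" for k unfolding var_le_def
  proof (intro allI impI, elim conjE)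
    fix g M assume g: "bdd01 g" "osc_le g M"
    have "integral\<^sup>L (cesaro S L01 (Suc k)) g = (\<Sum>t<Suc k. integral\<^sup>L L01 (\<lambda>x. g ((S ^^ t) x))) / real (Suc k)"
      by (rule integral_cesaro[OF m p _ g(1)]) simp
    also have "\<dots> \<le> (\<Sum>t<Suc k. B * M) / real (Suc k)"
    proof (intro divide_right_mono sum_mono)
      fix t
      show "integral\<^sup>L L01 (\<lambda>x. g ((S ^^ t) x)) \<le> B * M"
        using var_leD[OF vt g, of t] integral_distr_01[OF fin01_L01 measurable_funpow_01[OF m] g(1), of t] by simp
    qed simp
    also have "\<dots> = B * M" by (simp add: field_simps del: sum.lessThan_Suc)
    finally show "integral\<^sup>L (cesaro S L01 (Suc k)) g \<le> B * M" .
  qed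
  obtain r \<sigma> where r: "strict_mono (r :: nat \<Rightarrow> nat)" "prob01 \<sigma>" "weak_conv01 ((\<lambda>k. cesaro S L01 (Suc k)) \<circ> r) \<sigma>"
    by (rule helly01[of "\<lambda>k. cesaro S L01 (Suc k)", OF pc])
  have "inv01 S \<sigma>"
  proof (rule cesaro_limit_inv01[OF m p r(1) _ _ r(2)])
    show "dominated (cesaro S L01 (Suc k)) L01 B" for k by (rule var_le_dominated[OF prob01_fin01[OF pc] vc])
    show "B \<ge> 0" using var_le_mass(2)[OF prob01_fin01[OF pc] vc] .
    show "weak_conv01 (\<lambda>i. cesaro S L01 (Suc (r i))) \<sigma>" using r(3) by (simp add: o_def)
  qed
  then show thesis by (rule that)
qed

text \<open>A bound from above controls both signs because the total masses agree: it is applied to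
  the nonnegative functions R + g and R - g, whose integrals are at most 2 * R.\<close>

lemma integral_close_of_dominated:
  assumes \<alpha>: "prob01 \<alpha>" and \<beta>: "prob01 \<beta>" and dom: "dominated \<alpha> \<beta> (1 + \<eta>)" "\<eta> \<ge> 0"
    and g: "bdd01 g" "\<And>x. x \<in> {0..1} \<Longrightarrow> \<bar>g x\<bar> \<le> R"
  shows "\<bar>integral\<^sup>L \<alpha> g - integral\<^sup>L \<beta> g\<bar> \<le> 2 * R * \<eta>"
proof -
  note f = prob01_fin01[OF \<alpha>] prob01_fin01[OF \<beta>]
  have one: "integral\<^sup>L \<mu> (\<lambda>x. R) = R" if "prob01 \<mu>" for \<mu>
    using prob01_measure[OF that] fin01_space[OF prob01_fin01[OF that]] by simp
  have *: "integral\<^sup>L \<alpha> g - integral\<^sup>L \<beta> g \<le> 2 * R * \<eta>" if g: "bdd01 g" "\<And>x. x \<in> {0..1} \<Longrightarrow> \<bar>g x\<bar> \<le> R" for g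
  proof -
    have "0 \<le> g x + R" if "x \<in> {0..1}" for x using g(2)[OF that] by linarith
    then have "integral\<^sup>L \<alpha> (\<lambda>x. g x + R) \<le> (1 + \<eta>) * integral\<^sup>L \<beta> (\<lambda>x. g x + R)"
      using dom by (intro integral_dominated f bdd01_intros g) auto
    then have "integral\<^sup>L \<alpha> g + R \<le> (1 + \<eta>) * (integral\<^sup>L \<beta> g + R)"
      unfolding integral_add_01[OF f(1) g(1) bdd01_const] integral_add_01[OF f(2) g(1) bdd01_const] one[OF \<alpha>] one[OF \<beta>] .
    moreover have "integral\<^sup>L \<beta> g \<le> R" using integral_abs_le_01[OF f(2) g] prob01_measure[OF \<beta>] by simp
    then have "\<eta> * integral\<^sup>L \<beta> g \<le> \<eta> * R" using dom(2) by (rule mult_left_mono)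
    ultimately show ?thesis by (simp add: algebra_simps)
  qed
  show ?thesis using *[OF g] *[OF bdd01_uminus[OF g(1)]] g(2) by (simp add: abs_le_iff)
qed

text \<open>The sets where the density is at most n exhaust U. This isolates a bounded part of the
  starting measures in \<open>SBR\<close>, whose densities may be unbounded.\<close>

lemma full_measure_bounded_density:
  assumes \<mu>: "prob01 \<mu>" "absolutely_continuous L01 \<mu>" and U: "U \<in> sets M01" "measure \<mu> U = 1" and "q < 1"
  obtains A K where "A \<in> sets M01" "A \<subseteq> U" "measure \<mu> A > q" "K \<ge> 0"
    "\<And>B. B \<in> sets M01 \<Longrightarrow> measure \<mu> (A \<inter> B) \<le> K * measure L01 (A \<inter> B)"
proof -
  note f = prob01_fin01[OF \<mu>(1)]
  obtain h where h: "h \<in> borel_measurable M01" "\<And>x. 0 \<le> h x" "integrable L01 h"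
    "\<And>g. bdd01 g \<Longrightarrow> integral\<^sup>L \<mu> g = (\<integral>x. h x * g x \<partial>L01)" using density_01[OF f \<mu>(2)] by blast
  define A where "A = (\<lambda>n. {x \<in> space M01. h x \<le> real n} \<inter> U)"
  have A: "A n \<in> sets M01" for n unfolding A_def using h(1) U(1) by measurable
  have "(\<lambda>n. measure \<mu> (A n)) \<longlonglongrightarrow> measure \<mu> (\<Union>n. A n)"
  proof (rule finite_measure.finite_Lim_measure_incseq[OF fin01_finite[OF f]])
    show "range A \<subseteq> sets \<mu>" using A f by (auto simp: fin01_sets)
    show "incseq A" by (auto simp: incseq_def A_def)
  qed
  also have "(\<Union>n. A n) = U"
  proof
    show "U \<subseteq> (\<Union>n. A n)"
    proof
      fix x assume x: "x \<in> U"
      obtain n :: nat where "h x \<le> real n" using real_arch_simple by blast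
      then show "x \<in> (\<Union>n. A n)" using x U(1) by (auto simp: A_def in_sets_M01)
    qed
  qed (auto simp: A_def)
  finally have "(\<lambda>n. measure \<mu> (A n)) \<longlonglongrightarrow> 1" using U(2) by simp
  from order_tendstoD(1)[OF this \<open>q < 1\<close>] obtain n where n: "measure \<mu> (A n) > q"
    by (auto simp: eventually_sequentially)
  show thesis
  proof (rule that[OF A _ n, of "real n"])
    show "A n \<subseteq> U" by (auto simp: A_def)
    fix B assume B: "B \<in> sets M01"
    have AB: "A n \<inter> B \<in> sets M01" using A B by auto
    have "measure \<mu> (A n \<inter> B) = (\<integral>x. h x * indicator (A n \<inter> B) x \<partial>L01)"
      using h(4)[OF bdd01_indicator[OF AB]] integral_indicator_01[OF f AB] by simp
    also have "\<dots> \<le> (\<integral>x. real n * indicator (A n \<inter> B) x \<partial>L01)"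
    proof (rule integral_mono)
      show "integrable L01 (\<lambda>x. h x * indicator (A n \<inter> B) x)"
        using h AB by (intro integrable_real_mult_indicator) auto
      show "integrable L01 (\<lambda>x. real n * indicator (A n \<inter> B) x)"
        by (intro bdd01_integrable[OF fin01_L01] bdd01_intros AB)
    qed (auto simp: A_def indicator_def)
    also have "\<dots> = real n * measure L01 (A n \<inter> B)" using integral_indicator_01[OF fin01_L01 AB] by simp
    finally show "measure \<mu> (A n \<inter> B) \<le> real n * measure L01 (A n \<inter> B)" .
  qed simp
qed

lemma dominated_cesaro:
  assumes S: "S \<in> measurable M01 M01" and \<mu>: "prob01 \<mu>" and \<nu>: "inv01 S \<nu>" and dom: "dominated \<mu> \<nu> K"
  shows "dominated (cesaro S \<mu> (Suc k)) \<nu> K"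
  unfolding dominated_def
proof
  fix A assume A: "A \<in> sets M01"
  have "measure (cesaro S \<mu> (Suc k)) A = (\<Sum>t<Suc k. measure \<mu> ((S ^^ t) -` A \<inter> {0..1})) / real (Suc k)"
    by (rule measure_cesaro[OF S \<mu> _ A]) simp
  also have "\<dots> \<le> (\<Sum>t<Suc k. K * measure \<nu> A) / real (Suc k)"
  proof (intro divide_right_mono sum_mono)
    fix t
    note mt = measurable_funpow_01[OF S, of t]
    have "measure \<nu> ((S ^^ t) -` A \<inter> {0..1}) = measure \<nu> A"
      using measure_distr_01[OF inv01D(2)[OF \<nu>] mt A] inv01_funpow[OF \<nu> S, of t] by simp
    then show "measure \<mu> ((S ^^ t) -` A \<inter> {0..1}) \<le> K * measure \<nu> A"
      using dom vimage_sets_01[OF mt A] unfolding dominated_def by metis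
  qed simp
  also have "\<dots> = K * measure \<nu> A" by (simp add: field_simps del: sum.lessThan_Suc)
  finally show "measure (cesaro S \<mu> (Suc k)) A \<le> K * measure \<nu> A" .
qed

text \<open>Domination by \<nu> survives averaging, since \<nu> is invariant, and survives limits.
  So each limit point is invariant and absolutely continuous with respect to \<nu>, hence equal to
  \<nu> by minimality. This takes the place of an ergodic theorem.\<close>

lemma ergodic01_cesaro_weak_conv:
  assumes S: "S \<in> measurable M01 M01" and \<nu>: "ergodic01 S \<nu>" "dominated \<nu> L01 D" "D \<ge> 0"
    and \<mu>: "prob01 \<mu>" and dom: "dominated \<mu> \<nu> K" "K \<ge> 0"
  shows "weak_conv01 (\<lambda>k. cesaro S \<mu> (Suc k)) \<nu>"
  unfolding weak_conv01_def
proof (intro allI impI)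
  fix f :: "real \<Rightarrow> real" assume f: "continuous_on {0..1} f"
  have inv: "inv01 S \<nu>" using \<nu>(1) by (simp add: ergodic01_def)
  let ?C = "\<lambda>k. cesaro S \<mu> (Suc k)"
  have p: "prob01 (?C k)" for k by (rule prob01_cesaro[OF S \<mu>]) simp
  have d: "dominated (?C k) \<nu> K" for k by (rule dominated_cesaro[OF S \<mu> inv dom(1)])
  have dL: "dominated (?C k) L01 (K * D)" for k unfolding dominated_def
  proof
    fix A assume A: "A \<in> sets M01"
    have "measure (?C k) A \<le> K * measure \<nu> A" using d[of k] A by (simp add: dominated_def)
    also have "\<dots> \<le> K * (D * measure L01 A)" using \<nu>(2) A dom(2) by (auto simp: dominated_def intro: mult_left_mono)
    finally show "measure (?C k) A \<le> K * D * measure L01 A" by simp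
  qed
  have KD: "K * D \<ge> 0" using dom(2) \<nu>(3) by simp
  show "(\<lambda>k. integral\<^sup>L (?C k) f) \<longlonglongrightarrow> integral\<^sup>L \<nu> f"
  proof (rule tendsto_subsequence)
    fix r :: "nat \<Rightarrow> nat" assume r: "strict_mono r"
    obtain s \<sigma> where s: "strict_mono (s :: nat \<Rightarrow> nat)" "prob01 \<sigma>" "weak_conv01 ((\<lambda>i. ?C (r i)) \<circ> s) \<sigma>"
      by (rule helly01[of "\<lambda>i. ?C (r i)", OF p])
    have w: "weak_conv01 (\<lambda>i. ?C ((r \<circ> s) i)) \<sigma>" using s(3) by (simp add: o_def)
    have inv\<sigma>: "inv01 S \<sigma>"
      by (rule cesaro_limit_inv01[OF S \<mu> strict_mono_o[OF r s(1)] dL KD s(2) w])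
    have "dominated \<sigma> \<nu> K" unfolding dominated_def
    proof
      fix A assume A: "A \<in> sets M01"
      have "(\<lambda>i. integral\<^sup>L (?C ((r \<circ> s) i)) (indicator A)) \<longlonglongrightarrow> (integral\<^sup>L \<sigma> (indicator A) :: real)"
        by (rule weak_limit_bdd01[OF prob01_fin01[OF p] dL KD prob01_fin01[OF s(2)] w bdd01_indicator[OF A]])
      then have "(\<lambda>i. measure (?C ((r \<circ> s) i)) A) \<longlonglongrightarrow> measure \<sigma> A"
        unfolding integral_indicator_01[OF prob01_fin01[OF p] A] integral_indicator_01[OF prob01_fin01[OF s(2)] A] .
      then show "measure \<sigma> A \<le> K * measure \<nu> A"
        by (rule LIMSEQ_le_const2) (use d A in \<open>auto simp: dominated_def\<close>)
    qed
    then have "absolutely_continuous \<nu> \<sigma>"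
      by (rule dominated_absolutely_continuous[OF inv01D(2)[OF inv] prob01_fin01[OF s(2)]])
    then have "\<sigma> = \<nu>" using \<nu>(1) inv\<sigma> by (simp add: ergodic01_def)
    then show "\<exists>s. strict_mono s \<and> (\<lambda>i. integral\<^sup>L (?C (r (s i))) f) \<longlonglongrightarrow> integral\<^sup>L \<nu> f"
      using s(1) w f by (intro exI[of _ s]) (auto simp: weak_conv01_def)
  qed
qed

text \<open>The open set for \<open>SBR\<close> is an interval on which the density of \<nu> is at
  least 1/2: bounded densities carried there are dominated by a multiple of \<nu>. An unbounded
  density is truncated first, with an error that averaging along orbits does not enlarge.\<close>

lemma ergodic01_imp_SBR:
  assumes S: "lasota_yorke S \<rho> C" and \<nu>: "ergodic01 S \<nu>"
  shows "SBR S \<nu>"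
proof -
  note m = lasota_yorke_measurable[OF S]
  have inv: "inv01 S \<nu>" using \<nu> by (simp add: ergodic01_def)
  note p\<nu> = inv01D(1)[OF inv] and f\<nu> = inv01D(2)[OF inv]
  note v\<nu> = inv01_var_le[OF S inv]
  note d\<nu> = var_le_dominated[OF f\<nu> v\<nu>] and D0 = var_le_mass(2)[OF f\<nu> v\<nu>]
  obtain a b where ab: "0 \<le> a" "a < b" "b \<le> 1"
    "\<And>A. A \<in> sets M01 \<Longrightarrow> A \<subseteq> {a..b} \<Longrightarrow> measure L01 A \<le> 2 * measure \<nu> A"
    using var_le_interval_lower_bound[OF p\<nu> v\<nu>] by blast
  let ?U = "{a<..<b}"
  have U: "?U \<inter> {0..1} = ?U" "?U \<in> sets M01" using ab(1-3) by (auto simp: in_sets_M01)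
  have "weak_conv01 (cesaro S \<mu>) \<nu>" if \<mu>: "prob01 \<mu>" "absolutely_continuous L01 \<mu>" "emeasure \<mu> (?U \<inter> {0..1}) = 1" for \<mu>
    unfolding weak_conv01_def
  proof (intro allI impI)
    fix f :: "real \<Rightarrow> real" assume f: "continuous_on {0..1} f"
    note f\<mu> = prob01_fin01[OF \<mu>(1)]
    have \<mu>U: "measure \<mu> ?U = 1" using \<mu>(3) unfolding U(1) by (simp add: measure_def)
    note bf = bdd01_continuous[OF f]
    obtain R where R: "R > 0" "\<And>x. x \<in> {0..1} \<Longrightarrow> \<bar>f x\<bar> \<le> R" using bdd01_bound[OF bf] by blast
    have "(\<lambda>k. integral\<^sup>L (cesaro S \<mu> (Suc k)) f) \<longlonglongrightarrow> integral\<^sup>L \<nu> f"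
    proof (rule LIMSEQ_I)
      fix e :: real assume "e > 0"
      \<comment> \<open>Chosen so that the truncation error \<open>2 * R * \<eta>\<close> is e /
        2.\<close>
      define \<eta> where "\<eta> = e / (4 * R)"
      have \<eta>: "\<eta> > 0" using R(1) \<open>e > 0\<close> by (simp add: \<eta>_def)
      have "1 / (1 + \<eta>) < 1" using \<eta> by simp
      then obtain A K where A: "A \<in> sets M01" "A \<subseteq> ?U" "measure \<mu> A > 1 / (1 + \<eta>)" "K \<ge> 0"
        "\<And>B. B \<in> sets M01 \<Longrightarrow> measure \<mu> (A \<inter> B) \<le> K * measure L01 (A \<inter> B)"
        using full_measure_bounded_density[OF \<mu>(1,2) U(2) \<mu>U] by metis
      have Apos: "measure \<mu> A > 0" using A(3) \<eta> by (smt (verit) divide_pos_pos)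
      \<comment> \<open>Conditioning on A does two things: \<open>d1\<close> keeps \<mu>A close to
        \<mu>, and \<open>d2\<close> puts it below a multiple of \<nu>, so that its means
        converge.\<close>
      define \<mu>A where "\<mu>A = uniform_measure \<mu> A"
      have mA: "measure \<mu>A B = measure \<mu> (A \<inter> B) / measure \<mu> A" if "B \<in> sets M01" for B
        unfolding \<mu>A_def using that Apos f\<mu> A(1) finite_measure.emeasure_eq_measure[OF fin01_finite[OF f\<mu>]]
        by (intro measure_uniform_measure) (auto simp: fin01_sets)
      have pA: "prob01 \<mu>A" unfolding prob01_def \<mu>A_def
        using Apos f\<mu> finite_measure.emeasure_eq_measure[OF fin01_finite[OF f\<mu>]]
        by (auto intro!: prob_space_uniform_measure simp: fin01_sets)
      have inv_le: "1 / measure \<mu> A \<le> 1 + \<eta>" using A(3) Apos \<eta> by (simp add: field_simps)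
      have d1: "dominated \<mu>A \<mu> (1 + \<eta>)" unfolding dominated_def
      proof
        fix B assume B: "B \<in> sets M01"
        have "measure \<mu>A B = 1 / measure \<mu> A * measure \<mu> (A \<inter> B)" using mA[OF B] by simp
        also have "\<dots> \<le> (1 + \<eta>) * measure \<mu> B"
          using inv_le \<eta> B f\<mu> by (intro mult_mono fin01_measure_mono) auto
        finally show "measure \<mu>A B \<le> (1 + \<eta>) * measure \<mu> B" .
      qed
      have d2: "dominated \<mu>A \<nu> ((1 + \<eta>) * (K * 2))" unfolding dominated_def
      proof
        fix B assume B: "B \<in> sets M01"
        have AB: "A \<inter> B \<in> sets M01" using A(1) B by auto
        have "measure \<mu> (A \<inter> B) \<le> K * measure L01 (A \<inter> B)" by (rule A(5)[OF B])
        also have "\<dots> \<le> K * (2 * measure \<nu> (A \<inter> B))" using AB A(2,4) by (intro mult_left_mono ab(4)) auto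
        also have "\<dots> \<le> K * (2 * measure \<nu> B)" using A(4) B f\<nu> by (intro mult_left_mono fin01_measure_mono) auto
        finally have "measure \<mu> (A \<inter> B) \<le> K * (2 * measure \<nu> B)" .
        then have "1 / measure \<mu> A * measure \<mu> (A \<inter> B) \<le> (1 + \<eta>) * (K * (2 * measure \<nu> B))"
          using inv_le \<eta> by (intro mult_mono) auto
        then show "measure \<mu>A B \<le> (1 + \<eta>) * (K * 2) * measure \<nu> B" using mA[OF B] by simp
      qed
      have "weak_conv01 (\<lambda>k. cesaro S \<mu>A (Suc k)) \<nu>"
        using A(4) \<eta> by (intro ergodic01_cesaro_weak_conv[OF m \<nu> d\<nu> D0 pA d2]) auto
      then have "(\<lambda>k. integral\<^sup>L (cesaro S \<mu>A (Suc k)) f) \<longlonglongrightarrow> integral\<^sup>L \<nu> f"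
        using f by (simp add: weak_conv01_def)
      from LIMSEQ_D[OF this, of "e / 2"] \<open>e > 0\<close> obtain n where
        n: "\<And>k. k \<ge> n \<Longrightarrow> \<bar>integral\<^sup>L (cesaro S \<mu>A (Suc k)) f - integral\<^sup>L \<nu> f\<bar> < e / 2" by auto
      have close: "\<bar>integral\<^sup>L (cesaro S \<mu>A (Suc k)) f - integral\<^sup>L (cesaro S \<mu> (Suc k)) f\<bar> \<le> e / 2" for k
      proof -
        have "integral\<^sup>L (cesaro S \<mu>A (Suc k)) f = (\<Sum>t<Suc k. integral\<^sup>L \<mu>A (\<lambda>x. f ((S ^^ t) x))) / real (Suc k)"
          "integral\<^sup>L (cesaro S \<mu> (Suc k)) f = (\<Sum>t<Suc k. integral\<^sup>L \<mu> (\<lambda>x. f ((S ^^ t) x))) / real (Suc k)"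
          by (rule integral_cesaro[OF m _ _ bf]; simp add: pA \<mu>)+
        then have "\<bar>integral\<^sup>L (cesaro S \<mu>A (Suc k)) f - integral\<^sup>L (cesaro S \<mu> (Suc k)) f\<bar>
          = \<bar>\<Sum>t<Suc k. integral\<^sup>L \<mu>A (\<lambda>x. f ((S ^^ t) x)) - integral\<^sup>L \<mu> (\<lambda>x. f ((S ^^ t) x))\<bar> / real (Suc k)"
          by (simp add: diff_divide_distrib[symmetric] sum_subtractf[symmetric] del: sum.lessThan_Suc)
        also have "\<dots> \<le> (\<Sum>t<Suc k. 2 * R * \<eta>) / real (Suc k)"
        proof (intro divide_right_mono order_trans[OF sum_abs] sum_mono)
          fix t
          note mt = measurable_funpow_01[OF m, of t]
          show "\<bar>integral\<^sup>L \<mu>A (\<lambda>x. f ((S ^^ t) x)) - integral\<^sup>L \<mu> (\<lambda>x. f ((S ^^ t) x))\<bar> \<le> 2 * R * \<eta>"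
            using R(2) maps_01[OF mt] \<eta> by (intro integral_close_of_dominated[OF pA \<mu>(1) d1] bdd01_compose[OF bf mt]) auto
        qed simp
        also have "\<dots> = 2 * R * \<eta>" by (simp add: field_simps del: sum.lessThan_Suc)
        also have "\<dots> = e / 2" using R(1) by (simp add: \<eta>_def)
        finally show ?thesis .
      qed
      have "norm (integral\<^sup>L (cesaro S \<mu> (Suc k)) f - integral\<^sup>L \<nu> f) < e" if "k \<ge> n" for k
        using n[OF that] close[of k] unfolding real_norm_def by linarith
      then show "\<exists>n. \<forall>k\<ge>n. norm (integral\<^sup>L (cesaro S \<mu> (Suc k)) f - integral\<^sup>L \<nu> f) < e" by blast
    qed
    then show "(\<lambda>k. integral\<^sup>L (cesaro S \<mu> k) f) \<longlonglongrightarrow> integral\<^sup>L \<nu> f" by (rule LIMSEQ_imp_Suc)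
  qed
  moreover have "?U \<inter> {0..1} \<noteq> {}" unfolding U(1) using ab(2) by simp
  ultimately show ?thesis unfolding SBR_def L01_def[symmetric] using p\<nu>
    by (intro conjI exI[of _ ?U]) auto
qed

text \<open>A second invariant measure would yield two mutually singular ones. Each carrier supports
  an ergodic measure, hence an SBR measure, hence \<mu>S, which would then have full mass on two
  disjoint sets.\<close>

lemma unique_SBR_imp_unique_inv01:
  assumes S: "lasota_yorke S \<rho> C" and uniq: "\<And>\<nu>. SBR S \<nu> \<Longrightarrow> \<nu> = \<mu>S" and \<sigma>: "inv01 S \<sigma>"
  shows "\<sigma> = \<mu>S"
proof -
  note m = lasota_yorke_measurable[OF S]
  have erg: "measure \<mu>S E = 1 \<and> inv01 S \<mu>S" if \<mu>: "inv01 S \<mu>" "E \<in> sets M01" "measure \<mu> E = 1" for \<mu> E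
  proof -
    obtain k :: nat where "C / (1 - \<rho>) * measure L01 E < real k" using reals_Archimedean2 by blast
    from ergodic01_exists[OF S \<mu> this] obtain \<nu> where "ergodic01 S \<nu>" "measure \<nu> E = 1" by blast
    then show ?thesis using uniq[OF ergodic01_imp_SBR[OF S]] by (metis ergodic01_def)
  qed
  \<comment> \<open>\<open>SBR\<close> asks for neither invariance nor absolute continuity; both
    come from identifying \<mu>S with an ergodic measure.\<close>
  have "inv01 S \<mu>S"
    using erg[OF \<sigma>, of "{0..1}"] sets.top[of M01] prob01_measure[OF inv01D(1)[OF \<sigma>]] by simp
  show ?thesis
  proof (rule ccontr)
    assume "\<sigma> \<noteq> \<mu>S"
    from inv01_singular_pair[OF m \<sigma> \<open>inv01 S \<mu>S\<close> this] obtain \<mu>1 \<mu>2 E where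
      \<mu>: "inv01 S \<mu>1" "inv01 S \<mu>2" "E \<in> sets M01" "measure \<mu>1 E = 1" "measure \<mu>2 ({0..1} - E) = 1" by metis
    have "measure \<mu>S E = 1" using erg[OF \<mu>(1,3,4)] by simp
    moreover have "measure \<mu>S ({0..1} - E) = 1"
      using erg[OF \<mu>(2) _ \<mu>(5)] \<mu>(3) sets.top[of M01] by auto
    ultimately show False using measure_compl_01[OF inv01D(1)[OF \<open>inv01 S \<mu>S\<close>] \<mu>(3)] by simp
  qed
qed

section \<open>Expanding maps\<close>

text \<open>E stands for (1 / T')' and is fixed before the test function, so one distortion bound
  serves all of them. The limits s and t stay inside the open branch, where T has two-sided
  derivatives.\<close>

definition branch_distortion :: "real \<Rightarrow> (real \<Rightarrow> real) \<Rightarrow> real \<Rightarrow> real \<Rightarrow> (real \<Rightarrow> real) \<Rightarrow> bool" where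
  "branch_distortion lam T p q E \<longleftrightarrow> (\<forall>g \<phi> c s t.
     (\<forall>x\<in>{0..1}. (\<phi> has_real_derivative g x) (at x)) \<and> (\<forall>x\<in>{0..1}. \<bar>\<phi> x\<bar> \<le> c) \<and> p < s \<and> s \<le> t \<and> t < q \<longrightarrow>
     (\<exists>I. ((\<lambda>x. g (T x) + \<phi> (T x) * E x) has_integral I) {s..t} \<and> \<bar>I\<bar> \<le> 2 * c / lam))"

text \<open>On a branch, \<open>g \<circ> T\<close> equals the derivative of \<open>(\<phi> \<circ> T) / T'\<close> (with \<open>\<phi>' = g\<close>) up to the
  bounded distortion term \<open>(\<phi> \<circ> T) (1 / T')'\<close>.\<close>
lemma good_piece_distortion:
  assumes pq: "0 \<le> p" "p < q" "q \<le> 1" and X: "{p<..<q} \<subseteq> X" "X \<subseteq> {p..q}"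
    and T01: "\<And>x. x \<in> {0..1} \<Longrightarrow> T x \<in> {0..1}" and lam: "lam > 0" and good: "good_piece lam T X"
  obtains E K where "K \<ge> 0" "\<forall>x\<in>{p<..<q}. \<bar>E x\<bar> \<le> K" "continuous_on {p<..<q} E" "continuous_on {p<..<q} T"
    "branch_distortion lam T p q E"
proof -
  obtain T' T'' D K where
    T': "\<And>x. x \<in> X \<Longrightarrow> (T has_real_derivative T' x) (at x within X)" and
    T'': "\<And>x. x \<in> X \<Longrightarrow> (T' has_real_derivative T'' x) (at x within X)" and
    cT'': "continuous_on X T''" and ge: "\<And>x. x \<in> X \<Longrightarrow> \<bar>T' x\<bar> \<ge> lam" and
    D: "\<And>x. x \<in> X \<Longrightarrow> ((\<lambda>y. 1 / T' y) has_real_derivative D x) (at x within X)" and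
    K: "\<And>x. x \<in> X \<Longrightarrow> \<bar>D x\<bar> \<le> K"
    using good unfolding good_piece_def by blast
  have at: "at x within X = at x" if "x \<in> {p<..<q}" for x
    using that X(1) by (intro at_within_interior) (meson interior_maximal open_greaterThanLessThan subsetD)
  have dT: "(T has_real_derivative T' x) (at x)" and dT': "(T' has_real_derivative T'' x) (at x)"
    and dD: "((\<lambda>y. 1 / T' y) has_real_derivative D x) (at x)" and ne: "T' x \<noteq> 0" if "x \<in> {p<..<q}" for x
    using T'[of x] T''[of x] D[of x] ge[of x] lam at[OF that] that X(1) by auto
  \<comment> \<open>D is given merely as a derivative. The formula through the continuous T'' makes
    it continuous, which later gives measurability of the distortion term.\<close>
  have Deq: "D x = - T'' x / (T' x)\<^sup>2" if x: "x \<in> {p<..<q}" for x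
  proof -
    have "((\<lambda>y. 1 / T' y) has_real_derivative (0 * T' x - 1 * T'' x) / (T' x * T' x)) (at x)"
      by (rule DERIV_divide[OF DERIV_const dT'[OF x] ne[OF x]])
    then show ?thesis using DERIV_unique[OF dD[OF x]] by (simp add: power2_eq_square)
  qed
  have cT: "continuous_on {p<..<q} T" and cT': "continuous_on {p<..<q} T'"
    by (intro continuous_at_imp_continuous_on ballI DERIV_isCont[OF dT] DERIV_isCont[OF dT']; assumption)+
  have "continuous_on {p<..<q} (\<lambda>x. - T'' x / (T' x)\<^sup>2)"
    using ne by (intro continuous_intros continuous_on_subset[OF cT'' X(1)] cT') auto
  then have cD: "continuous_on {p<..<q} D" by (subst continuous_on_cong[OF refl Deq])
  have mid: "(p + q) / 2 \<in> X" using X(1) pq by auto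
  show thesis
  proof (rule that[of K D])
    show "K \<ge> 0" using K[OF mid] by linarith
    show "\<forall>x\<in>{p<..<q}. \<bar>D x\<bar> \<le> K" using K X(1) by auto
    show "branch_distortion lam T p q D" unfolding branch_distortion_def
    proof (intro allI impI, elim conjE)
      fix g \<phi> :: "real \<Rightarrow> real" and c s t :: real
      assume \<phi>': "\<forall>x\<in>{0..1}. (\<phi> has_real_derivative g x) (at x)" and c': "\<forall>x\<in>{0..1}. \<bar>\<phi> x\<bar> \<le> c"
        and st: "p < s" "s \<le> t" "t < q"
      note \<phi> = \<phi>'[rule_format] and c = c'[rule_format]
      define \<psi> where "\<psi> = (\<lambda>x. \<phi> (T x) * (1 / T' x))"
      have b: "\<bar>\<psi> x\<bar> \<le> c / lam" if x: "x \<in> {p<..<q}" for x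
      proof -
        have "T x \<in> {0..1}" using T01[of x] x pq by auto
        then have "\<bar>\<phi> (T x)\<bar> \<le> c" by (rule c)
        moreover have "\<bar>1 / T' x\<bar> \<le> 1 / lam" using ge[of x] X(1) x lam by (auto simp: field_simps)
        ultimately have "\<bar>\<psi> x\<bar> \<le> c * (1 / lam)" unfolding \<psi>_def abs_mult by (intro mult_mono) auto
        then show ?thesis by simp
      qed
      have "((\<lambda>x. g (T x) + \<phi> (T x) * D x) has_integral \<psi> t - \<psi> s) {s..t}"
      proof (rule fundamental_theorem_of_calculus)
        fix x assume "x \<in> {s..t}"
        then have x: "x \<in> {p<..<q}" using st by auto
        have "T x \<in> {0..1}" using T01[of x] x pq by auto
        from DERIV_chain2[OF \<phi>[OF this] dT[OF x]]
        have "(\<psi> has_real_derivative g (T x) * T' x * (1 / T' x) + D x * \<phi> (T x)) (at x)"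
          unfolding \<psi>_def by (rule DERIV_mult'[OF _ dD[OF x], THEN DERIV_cong]) (simp add: algebra_simps)
        then have "(\<psi> has_real_derivative g (T x) + \<phi> (T x) * D x) (at x)"
          using ne[OF x] by (simp add: mult.commute)
        then show "(\<psi> has_vector_derivative g (T x) + \<phi> (T x) * D x) (at x within {s..t})"
          by (auto intro: has_field_derivative_at_within simp flip: has_real_derivative_iff_has_vector_derivative)
      qed (use st in auto)
      moreover have "\<bar>\<psi> t - \<psi> s\<bar> \<le> 2 * c / lam" 
      proof -
        have "2 * c / lam = c / lam + c / lam" by simp
        then show ?thesis using b[of s] b[of t] st by (auto simp: abs_le_iff)
      qed
      ultimately show "\<exists>I. ((\<lambda>x. g (T x) + \<phi> (T x) * D x) has_integral I) {s..t} \<and> \<bar>I\<bar> \<le> 2 * c / lam" by blast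
    qed
  qed (use cD cT in auto)
qed

text \<open>The distortion identity holds strictly inside a branch. Trimming length d at each end
  costs at most R * d there, so the bound extends to the closed branch.\<close>

lemma set_integral_closure_bound:
  assumes H: "bdd01 H" and pq: "0 \<le> p" "q \<le> 1"
    and inner: "\<And>s t. p < s \<Longrightarrow> s \<le> t \<Longrightarrow> t < q \<Longrightarrow> \<bar>LINT x:{s..t}|L01. H x\<bar> \<le> m" and "m \<ge> 0"
    and st: "p \<le> s" "s \<le> t" "t \<le> q"
  shows "\<bar>LINT x:{s..t}|L01. H x\<bar> \<le> m"
proof (cases "s = t")
  case True
  obtain R where "\<And>x. x \<in> {0..1} \<Longrightarrow> \<bar>H x\<bar> \<le> R" using bdd01_bound[OF H] by blast
  from abs_set_integral_le_length[OF H this, of s t] show ?thesis using True st pq \<open>m \<ge> 0\<close> by auto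
next
  case False
  obtain R where R: "R > 0" "\<And>x. x \<in> {0..1} \<Longrightarrow> \<bar>H x\<bar> \<le> R" using bdd01_bound[OF H] by blast
  show ?thesis
  proof (rule field_le_epsilon)
    fix e :: real assume "e > 0"
    define d where "d = min ((t - s) / 2) (e / (2 * R))"
    have d: "d > 0" "2 * d \<le> t - s" "2 * (R * d) \<le> e"
      using False st R(1) \<open>e > 0\<close> by (auto simp: d_def min_def field_simps)
    have "(LINT x:{s..t}|L01. H x) = (LINT x:{s..s + d}|L01. H x) + (LINT x:{s + d..t}|L01. H x)"
      using d st pq by (intro set_integral_combine_01 H) auto
    moreover have "(LINT x:{s + d..t}|L01. H x) = (LINT x:{s + d..t - d}|L01. H x) + (LINT x:{t - d..t}|L01. H x)"
      using d st pq by (intro set_integral_combine_01 H) auto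
    moreover have "\<bar>LINT x:{s..s + d}|L01. H x\<bar> \<le> R * (s + d - s)" "\<bar>LINT x:{t - d..t}|L01. H x\<bar> \<le> R * (t - (t - d))"
      using d st pq abs_set_integral_le_length[OF H R(2), of s "s + d"] abs_set_integral_le_length[OF H R(2), of "t - d" t] by simp_all
    moreover have "\<bar>LINT x:{s + d..t - d}|L01. H x\<bar> \<le> m" using d st by (intro inner) auto
    ultimately show "\<bar>LINT x:{s..t}|L01. H x\<bar> \<le> m + e" using d(3) by (simp add: abs_le_iff)
  qed
qed

lemma expanding_partition:
  assumes "expanding lam T"
  obtains k :: nat and p X where "p 0 = 0" "p k = 1" "\<forall>j<k. p j < p (Suc j)"
    "\<forall>j<k. {p j<..<p (Suc j)} \<subseteq> X j" "\<forall>j<k. X j \<subseteq> {p j..p (Suc j)}"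
    "(\<Union>j<k. X j) = {0..1}" "\<forall>j<k. good_piece lam T (X j)"
proof -
  from assms[unfolded expanding_def, THEN conjunct2] obtain k p X where
    *: "p 0 = 0 \<and> p k = 1 \<and> (\<forall>j<k. p j < p (Suc j)) \<and>
        (\<forall>j<k. {p j<..<p (Suc j)} \<subseteq> X j \<and> X j \<subseteq> {p j..p (Suc j)}) \<and>
        (\<forall>j<k. \<forall>j'<k. j \<noteq> j' \<longrightarrow> X j \<inter> X j' = {}) \<and>
        (\<Union>j<k. X j) = {0..1} \<and>
        (\<forall>j<k. good_piece lam T (X j))" by (elim exE)
  show thesis by (rule that[of p k X]) (use * in simp_all)
qed

lemma expanding_measurable:
  assumes "expanding lam T" shows "T \<in> measurable M01 M01"
proof -
  have T01: "\<forall>x\<in>{0..1}. T x \<in> {0..1}" using assms unfolding expanding_def by (rule conjunct1)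
  obtain k :: nat and p X where part: "p 0 = 0" "p k = 1" "\<forall>j<k. p j < p (Suc j)"
    "\<forall>j<k. {p j<..<p (Suc j)} \<subseteq> X j" "\<forall>j<k. X j \<subseteq> {p j..p (Suc j)}"
    "(\<Union>j<k. X j) = {0..1}" "\<forall>j<k. good_piece lam T (X j)"
    by (rule expanding_partition[OF assms])
  have X0: "\<And>j. j < k \<Longrightarrow> {p j<..<p (Suc j)} \<subseteq> X j" "\<And>j. j < k \<Longrightarrow> X j \<subseteq> {p j..p (Suc j)}" and
    X: "(\<Union>j<k. X j) = {0..1}" "\<And>j. j < k \<Longrightarrow> good_piece lam T (X j)"
    using part by blast+
  have Xb: "X j \<in> sets borel" if "j < k" for j
  proof -
    \<comment> \<open>A piece is an open interval with at most two added endpoints, hence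
      Borel.\<close>
    have "x \<in> {p j<..<p (Suc j)} \<union> (X j \<inter> {p j, p (Suc j)})" if "x \<in> X j" for x
      using X0(2)[OF \<open>j < k\<close>] that by force
    then have eq: "X j = {p j<..<p (Suc j)} \<union> (X j \<inter> {p j, p (Suc j)})" using X0(1)[OF that] by blast
    have "X j \<inter> {p j, p (Suc j)} \<in> sets borel" by (intro borel_closed finite_imp_closed) auto
    then show ?thesis by (subst eq) (intro sets.Un; simp)
  qed
  have "T \<in> measurable M01 borel"
  proof (rule measurable_piecewise_restrict[of "X ` {..<k}"])
    show "space M01 \<subseteq> \<Union> (X ` {..<k})" using X(1) by simp
    fix \<Omega> assume "\<Omega> \<in> X ` {..<k}"
    then obtain j where j: "j < k" "\<Omega> = X j" by auto
    have sub: "\<Omega> \<subseteq> {0..1}" using X(1) j by auto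
    show "\<Omega> \<inter> space M01 \<in> sets M01" using Xb[OF j(1)] j(2) sub by (auto simp: in_sets_M01)
    obtain T' where "\<forall>x\<in>X j. (T has_real_derivative T' x) (at x within X j)"
      using X(2)[OF j(1)] unfolding good_piece_def by blast
    then have "continuous_on \<Omega> T" unfolding j(2) by (auto simp: continuous_on_eq_continuous_within dest: DERIV_continuous)
    then have "T \<in> borel_measurable (restrict_space borel \<Omega>)" by (rule borel_measurable_continuous_on_restrict)
    moreover have "restrict_space M01 \<Omega> = restrict_space borel \<Omega>"
      unfolding M01_def using sub Xb[OF j(1)] j(2) by (subst restrict_restrict_space) (auto simp: Int_absorb1)
    ultimately show "T \<in> borel_measurable (restrict_space M01 \<Omega>)" by simp
  qed auto
  then show ?thesis unfolding M01_def using T01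
    by (intro measurable_restrict_space2) (auto simp: space_restrict_space M01_def)
qed

lemma AE_not_in_finite:
  assumes "fin01 \<mu>" "dominated \<mu> L01 K" "finite A" shows "AE x in \<mu>. x \<notin> A"
proof (rule AE_dominated[OF assms(1,2)])
  have "A \<in> null_sets lborel" using assms(3) by (rule finite_imp_null_set_lborel)
  then have "AE x in lborel. x \<notin> A" by (rule AE_not_in)
  then show "AE x in L01. x \<notin> A" unfolding L01_def by (subst AE_restrict_space_iff) auto
qed

lemma partition_unique:
  fixes p :: "nat \<Rightarrow> real"
  assumes p: "\<And>j. j < k \<Longrightarrow> p j < p (Suc j)" and ij: "i < k" "j < k" "x \<in> {p i<..<p (Suc i)}" "x \<in> {p j..p (Suc j)}"
  shows "i = j"
proof (rule ccontr)
  assume "i \<noteq> j"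
  then consider "i < j" | "j < i" by linarith
  then show False
  proof cases
    case 1
    then have "p (Suc i) \<le> p j" using partition_mono[of k p "Suc i" j] p ij by auto
    then show False using ij by auto
  next
    case 2
    then have "p (Suc j) \<le> p i" using partition_mono[of k p "Suc j" i] p ij by auto
    then show False using ij by auto
  qed
qed

text \<open>The test function \<open>g \<circ> T\<close> is a total derivative up to the distortion terms. Subtracting
  from the primitive on each branch its linear interpolation makes it vanish at the partition
  points, at the price of doubling its oscillation; this is the factor 2.\<close>
lemma expanding_lasota_yorke_inequality:
  assumes T: "expanding lam T" and lam: "lam > 0"
  obtains C where "C \<ge> 0"
    "\<And>\<mu> B. fin01 \<mu> \<Longrightarrow> var_le \<mu> B \<Longrightarrow> var_le (distr \<mu> M01 T) (2 / lam * B + C * measure \<mu> {0..1})"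
proof -
  have T01: "T x \<in> {0..1}" if "x \<in> {0..1}" for x using T[unfolded expanding_def, THEN conjunct1] that by simp
  note Tm = expanding_measurable[OF T]
  obtain k :: nat and p X where part: "p 0 = 0" "p k = 1" "\<forall>j<k. p j < p (Suc j)"
    "\<forall>j<k. {p j<..<p (Suc j)} \<subseteq> X j" "\<forall>j<k. X j \<subseteq> {p j..p (Suc j)}"
    "(\<Union>j<k. X j) = {0..1}" "\<forall>j<k. good_piece lam T (X j)"
    by (rule expanding_partition[OF T])
  have p: "p j < p (Suc j)" if "j < k" for j using part(3) that by blast
  have kpos: "k > 0" using part(1,2) by (cases k) auto
  have p01: "0 \<le> p j" "p j \<le> 1" if "j \<le> k" for j
    using partition_mono[of k p 0 j] partition_mono[of k p j k] part(1,2) p that by auto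
  define Q where "Q = (\<lambda>j E K. K \<ge> 0 \<and> (\<forall>x\<in>{p j<..<p (Suc j)}. \<bar>E x\<bar> \<le> K) \<and>
    continuous_on {p j<..<p (Suc j)} E \<and> continuous_on {p j<..<p (Suc j)} T \<and> branch_distortion lam T (p j) (p (Suc j)) E)"
  have "\<exists>E K. Q j E K" if j: "j < k" for j
    by (rule good_piece_distortion[OF _ p[OF j] _ _ _ T01 lam, of "X j"])
      (use j part p01[of j] p01[of "Suc j"] in \<open>auto simp: Q_def\<close>)
  then obtain E K where Q: "\<And>j. j < k \<Longrightarrow> Q j (E j) (K j)" by metis
  have K0: "K j \<ge> 0" and EK: "\<And>x. x \<in> {p j<..<p (Suc j)} \<Longrightarrow> \<bar>E j x\<bar> \<le> K j"
    and cE: "continuous_on {p j<..<p (Suc j)} (E j)" and cT: "continuous_on {p j<..<p (Suc j)} T"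
    and dist: "branch_distortion lam T (p j) (p (Suc j)) (E j)" if "j < k" for j
    using Q[OF that] unfolding Q_def by auto
  define w where "w = (\<lambda>j. p (Suc j) - p j)"
  have w: "w j > 0" if "j < k" for j using p[OF that] by (simp add: w_def)
  \<comment> \<open>K j / 2 comes from the distortion term, with primitive bounded by M / 2; 1 /
    (lam * w j) comes from the slope of the interpolation on piece j.\<close>
  define C where "C = (\<Sum>j<k. K j / 2 + 1 / (lam * w j))"
  have "C \<ge> 0" unfolding C_def using K0 w lam by (intro sum_nonneg add_nonneg_nonneg) (simp_all add: less_imp_le)
  moreover have "var_le (distr \<mu> M01 T) (2 / lam * B + C * measure \<mu> {0..1})" if \<mu>: "fin01 \<mu>" "var_le \<mu> B" for \<mu> B
  proof (rule var_le_continuous[OF fin01_distr[OF \<mu>(1) Tm]])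
    fix g M assume g: "continuous_on {0..1} g" "osc_le g M" "(M::real) > 0"
    note bg = bdd01_continuous[OF g(1)]
    obtain \<phi> where \<phi>: "\<And>x. x \<in> {0..1} \<Longrightarrow> (\<phi> has_real_derivative g x) (at x)"
      "\<And>x. x \<in> {0..1} \<Longrightarrow> \<bar>\<phi> x\<bar> \<le> M / 2" using centered_primitive[OF g(1,2)] by blast
    have c\<phi>: "continuous_on {0..1} \<phi>" by (intro continuous_at_imp_continuous_on ballI DERIV_isCont[OF \<phi>(1)])
    define U where "U = (\<lambda>j. {p j<..<p (Suc j)})"
    define I where "I = (\<lambda>j. {p j..p (Suc j)})"
    have I: "I j \<in> sets M01" "U j \<in> sets M01" "I j \<subseteq> {0..1}" "U j \<subseteq> {0..1}" if "j < k" for j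
      using p01[of j] p01[of "Suc j"] that by (auto simp: in_sets_M01 I_def U_def)
    define V where "V = (\<lambda>j x. indicator (U j) x *\<^sub>R (\<phi> (T x) * E j x))"
    have V: "bdd01 (V j)" "\<And>x. \<bar>V j x\<bar> \<le> M / 2 * K j" if j: "j < k" for j
    proof -
      have "continuous_on (U j) (\<lambda>x. \<phi> (T x) * E j x)" unfolding U_def
        using T01 I(4)[OF j] by (intro continuous_intros continuous_on_compose2[OF c\<phi>] cT cE j) (auto simp: U_def)
      then have "V j \<in> borel_measurable borel" unfolding V_def
        by (intro borel_measurable_continuous_on_indicator) (auto simp: U_def)
      then have m: "V j \<in> borel_measurable M01" unfolding M01_def by (rule measurable_restrict_space1)
      show b: "\<bar>V j x\<bar> \<le> M / 2 * K j" for x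
      proof (cases "x \<in> U j")
        case True
        then have "\<bar>\<phi> (T x)\<bar> \<le> M / 2" "\<bar>E j x\<bar> \<le> K j"
          using I(4)[OF j] \<phi>(2)[OF T01] EK[OF j] by (auto simp: U_def)
        then have "\<bar>\<phi> (T x)\<bar> * \<bar>E j x\<bar> \<le> M / 2 * K j" using g(3) by (intro mult_mono) auto
        then show ?thesis using True by (simp add: V_def abs_mult)
      next
        case False then show ?thesis using K0[OF j] g(3) by (simp add: V_def)
      qed
      show "bdd01 (V j)" using m b by (rule bdd01I)
    qed
    \<comment> \<open>Adding the distortion term V j makes H j an exact derivative on the open
      branch; it is subtracted again in \<open>e\<close>.\<close>
    define H where "H = (\<lambda>j x. indicator (U j) x * g (T x) + V j x)"
    have bH: "bdd01 (H j)" if "j < k" for j unfolding H_def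
      by (intro bdd01_intros I V that bdd01_compose[OF bg Tm])
    have HM: "\<bar>LINT x:{s..t}|L01. H j x\<bar> \<le> M / lam" if j: "j < k" and st: "p j \<le> s" "s \<le> t" "t \<le> p (Suc j)" for j s t
    proof (rule set_integral_closure_bound[OF bH[OF j] _ _ _ _ st])
      show "0 \<le> p j" "p (Suc j) \<le> 1" "0 \<le> M / lam" using p01[of j] p01[of "Suc j"] j g(3) lam by auto
      fix s t assume st: "p j < s" "s \<le> t" "t < p (Suc j)"
      obtain J where J: "((\<lambda>x. g (T x) + \<phi> (T x) * E j x) has_integral J) {s..t}" "\<bar>J\<bar> \<le> 2 * (M / 2) / lam"
        using dist[OF j] st \<phi> unfolding branch_distortion_def by blast
      have "((H j) has_integral J) {s..t}"
        by (rule has_integral_eq[OF _ J(1)]) (use st in \<open>auto simp: H_def V_def U_def\<close>)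
      moreover have "(LINT x:{s..t}|L01. H j x) = integral {s..t} (H j)"
        using st p01[of j] p01[of "Suc j"] j by (intro set_integral_01_HK(1) bH) auto
      ultimately show "\<bar>LINT x:{s..t}|L01. H j x\<bar> \<le> M / lam" using J(2) by (simp add: integral_unique)
    qed
    \<comment> \<open>The slope of the linear interpolation of the primitive of H j between the ends
      of piece j.\<close>
    define l where "l = (\<lambda>j. (LINT x:{p j..p (Suc j)}|L01. H j x) / w j)"
    have l: "\<bar>l j\<bar> \<le> M / (lam * w j)" if j: "j < k" for j
    proof -
      have "\<bar>l j\<bar> = \<bar>LINT x:{p j..p (Suc j)}|L01. H j x\<bar> / w j" using w[OF j] by (simp add: l_def)
      also have "\<dots> \<le> M / lam / w j" using HM[OF j, of "p j" "p (Suc j)"] p[OF j] w[OF j] by (intro divide_right_mono) auto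
      finally show ?thesis by simp
    qed
    define s where "s = (\<lambda>x. \<Sum>j<k. l j * indicator (I j) x)"
    define h where "h = (\<lambda>x. \<Sum>j<k. H j x)"
    have bs: "bdd01 s" unfolding s_def by (intro bdd01_intros I) simp
    have bh: "bdd01 h" unfolding h_def by (intro bdd01_intros bH) simp
    have int: "(LINT x:{p j..t}|L01. h x - s x) = (LINT x:{p j..t}|L01. H j x) - l j * (t - p j)"
      if j: "j < k" "p j \<le> t" "t \<le> p (Suc j)" for j t
    proof -
      have st: "{p j..t} \<subseteq> {0..1}" using p01[of j] p01[of "Suc j"] j by auto
      have "h x = H j x" if "x \<in> {p j..t}" for x
      proof -
        have "h x = (\<Sum>i<k. if i = j then H j x else 0)" unfolding h_def
        proof (rule sum.cong[OF refl])
          fix i assume "i \<in> {..<k}"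
          then have "i \<noteq> j \<Longrightarrow> x \<notin> U i" using partition_unique[where p = p and k = k and i = i and j = j and x = x, OF p] that j by (auto simp: U_def)
          then show "H i x = (if i = j then H j x else 0)" by (auto simp: H_def V_def)
        qed
        also have "\<dots> = H j x" using j by (simp add: sum.delta)
        finally show ?thesis .
      qed
      then have "(LINT x:{p j..t}|L01. h x) = (LINT x:{p j..t}|L01. H j x)"
        unfolding set_lebesgue_integral_def by (intro Bochner_Integration.integral_cong refl) (simp add: indicator_def)
      moreover have "(LINT x:{p j..t}|L01. s x) = l j * measure L01 (I j \<inter> {p j..t})" unfolding s_def
        by (rule set_integral_partition_sum[where k = k and p = p]) (use part p I j in \<open>auto simp: I_def\<close>)
      moreover have "I j \<inter> {p j..t} = {p j..t}" using j by (auto simp: I_def)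
      moreover have "measure L01 {p j..t} = t - p j" using st j by (subst measure_L01_interval) auto
      ultimately show ?thesis using set_integral_diff_01[OF bh bs st] by simp
    qed
    have osc: "osc_le (\<lambda>x. h x - s x) (2 * (M / lam))"
    proof (rule osc_le_partition[where k = k and p = p])
      show "(LINT x:{p j..p (Suc j)}|L01. h x - s x) = 0" if "j < k" for j
        using int[OF that, of "p (Suc j)"] p[OF that] w[OF that] by (simp add: l_def w_def)
      fix j t assume j: "j < k" "p j \<le> t" "t \<le> p (Suc j)"
      define a where "a = (LINT x:{p j..t}|L01. H j x)"
      define b where "b = (LINT x:{t..p (Suc j)}|L01. H j x)"
      \<comment> \<open>The error of linear interpolation is the combination (1 - \<theta>) * a -
        \<theta> * b of the integrals on both sides of t. It is therefore at most M / lam; bounding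
        the interpolant separately would give twice as much.\<close>
      define \<theta> where "\<theta> = (t - p j) / w j"
      have \<theta>: "0 \<le> \<theta>" "\<theta> \<le> 1" using j w[OF j(1)] by (auto simp: \<theta>_def w_def)
      have "(LINT x:{p j..p (Suc j)}|L01. H j x) = a + b" unfolding a_def b_def
        using j p01[of j] p01[of "Suc j"] by (intro set_integral_combine_01 bH) auto
      then have "l j * (t - p j) = \<theta> * (a + b)" by (simp add: l_def \<theta>_def)
      then have "(LINT x:{p j..t}|L01. h x - s x) = (1 - \<theta>) * a - \<theta> * b"
        unfolding int[OF j] a_def[symmetric] by (simp add: algebra_simps)
      also have "\<bar>\<dots>\<bar> \<le> (1 - \<theta>) * \<bar>a\<bar> + \<theta> * \<bar>b\<bar>"
        using \<theta> abs_triangle_ineq4[of "(1 - \<theta>) * a" "\<theta> * b"] by (simp add: abs_mult)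
      also have "\<dots> \<le> (1 - \<theta>) * (M / lam) + \<theta> * (M / lam)"
        unfolding a_def b_def using \<theta> HM[OF j(1)] j by (intro add_mono mult_left_mono) auto
      also have "\<dots> = (1 - \<theta> + \<theta>) * (M / lam)" by (rule distrib_right[symmetric])
      finally show "\<bar>LINT x:{p j..t}|L01. h x - s x\<bar> \<le> M / lam" by simp
    qed (use part p bh bs in \<open>auto intro: bdd01_intros\<close>)
    \<comment> \<open>The slopes and distortion terms are bounded pointwise by C * M, so they are
      charged to the mass and not to the variation of \<mu>.\<close>
    define e where "e = (\<lambda>x. s x - (\<Sum>j<k. V j x))"
    have be: "bdd01 e" unfolding e_def by (intro bdd01_intros bs V) simp
    have AE: "AE x in \<mu>. g (T x) = (h x - s x) + e x"
    proof -
      have "AE x in \<mu>. x \<notin> p ` {..k}"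
        by (rule AE_not_in_finite[OF \<mu>(1) var_le_dominated[OF \<mu>]]) simp
      moreover have "AE x in \<mu>. x \<in> {0..1}" by (rule AE_I2) (simp add: fin01_space[OF \<mu>(1)])
      ultimately show ?thesis
      proof eventually_elim
        case (elim x)
        obtain j where j: "j < k" "p j \<le> x" "x \<le> p (Suc j)"
          using partition_locate[OF part(1,2) _ _ kpos, of x] elim(2) by auto
        then have xj: "x \<in> U j" using elim(1) unfolding U_def by (smt (verit) greaterThanLessThan_iff image_eqI atMost_iff Suc_leI less_imp_le)
        have "(\<Sum>i<k. indicator (U i) x * g (T x)) = (\<Sum>i<k. if i = j then g (T x) else 0)"
        proof (rule sum.cong[OF refl])
          fix i assume "i \<in> {..<k}"
          then have "i \<noteq> j \<Longrightarrow> x \<notin> U i" using partition_unique[where p = p and k = k and i = i and j = j and x = x, OF p] j by (auto simp: U_def)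
          then show "indicator (U i) x * g (T x) = (if i = j then g (T x) else 0)" using xj by auto
        qed
        also have "\<dots> = g (T x)" using j by (simp add: sum.delta)
        finally show ?case by (simp add: h_def H_def e_def sum.distrib)
      qed
    qed
    have eb: "\<bar>e x\<bar> \<le> C * M" for x
    proof -
      have "\<bar>e x\<bar> \<le> \<bar>s x\<bar> + \<bar>\<Sum>j<k. V j x\<bar>" unfolding e_def by (rule abs_triangle_ineq4)
      also have "\<dots> \<le> (\<Sum>j<k. M / (lam * w j)) + (\<Sum>j<k. M / 2 * K j)"
      proof (intro add_mono order_trans[OF sum_abs] sum_mono)
        show "\<bar>s x\<bar> \<le> (\<Sum>j<k. M / (lam * w j))" unfolding s_def
        proof (intro order_trans[OF sum_abs] sum_mono)
          fix j assume "j \<in> {..<k}"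
          then have j: "j < k" by simp
          show "\<bar>l j * indicator (I j) x\<bar> \<le> M / (lam * w j)"
            using l[OF j] by (auto simp: indicator_def intro: order_trans[OF abs_ge_zero])
        qed
      qed (use V in auto)
      also have "\<dots> = C * M" unfolding C_def sum_distrib_right sum.distrib[symmetric]
        by (intro sum.cong refl) (simp add: algebra_simps)
      finally show ?thesis .
    qed
    have "integral\<^sup>L (distr \<mu> M01 T) g = integral\<^sup>L \<mu> (\<lambda>x. g (T x))"
      by (rule integral_distr_01[OF \<mu>(1) Tm bg])
    also have "\<dots> = integral\<^sup>L \<mu> (\<lambda>x. (h x - s x) + e x)"
      by (intro integral_cong_AE bdd01_borel[OF \<mu>(1)] bdd01_compose[OF bg Tm] bdd01_intros bh bs be AE)
    also have "\<dots> = integral\<^sup>L \<mu> (\<lambda>x. h x - s x) + integral\<^sup>L \<mu> e"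
      by (intro integral_add_01 \<mu> bdd01_intros bh bs be)
    also have "integral\<^sup>L \<mu> (\<lambda>x. h x - s x) \<le> B * (2 * (M / lam))"
      by (intro var_leD[OF \<mu>(2)] bdd01_intros bh bs osc)
    also have "integral\<^sup>L \<mu> e \<le> C * M * measure \<mu> {0..1}"
      using integral_abs_le_01[OF \<mu>(1) be, of "C * M"] eb by auto
    finally show "integral\<^sup>L (distr \<mu> M01 T) g \<le> (2 / lam * B + C * measure \<mu> {0..1}) * M"
      by (simp add: algebra_simps)
  qed
  ultimately show thesis using that by blast
qed

section \<open>The perturbation\<close>

context
  fixes n :: nat and \<alpha> a a' c :: "nat \<Rightarrow> real" and \<delta> :: real
  assumes adm: "admissible n \<alpha> a a' c \<delta>" and n: "n \<ge> 1" and \<alpha>: "\<And>i. i < n \<Longrightarrow> \<alpha> i > 0"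
begin

lemma admissible_less: "i < n \<Longrightarrow> a i < a' i"
  using adm by (simp add: admissible_def)

lemma admissible_maps: "i < n \<Longrightarrow> x \<in> {a i..a' i} \<Longrightarrow> \<alpha> i * x + c i \<in> {a i..a' i}"
  using adm unfolding admissible_def by blast

lemma admissible_ordered: "i < j \<Longrightarrow> j < n \<Longrightarrow> a' i \<le> a j"
proof (induction j)
  case (Suc j)
  have "a' j \<le> a (Suc j)" using adm Suc.prems by (simp add: admissible_def)
  moreover have "a' i \<le> a' j"
  proof (cases "i = j")
    case False
    then have "a' i \<le> a j" using Suc by simp
    then show ?thesis using admissible_less[of j] Suc.prems by simp
  qed simp
  ultimately show ?case by simp
qed simp

lemma admissible_subset: assumes "i < n" shows "{a i..a' i} \<subseteq> {0..1}"
proof -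
  have "0 \<le> a 0" "a' (n - 1) \<le> 1" using adm by (auto simp: admissible_def)
  moreover have "a 0 \<le> a i" using admissible_ordered[of 0 i] admissible_less[of 0] assms by (cases "i = 0") auto
  moreover have "a' i \<le> a' (n - 1)"
  proof (cases "i = n - 1")
    case False
    then have "i < n - 1" "n - 1 < n" using assms by auto
    then show ?thesis using admissible_ordered[of i "n - 1"] admissible_less[of "n - 1"] by linarith
  qed simp
  ultimately show ?thesis by auto
qed

lemma admissible_sets: "i < n \<Longrightarrow> {a i..a' i} \<in> sets M01"
  using admissible_subset by (simp add: in_sets_M01)

lemma tau_cases:
  obtains (piece) i where "i < n" "x \<in> {a i..a' i}" "tau n \<alpha> a a' c x = \<alpha> i * x + c i"
  | (fixed) "\<And>i. i < n \<Longrightarrow> x \<notin> {a i..a' i}" "tau n \<alpha> a a' c x = x"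
proof (cases "\<exists>i<n. x \<in> {a i..a' i}")
  case True
  define j where "j = (LEAST i. i < n \<and> x \<in> {a i..a' i})"
  have "j < n \<and> x \<in> {a j..a' j}" unfolding j_def using True by (rule LeastI_ex)
  moreover have "tau n \<alpha> a a' c x = \<alpha> j * x + c j" using True unfolding tau_def j_def Let_def by simp
  ultimately show thesis using piece[of j] by blast
next
  case False
  then have "tau n \<alpha> a a' c x = x" unfolding tau_def by (rule if_not_P)
  then show thesis using False fixed by blast
qed

lemma tau_measurable: "tau n \<alpha> a a' c \<in> measurable M01 M01"
proof -
  define A where "A = (\<lambda>i. {a i..a' i})"
  define L where "L = (\<lambda>x. LEAST i. i < n \<and> x \<in> A i)"
  have A: "A i \<in> sets borel" for i by (simp add: A_def)
  have "L \<in> measurable borel (count_space UNIV)" unfolding L_def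
  proof (rule measurable_Least)
    show "Measurable.pred borel (\<lambda>x. i < n \<and> x \<in> A i)" for i
      unfolding pred_def using A[of i] by (cases "i < n") auto
  qed
  then have "(\<lambda>x. \<alpha> (L x) * x + c (L x)) \<in> borel_measurable borel"
    by (rule measurable_compose_countable[where f = "\<lambda>i x. \<alpha> i * x + c i", rotated]) simp
  then have "(\<lambda>x. if \<exists>i<n. x \<in> A i then \<alpha> (L x) * x + c (L x) else x) \<in> borel_measurable borel"
  proof (rule measurable_If)
    have "{x \<in> space borel. \<exists>i<n. x \<in> A i} = (\<Union>i<n. A i)" by auto
    also have "\<dots> \<in> sets borel" using A by (intro sets.finite_UN) auto
    finally show "{x \<in> space borel. \<exists>i<n. x \<in> A i} \<in> sets borel" .
  qed simp
  moreover have "(\<lambda>x. if \<exists>i<n. x \<in> A i then \<alpha> (L x) * x + c (L x) else x) = tau n \<alpha> a a' c"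
    by (rule ext) (simp only: tau_def Let_def L_def A_def)
  ultimately have "tau n \<alpha> a a' c \<in> borel_measurable borel" by simp
  moreover have "tau n \<alpha> a a' c x \<in> {0..1}" if "x \<in> {0..1}" for x
    using tau_cases[of x] admissible_maps admissible_subset that by (metis subsetD)
  ultimately show ?thesis unfolding M01_def
    by (intro measurable_restrict_space2 measurable_restrict_space1) (auto simp: space_restrict_space)
qed

text \<open>Endpoints are excluded because at an endpoint common to two intervals the sum has two
  terms, while \<open>tau\<close> follows only the lower index.\<close>

lemma tau_test_function:
  assumes x: "x \<notin> a ` {..<n} \<union> a' ` {..<n}"
  shows "g (tau n \<alpha> a a' c x) = g x + (\<Sum>i<n. indicator {a i..a' i} x * (g (\<alpha> i * x + c i) - g x) :: real)"
proof (cases rule: tau_cases[of x])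
  case (piece i)
  have "(\<Sum>j<n. indicator {a j..a' j} x * (g (\<alpha> j * x + c j) - g x)) = (\<Sum>j<n. if j = i then g (\<alpha> i * x + c i) - g x else 0)"
  proof (rule sum.cong[OF refl])
    fix j assume "j \<in> {..<n}"
    then have j: "j < n" by simp
    have "x \<notin> {a j..a' j}" if "j \<noteq> i"
    proof -
      have "a i < x" "x < a' i" using x piece(1,2) by (auto simp: less_le)
      then show ?thesis
        using admissible_ordered[of i j] admissible_ordered[of j i] j piece(1) that by (cases "i < j") auto
    qed
    then show "indicator {a j..a' j} x * (g (\<alpha> j * x + c j) - g x) = (if j = i then g (\<alpha> i * x + c i) - g x else 0)"
      using piece(2) by auto
  qed
  then show ?thesis using piece by (simp add: sum.delta)
next
  case fixed
  then have "(\<Sum>i<n. indicator {a i..a' i} x * (g (\<alpha> i * x + c i) - g x)) = (0 :: real)" by (intro sum.neutral) auto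
  then show ?thesis using fixed by simp
qed

text \<open>Because \<alpha> i > 0, a subinterval of A i is mapped affinely onto an interval inside
  A i, and substitution divides its integral by \<alpha> i. The estimate is purely multiplicative:
  neither the mass of \<nu> nor a length a' i - a i enters.\<close>

lemma tau_var_le:
  assumes \<nu>: "fin01 \<nu>" "var_le \<nu> B"
  shows "var_le (distr \<nu> M01 (tau n \<alpha> a a' c)) ((real n + 1 + (\<Sum>i<n. 1 / \<alpha> i)) * B)"
  unfolding var_le_def
proof (intro allI impI, elim conjE)
  fix g M assume g: "bdd01 g" "osc_le g M"
  define A where "A = (\<lambda>i. {a i..a' i})"
  have A: "A i \<in> sets M01" if "i < n" for i using admissible_sets[OF that] by (simp add: A_def)
  \<comment> \<open>The value 0 off A i makes S i a self-map of [0,1], so composition with it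
    preserves bounded test functions; the indicator in \<open>G1\<close> hides this value.\<close>
  define S where "S = (\<lambda>i x. if x \<in> A i then \<alpha> i * x + c i else 0)"
  have S: "S i \<in> measurable M01 M01" if i: "i < n" for i
  proof -
    have Ab: "A i \<in> sets borel" by (simp add: A_def)
    have "S i \<in> borel_measurable borel" unfolding S_def using Ab by measurable
    moreover have "S i x \<in> {0..1}" for x
      using admissible_maps[OF i, of x] admissible_subset[OF i] by (auto simp: S_def A_def)
    ultimately show ?thesis unfolding M01_def by (intro measurable_restrict_space2 measurable_restrict_space1) auto
  qed
  define G1 where "G1 = (\<lambda>i x. indicator (A i) x * g (S i x))"
  define G2 where "G2 = (\<lambda>i x. indicator (A i) x * g x)"
  have b1: "bdd01 (G1 i)" if "i < n" for i unfolding G1_def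
    by (intro bdd01_intros A that bdd01_compose[OF g(1) S])
  have b2: "bdd01 (G2 i)" if "i < n" for i unfolding G2_def by (intro bdd01_intros A that g)
  have M0: "M \<ge> 0" using osc_le_nonneg[OF g(2)] .
  \<comment> \<open>Intersecting [s, t] with A i leaves an interval or nothing, so a bound for
    intervals inside A i suffices.\<close>
  have restrict: "\<bar>LINT x:{s..t}|L01. indicator (A i) x * h x\<bar> \<le> m"
    if "m \<ge> 0" and m: "\<And>u v. s \<le> u \<Longrightarrow> a i \<le> u \<Longrightarrow> u \<le> v \<Longrightarrow> v \<le> t \<Longrightarrow> v \<le> a' i \<Longrightarrow> \<bar>LINT x:{u..v}|L01. h x\<bar> \<le> m" for s t i m and h :: "real \<Rightarrow> real"
  proof -
    define u v where "u = max s (a i)" and "v = min t (a' i)"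
    have "(LINT x:{s..t}|L01. indicator (A i) x * h x) = (LINT x:{u..v}|L01. h x)"
      unfolding set_lebesgue_integral_def
      by (intro Bochner_Integration.integral_cong refl) (auto simp: indicator_def A_def u_def v_def)
    moreover have "\<bar>LINT x:{u..v}|L01. h x\<bar> \<le> m"
    proof (cases "u \<le> v")
      case True then show ?thesis by (intro m) (auto simp: u_def v_def)
    next
      case False then show ?thesis using \<open>m \<ge> 0\<close> by (simp add: set_lebesgue_integral_def)
    qed
    ultimately show ?thesis by simp
  qed
  have le1: "\<bar>LINT x:{s..t}|L01. G1 i x\<bar> \<le> M / \<alpha> i" if i: "i < n" for s t i
    unfolding G1_def
  proof (rule restrict)
    show "0 \<le> M / \<alpha> i" using M0 \<alpha>[OF i] by simp
    fix u v assume uv: "a i \<le> u" "u \<le> v" "v \<le> a' i"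
    have sub: "{u..v} \<subseteq> {0..1}" using admissible_subset[OF i] uv by auto
    have im: "0 \<le> \<alpha> i * u + c i" "\<alpha> i * v + c i \<le> 1"
      using admissible_maps[OF i, of u] admissible_maps[OF i, of v] admissible_subset[OF i] uv by auto
    have mono: "\<alpha> i * u + c i \<le> \<alpha> i * v + c i" using \<alpha>[OF i] uv by simp
    define J where "J = (LINT x:{\<alpha> i * u + c i..\<alpha> i * v + c i}|L01. g x)"
    have "(g has_integral J) (cbox (\<alpha> i * u + c i) (\<alpha> i * v + c i))"
      unfolding J_def using set_integral_01_HK[OF g(1), of "\<alpha> i * u + c i" "\<alpha> i * v + c i"] im
      by (simp add: integrable_integral)
    from has_integral_affinity'[OF this \<alpha>[OF i], of "c i"]
    have "((\<lambda>x. g (\<alpha> i * x + c i)) has_integral J / \<alpha> i) {u..v}"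
      using \<alpha>[OF i] by (simp add: field_simps)
    then have "((\<lambda>x. g (S i x)) has_integral J / \<alpha> i) {u..v}"
      by (rule has_integral_eq[rotated]) (use uv in \<open>auto simp: S_def A_def\<close>)
    then have "(LINT x:{u..v}|L01. g (S i x)) = J / \<alpha> i"
      using set_integral_01_HK(1)[OF bdd01_compose[OF g(1) S[OF i]] sub] by (simp add: integral_unique)
    moreover have "\<bar>J\<bar> \<le> M" unfolding J_def by (rule osc_leD[OF g(2) im(1) mono im(2)])
    ultimately show "\<bar>LINT x:{u..v}|L01. g (S i x)\<bar> \<le> M / \<alpha> i" using \<alpha>[OF i] by (simp add: divide_right_mono)
  qed
  have le2: "\<bar>LINT x:{s..t}|L01. G2 i x\<bar> \<le> M" if i: "i < n" for s t i
    unfolding G2_def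
  proof (rule restrict[OF M0])
    fix u v assume uv: "a i \<le> u" "u \<le> v" "v \<le> a' i"
    show "\<bar>LINT x:{u..v}|L01. g x\<bar> \<le> M" using admissible_subset[OF i] uv by (intro osc_leD[OF g(2)]) auto
  qed
  define G where "G = (\<lambda>x. g x + (\<Sum>i<n. G1 i x - G2 i x))"
  have bG: "bdd01 G" unfolding G_def by (intro bdd01_intros g b1 b2) auto
  have oG: "osc_le G ((real n + 1 + (\<Sum>i<n. 1 / \<alpha> i)) * M)" unfolding osc_le_def
  proof (intro allI impI)
    fix s t :: real assume st: "0 \<le> s \<and> s \<le> t \<and> t \<le> 1"
    then have sub: "{s..t} \<subseteq> {0..1}" by auto
    have "(LINT x:{s..t}|L01. G x) = (LINT x:{s..t}|L01. g x) + (LINT x:{s..t}|L01. \<Sum>i<n. G1 i x - G2 i x)"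
      unfolding G_def by (intro set_integral_add set_integrable_01 sub g bdd01_intros b1 b2) auto
    also have "(LINT x:{s..t}|L01. \<Sum>i<n. G1 i x - G2 i x) = (\<Sum>i<n. LINT x:{s..t}|L01. G1 i x - G2 i x)"
      unfolding set_lebesgue_integral_def real_scaleR_def sum_distrib_left
      by (intro integral_sum_01 fin01_L01 bdd01_intros b1 b2) (use sub in \<open>auto simp: in_sets_M01\<close>)
    also have "\<dots> = (\<Sum>i<n. (LINT x:{s..t}|L01. G1 i x) - (LINT x:{s..t}|L01. G2 i x))"
      by (intro sum.cong refl set_integral_diff_01 b1 b2 sub) auto
    finally have eq: "(LINT x:{s..t}|L01. G x) = (LINT x:{s..t}|L01. g x) + (\<Sum>i<n. (LINT x:{s..t}|L01. G1 i x) - (LINT x:{s..t}|L01. G2 i x))" .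
    have "\<bar>\<Sum>i<n. (LINT x:{s..t}|L01. G1 i x) - (LINT x:{s..t}|L01. G2 i x)\<bar> \<le> (\<Sum>i<n. M / \<alpha> i + M)"
    proof (intro order_trans[OF sum_abs] sum_mono)
      fix i assume "i \<in> {..<n}"
      then show "\<bar>(LINT x:{s..t}|L01. G1 i x) - (LINT x:{s..t}|L01. G2 i x)\<bar> \<le> M / \<alpha> i + M"
        using le1[of i s t] le2[of i s t] by force
    qed
    moreover have "\<bar>LINT x:{s..t}|L01. g x\<bar> \<le> M" using osc_leD[OF g(2)] st by blast
    ultimately have "\<bar>LINT x:{s..t}|L01. G x\<bar> \<le> M + (\<Sum>i<n. M / \<alpha> i + M)" unfolding eq by linarith
    also have "\<dots> = (real n + 1 + (\<Sum>i<n. 1 / \<alpha> i)) * M"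
      by (simp add: sum.distrib algebra_simps sum_distrib_left)
    finally show "\<bar>LINT x:{s..t}|L01. G x\<bar> \<le> (real n + 1 + (\<Sum>i<n. 1 / \<alpha> i)) * M" .
  qed
  have "AE x in \<nu>. x \<notin> a ` {..<n} \<union> a' ` {..<n}"
    by (rule AE_not_in_finite[OF \<nu>(1) var_le_dominated[OF \<nu>]]) simp
  then have AE: "AE x in \<nu>. g (tau n \<alpha> a a' c x) = G x"
  proof eventually_elim
    case (elim x)
    show ?case unfolding tau_test_function[OF elim, of g] G_def G1_def G2_def
      by (intro arg_cong2[where f = "(+)"] sum.cong refl) (simp add: S_def A_def indicator_def)
  qed
  have "integral\<^sup>L (distr \<nu> M01 (tau n \<alpha> a a' c)) g = integral\<^sup>L \<nu> (\<lambda>x. g (tau n \<alpha> a a' c x))"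
    by (rule integral_distr_01[OF \<nu>(1) tau_measurable g(1)])
  also have "\<dots> = integral\<^sup>L \<nu> G"
    by (intro integral_cong_AE bdd01_borel[OF \<nu>(1)] bdd01_compose[OF g(1) tau_measurable] bG AE)
  also have "\<dots> \<le> B * ((real n + 1 + (\<Sum>i<n. 1 / \<alpha> i)) * M)" by (rule var_leD[OF \<nu>(2) bG oG])
  finally show "integral\<^sup>L (distr \<nu> M01 (tau n \<alpha> a a' c)) g \<le> (real n + 1 + (\<Sum>i<n. 1 / \<alpha> i)) * B * M"
    by (simp add: mult_ac)
qed

text \<open>Preimage and set differ only inside the union of the intervals, which has Lebesgue
  measure at most \<delta> and hence \<nu>-mass at most B * \<delta>.\<close>

lemma measure_tau_moved:
  assumes \<nu>: "fin01 \<nu>" "var_le \<nu> B" and A: "A \<in> sets M01"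
  shows "\<bar>measure \<nu> (tau n \<alpha> a a' c -` A \<inter> {0..1}) - measure \<nu> A\<bar> \<le> B * \<delta>"
proof -
  let ?\<tau> = "tau n \<alpha> a a' c" and ?W = "\<Union>i<n. {a i..a' i}"
  have W: "?W \<in> sets M01" using admissible_sets by (intro sets.finite_UN) auto
  have "measure L01 ?W \<le> (\<Sum>i<n. measure L01 {a i..a' i})"
    using admissible_sets by (intro measure_UNION_le) auto
  also have "\<dots> = (\<Sum>i<n. a' i - a i)"
  proof (rule sum.cong[OF refl])
    fix i assume "i \<in> {..<n}"
    then have i: "i < n" by simp
    have "0 \<le> a i" "a i \<le> a' i" "a' i \<le> 1" using admissible_subset[OF i] admissible_less[OF i] by auto
    then show "measure L01 {a i..a' i} = a' i - a i" by (rule measure_L01_interval)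
  qed
  also have "\<dots> = \<delta>" using adm by (simp add: admissible_def)
  finally have "measure L01 ?W \<le> \<delta>" .
  moreover have "measure \<nu> ?W \<le> B * measure L01 ?W"
    using var_le_dominated[OF \<nu>] W by (simp add: dominated_def)
  ultimately have W\<delta>: "measure \<nu> ?W \<le> B * \<delta>" using var_le_mass(2)[OF \<nu>] mult_left_mono order_trans by blast
  have V: "?\<tau> -` A \<inter> {0..1} \<in> sets M01" by (rule vimage_sets_01[OF tau_measurable A])
  have unmoved: "?\<tau> x = x" if "x \<notin> ?W" for x using that by (cases rule: tau_cases[of x]) auto
  have sub: "measure \<nu> P \<le> measure \<nu> Q + measure \<nu> ?W" if "P \<in> sets M01" "Q \<in> sets M01" "P \<subseteq> Q \<union> ?W" for P Q
  proof -
    have "measure \<nu> P \<le> measure \<nu> (Q \<union> ?W)" using that W \<nu>(1) by (intro fin01_measure_mono) auto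
    also have "\<dots> \<le> measure \<nu> Q + measure \<nu> ?W"
      using that W \<nu>(1) by (intro measure_Un_le) (auto simp: fin01_sets)
    finally show ?thesis .
  qed
  have "?\<tau> -` A \<inter> {0..1} \<subseteq> A \<union> ?W" using unmoved by force
  moreover have "A \<subseteq> (?\<tau> -` A \<inter> {0..1}) \<union> ?W" using unmoved A by (force simp: in_sets_M01)
  ultimately show ?thesis using sub[OF V A] sub[OF A V] W\<delta> by linarith
qed

end

section \<open>Uniqueness and convergence for small intervals\<close>

lemma inv01_iff:
  assumes S: "lasota_yorke S \<rho> C"
  shows "inv01 S \<mu> \<longleftrightarrow> prob01 \<mu> \<and> bv01 \<mu> \<and> invariant01 S \<mu>"
proof -
  have distr: "distr \<mu> \<mu> S = distr \<mu> M01 S" if "prob01 \<mu>"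
    using fin01_sets[OF prob01_fin01[OF that]] by (intro distr_cong) auto
  show ?thesis
  proof
    assume inv: "inv01 S \<mu>"
    note f = inv01D(2)[OF inv]
    show "prob01 \<mu> \<and> bv01 \<mu> \<and> invariant01 S \<mu>"
      using inv01D(1)[OF inv] var_le_imp_bv01[OF f inv01_var_le[OF S inv]] distr inv
      by (simp add: invariant01_def inv01_def)
  next
    assume a: "prob01 \<mu> \<and> bv01 \<mu> \<and> invariant01 S \<mu>"
    then have f: "fin01 \<mu>" using prob01_fin01 by blast
    obtain B where B: "var_le \<mu> B" using bv01_imp_var_le[OF f] a by blast
    have "absolutely_continuous L01 \<mu>"
      by (rule dominated_absolutely_continuous[OF fin01_L01 f var_le_dominated[OF f B]])
    then show "inv01 S \<mu>" using a distr by (simp add: inv01_def invariant01_def)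
  qed
qed

text \<open>Composition multiplies the estimate for \<open>T\<close> by N, and the hypothesis on the
  slopes says exactly that 2 * N / lam < 1. The constants are independent of the position and length
  of the intervals.\<close>

lemma tau_lasota_yorke:
  assumes adm: "admissible n \<alpha> a a' c \<delta>" "n \<ge> 1" "\<And>i. i < n \<Longrightarrow> \<alpha> i > 0"
    and N: "N = real n + 1 + (\<Sum>i<n. 1 / \<alpha> i)" "2 * N < lam"
    and T: "T \<in> measurable M01 M01" "C \<ge> 0"
      "\<And>\<mu> B. fin01 \<mu> \<Longrightarrow> var_le \<mu> B \<Longrightarrow> var_le (distr \<mu> M01 T) (2 / lam * B + C * measure \<mu> {0..1})"
  shows "lasota_yorke (tau n \<alpha> a a' c \<circ> T) (2 * N / lam) (N * C)"
proof -
  have "(\<Sum>i<n. 1 / \<alpha> i) \<ge> 0" using adm(3) by (intro sum_nonneg) (simp add: less_imp_le)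
  then have N1: "N \<ge> 1" by (simp add: N(1))
  note m = tau_measurable[OF adm]
  have "var_le (distr \<mu> M01 (tau n \<alpha> a a' c \<circ> T)) (2 * N / lam * B + N * C * measure \<mu> {0..1})"
    if \<mu>: "fin01 \<mu>" "var_le \<mu> B" for \<mu> B
  proof -
    have "var_le (distr (distr \<mu> M01 T) M01 (tau n \<alpha> a a' c)) (N * (2 / lam * B + C * measure \<mu> {0..1}))"
      unfolding N(1) by (rule tau_var_le[OF adm fin01_distr[OF \<mu>(1) T(1)] T(3)[OF \<mu>]])
    moreover have "distr (distr \<mu> M01 T) M01 (tau n \<alpha> a a' c) = distr \<mu> M01 (tau n \<alpha> a a' c \<circ> T)"
      using m T(1) \<mu>(1) by (intro distr_distr) (auto simp: fin01_sets cong: measurable_cong_sets)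
    moreover have "N * (2 / lam * B + C * measure \<mu> {0..1}) = 2 * N / lam * B + N * C * measure \<mu> {0..1}"
      by (simp add: algebra_simps)
    ultimately show ?thesis by metis
  qed
  then show ?thesis using m T(1,2) N(2) N1 unfolding lasota_yorke_def
    by (intro conjI allI impI measurable_comp[OF T(1) m]) (auto simp: field_simps)
qed

text \<open>Along a sequence with \<epsilon> tending to 0 the intervals change as well; hiding them
  under quantifiers leaves a condition on the measures alone.\<close>

definition perturbed_inv :: "nat \<Rightarrow> (nat \<Rightarrow> real) \<Rightarrow> (real \<Rightarrow> real) \<Rightarrow> real \<Rightarrow> real \<Rightarrow> real \<Rightarrow> real measure \<Rightarrow> bool" where
  "perturbed_inv n \<alpha> T \<rho> C \<epsilon> \<mu> \<longleftrightarrow> (\<exists>a a' c \<delta>. admissible n \<alpha> a a' c \<delta> \<and> \<delta> < \<epsilon> \<and>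
     lasota_yorke (tau n \<alpha> a a' c \<circ> T) \<rho> C \<and> inv01 (tau n \<alpha> a a' c \<circ> T) \<mu>)"

text \<open>\<mu> k is the image under \<tau> of \<open>distr (\<mu> k) M01 T\<close>, and \<tau>
  changes the mass of any set by O(\<delta>). So \<mu> k is nearly T-invariant on every Borel set,
  and the limit along a subsequence is the only T-invariant candidate.\<close>

lemma perturbed_inv01_converges:
  assumes T: "lasota_yorke T \<rho> C" and uniq: "\<forall>\<sigma>. inv01 T \<sigma> \<longrightarrow> \<sigma> = \<mu>T"
    and n: "n \<ge> 1" and \<alpha>0: "\<forall>i<n. \<alpha> i > 0"
    and \<mu>: "\<And>k. perturbed_inv n \<alpha> T \<rho> C (1 / real (Suc k)) (\<mu> k)"
  obtains r where "strict_mono (r :: nat \<Rightarrow> nat)" "weak_conv01 (\<mu> \<circ> r) \<mu>T" "prob01 \<mu>T"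
    "\<And>k. prob01 (\<mu> k)" "\<And>k. var_le (\<mu> k) (C / (1 - \<rho>))"
proof -
  note Tm = lasota_yorke_measurable[OF T]
  have \<alpha>: "\<alpha> i > 0" if "i < n" for i using \<alpha>0 that by blast
  define D where "D = C / (1 - \<rho>)"
  have p: "prob01 (\<mu> k)" and v: "var_le (\<mu> k) D" for k
    using \<mu>[of k] inv01_var_le by (auto simp: D_def perturbed_inv_def dest: inv01D(1))
  note f = prob01_fin01[OF p]
  note dom = var_le_dominated[OF f v]
  have D0: "D \<ge> 0" by (rule var_le_mass(2)[OF f v])
  \<comment> \<open>\<tau> acts on the image of \<mu> k under T, so it is the variation of that
    image that must be bounded.\<close>
  define D' where "D' = \<rho> * D + C"
  have vT: "var_le (distr (\<mu> k) M01 T) D'" for k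
    using T f[of k] v[of k] prob01_measure[OF p[of k]] unfolding lasota_yorke_def D'_def by (metis mult.right_neutral)
  have D'0: "D' \<ge> 0" by (rule var_le_mass(2)[OF fin01_distr[OF f Tm] vT])
  have bound: "norm (measure (\<mu> k) (T -` A \<inter> {0..1}) - measure (\<mu> k) A) \<le> D' * (1 / real (Suc k))" if A: "A \<in> sets M01" for k A
  proof -
    obtain a a' c \<delta> where k: "admissible n \<alpha> a a' c \<delta>" "\<delta> < 1 / real (Suc k)" "inv01 (tau n \<alpha> a a' c \<circ> T) (\<mu> k)"
      using \<mu>[of k] unfolding perturbed_inv_def by blast
    note \<tau> = tau_measurable[OF k(1) n \<alpha>]
    let ?\<nu> = "distr (\<mu> k) M01 T" and ?\<tau>A = "tau n \<alpha> a a' c -` A \<inter> {0..1}"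
    have "measure (\<mu> k) A = measure (\<mu> k) ((tau n \<alpha> a a' c \<circ> T) -` A \<inter> {0..1})"
      using inv01_measure[OF k(3) measurable_comp[OF Tm \<tau>] A] by simp
    also have "(tau n \<alpha> a a' c \<circ> T) -` A \<inter> {0..1} = T -` ?\<tau>A \<inter> {0..1}" using maps_01[OF Tm] by auto
    also have "measure (\<mu> k) \<dots> = measure ?\<nu> ?\<tau>A"
      using measure_distr_01[OF f Tm vimage_sets_01[OF \<tau> A]] by simp
    finally have "measure (\<mu> k) A = measure ?\<nu> ?\<tau>A" .
    moreover have "measure (\<mu> k) (T -` A \<inter> {0..1}) = measure ?\<nu> A" using measure_distr_01[OF f Tm A] by simp
    moreover have "\<bar>measure ?\<nu> ?\<tau>A - measure ?\<nu> A\<bar> \<le> D' * \<delta>"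
      by (rule measure_tau_moved[OF k(1) n \<alpha> fin01_distr[OF f Tm] vT A])
    moreover have "D' * \<delta> \<le> D' * (1 / real (Suc k))" using D'0 k(2) by (intro mult_left_mono) auto
    ultimately show ?thesis by (simp add: abs_minus_commute)
  qed
  obtain r \<sigma> where r: "strict_mono (r :: nat \<Rightarrow> nat)" "prob01 \<sigma>" "weak_conv01 (\<mu> \<circ> r) \<sigma>"
    by (rule helly01[of \<mu>, OF p])
  have "inv01 T \<sigma>"
  proof (rule inv01_weak_limit[OF Tm _ _ D0 r(2,3)])
    show "prob01 ((\<mu> \<circ> r) i)" "dominated ((\<mu> \<circ> r) i) L01 D" for i using p dom by auto
    fix A assume A: "A \<in> sets M01"
    have "(\<lambda>i. measure (\<mu> i) (T -` A \<inter> {0..1}) - measure (\<mu> i) A) \<longlonglongrightarrow> 0"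
    proof (rule Lim_null_comparison[OF always_eventually[OF allI[OF bound[OF A]]]])
      have "(\<lambda>k. D' * (1 / real (Suc k))) \<longlonglongrightarrow> D' * 0"
        by (intro tendsto_intros LIMSEQ_Suc lim_1_over_n)
      then show "(\<lambda>k. D' * (1 / real (Suc k))) \<longlonglongrightarrow> 0" by simp
    qed
    from LIMSEQ_subseq_LIMSEQ[OF this r(1)]
    show "(\<lambda>i. measure ((\<mu> \<circ> r) i) (T -` A \<inter> {0..1}) - measure ((\<mu> \<circ> r) i) A) \<longlonglongrightarrow> 0" by (simp add: o_def)
  qed
  then have "\<sigma> = \<mu>T" using uniq by blast
  then show thesis using that[of r] r p v by (auto simp: D_def)
qed

lemma weak_conv01_subseq:
  "weak_conv01 \<mu> \<sigma> \<Longrightarrow> strict_mono (r :: nat \<Rightarrow> nat) \<Longrightarrow> weak_conv01 (\<mu> \<circ> r) \<sigma>"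
  unfolding weak_conv01_def using LIMSEQ_subseq_LIMSEQ by (fastforce simp: o_def)

text \<open>Bounded variation upgrades weak convergence to convergence in total variation,
  which is incompatible with mutual singularity.\<close>
lemma var_le_not_singular:
  assumes \<mu>: "\<And>k. prob01 (\<mu> k)" "\<And>k. var_le (\<mu> k) D" "weak_conv01 \<mu> \<sigma>"
    and \<nu>: "\<And>k. prob01 (\<nu> k)" "\<And>k. var_le (\<nu> k) D" "weak_conv01 \<nu> \<sigma>" and \<sigma>: "prob01 \<sigma>"
    and E: "\<And>k. E k \<in> sets M01" "\<And>k. measure (\<mu> k) (E k) = 1" "\<And>k. measure (\<nu> k) (E k) = 0"
  shows False
proof -
  note f\<mu> = prob01_fin01[OF \<mu>(1)] and f\<nu> = prob01_fin01[OF \<nu>(1)] and f\<sigma> = prob01_fin01[OF \<sigma>]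
  have D0: "D \<ge> 0" by (rule var_le_mass(2)[OF f\<mu> \<mu>(2)])
  \<comment> \<open>This makes 8 * D / N at most 1/2. Together with an error \<open>err k\<close>
    below 1/2 it contradicts the difference 1 of the masses on E k.\<close>
  obtain N :: nat where N: "real N > 16 * D" "N > 0"
    using reals_Archimedean2[of "max 1 (16 * D)"] by (metis (no_types) gr0I max_less_iff_conj not_one_less_zero of_nat_0)
  define I where "I = (\<lambda>j. {real j / real N..real (Suc j) / real N})"
  have I: "I j \<in> sets M01" if "j < N" for j using uniform_partition(5)[OF N(2) that] by (simp add: I_def)
  define err where "err = (\<lambda>k. \<Sum>j<N. \<bar>measure (\<mu> k) (I j) - measure (\<nu> k) (I j)\<bar>)"
  have lim: "(\<lambda>k. measure (\<rho> k) A) \<longlonglongrightarrow> measure \<sigma> A"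
    if "\<And>k. prob01 (\<rho> k)" "\<And>k. var_le (\<rho> k) D" "weak_conv01 \<rho> \<sigma>" "A \<in> sets M01" for \<rho> A
    using weak_limit_bdd01[OF prob01_fin01[OF that(1)] var_le_dominated[OF prob01_fin01[OF that(1)] that(2)] D0 f\<sigma> that(3) bdd01_indicator[OF that(4)]]
    unfolding integral_indicator_01[OF prob01_fin01[OF that(1)] that(4)] integral_indicator_01[OF f\<sigma> that(4)] .
  have "err \<longlonglongrightarrow> (\<Sum>j<N. \<bar>measure \<sigma> (I j) - measure \<sigma> (I j)\<bar>)"
    unfolding err_def by (intro tendsto_sum tendsto_rabs tendsto_diff lim \<mu> \<nu> I) auto
  then have "err \<longlonglongrightarrow> 0" by simp
  from order_tendstoD(2)[OF this, of "1 / 2"] obtain k where k: "err k < 1 / 2"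
    by (auto simp: eventually_sequentially)
  have "\<bar>integral\<^sup>L (\<mu> k) (indicator (E k)) - integral\<^sup>L (\<nu> k) (indicator (E k))\<bar> \<le> 8 * D / real N + err k"
    unfolding err_def I_def
    by (rule var_le_step_approx[OF f\<mu> \<mu>(2) f\<nu> \<nu>(2) N(2) bdd01_indicator[OF E(1)]]) (auto simp: indicator_def)
  moreover have "8 * D / real N \<le> 1 / 2" using N by (simp add: field_simps)
  ultimately show False
    using k integral_indicator_01[OF f\<mu> E(1), of k k] integral_indicator_01[OF f\<nu> E(1), of k k] E(2,3)[of k] by simp
qed

theorem theorem8:
  fixes T :: "real \<Rightarrow> real" and lam :: real and \<mu>T :: "real measure"
    and n :: nat and \<alpha> :: "nat \<Rightarrow> real"
  assumes "lam > 1" and "expanding lam T"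
    and "SBR T \<mu>T" and "\<And>\<nu>. SBR T \<nu> \<Longrightarrow> \<nu> = \<mu>T"
    and "n \<ge> 1" and "\<And>i. i < n \<Longrightarrow> \<alpha> i > 0"
    and "2 * (real n + 1 + (\<Sum>i<n. 1 / \<alpha> i)) < lam"
  shows "\<exists>\<delta>0>0.
    (\<forall>a a' c \<delta>. admissible n \<alpha> a a' c \<delta> \<and> \<delta> < \<delta>0 \<longrightarrow>
       (\<exists>!\<mu>. prob01 \<mu> \<and> bv01 \<mu> \<and> invariant01 (tau n \<alpha> a a' c \<circ> T) \<mu>)) \<and>
    (\<forall>f::real \<Rightarrow> real. continuous_on {0..1} f \<longrightarrow> (\<forall>\<epsilon>>0. \<exists>\<delta>1>0.
       \<forall>a a' c \<delta> \<mu>. admissible n \<alpha> a a' c \<delta> \<and> \<delta> < \<delta>1 \<and>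
         prob01 \<mu> \<and> bv01 \<mu> \<and> invariant01 (tau n \<alpha> a a' c \<circ> T) \<mu> \<longrightarrow>
         \<bar>integral\<^sup>L \<mu> f - integral\<^sup>L \<mu>T f\<bar> < \<epsilon>))"
  proof -
  define N where "N = real n + 1 + (\<Sum>i<n. 1 / \<alpha> i)"
  define \<rho> where "\<rho> = 2 * N / lam"
  have N2: "2 * N < lam" using assms(7) by (simp add: N_def)
  have "(\<Sum>i<n. 1 / \<alpha> i) \<ge> 0" using assms(6) by (intro sum_nonneg) (simp add: less_imp_le)
  then have N1: "N \<ge> 1" by (simp add: N_def)
  have lam: "lam > 0" using assms(1) by simp
  obtain C0 where C0: "C0 \<ge> 0"
    "\<And>\<mu> B. fin01 \<mu> \<Longrightarrow> var_le \<mu> B \<Longrightarrow> var_le (distr \<mu> M01 T) (2 / lam * B + C0 * measure \<mu> {0..1})"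
    using expanding_lasota_yorke_inequality[OF assms(2) lam] by blast
  define C where "C = N * C0"
  note Tm = expanding_measurable[OF assms(2)]
  have S: "lasota_yorke (tau n \<alpha> a a' c \<circ> T) \<rho> C" if "admissible n \<alpha> a a' c \<delta>" for a a' c \<delta>
    unfolding \<rho>_def C_def by (rule tau_lasota_yorke[OF that assms(5,6) N_def N2 Tm C0])
  \<comment> \<open>Since N is at least 1, \<open>T\<close> itself satisfies the inequality with the
    constants of the perturbed maps.\<close>
  have T: "lasota_yorke T \<rho> C"
    unfolding lasota_yorke_def
  proof (intro conjI allI impI, goal_cases)
    case (5 \<mu> B)
    have B: "B \<ge> 0" using 5 var_le_mass(2) by blast
    have "2 / lam * B \<le> \<rho> * B" unfolding \<rho>_def using B N1 lam by (intro mult_right_mono divide_right_mono) auto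
    moreover have "C0 * measure \<mu> {0..1} \<le> C * measure \<mu> {0..1}"
      unfolding C_def using C0(1) N1 by (intro mult_right_mono) (auto simp: mult_le_cancel_right1)
    ultimately show ?case using 5 by (intro var_le_mono[OF C0(2)]) auto
  qed (use Tm N1 N2 lam C0(1) in \<open>auto simp: \<rho>_def C_def\<close>)
  have uniq: "\<forall>\<sigma>. inv01 T \<sigma> \<longrightarrow> \<sigma> = \<mu>T"
    using unique_SBR_imp_unique_inv01[OF T assms(4)] by blast
  have "\<forall>i<n. \<alpha> i > 0" using assms(6) by blast
  note conv = perturbed_inv01_converges[OF T uniq assms(5) this]
  have "\<exists>\<delta>0>0. \<forall>a a' c \<delta>. admissible n \<alpha> a a' c \<delta> \<and> \<delta> < \<delta>0 \<longrightarrow>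
    (\<forall>\<mu> \<nu>. inv01 (tau n \<alpha> a a' c \<circ> T) \<mu> \<and> inv01 (tau n \<alpha> a a' c \<circ> T) \<nu> \<longrightarrow> \<mu> = \<nu>)"
  proof (rule ccontr)
    assume neg: "\<not> ?thesis"
    define P where "P = (\<lambda>k. perturbed_inv n \<alpha> T \<rho> C (1 / real (Suc k)))"
    \<comment> \<open>Two different invariant measures might approach each other in total variation
      as k grows. Singular ones cannot, so these are used for the contradiction.\<close>
    have "\<exists>\<mu> \<nu> E. P k \<mu> \<and> P k \<nu> \<and> E \<in> sets M01 \<and> measure \<mu> E = 1 \<and> measure \<nu> E = 0" for k
    proof -
      have "1 / real (Suc k) > 0" by simp
      then obtain a a' c \<delta> \<mu> \<nu> where a: "admissible n \<alpha> a a' c \<delta>" "\<delta> < 1 / real (Suc k)"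
        "inv01 (tau n \<alpha> a a' c \<circ> T) \<mu>" "inv01 (tau n \<alpha> a a' c \<circ> T) \<nu>" "\<mu> \<noteq> \<nu>"
        using neg by blast
      obtain \<mu>1 \<mu>2 E where E: "inv01 (tau n \<alpha> a a' c \<circ> T) \<mu>1" "inv01 (tau n \<alpha> a a' c \<circ> T) \<mu>2" "E \<in> sets M01"
        "measure \<mu>1 E = 1" "measure \<mu>2 ({0..1} - E) = 1"
        using inv01_singular_pair[OF lasota_yorke_measurable[OF S[OF a(1)]] a(3-5)] by blast
      have "measure \<mu>2 E = 0" using E(5) measure_compl_01[OF inv01D(1)[OF E(2)] E(3)] by simp
      then show ?thesis unfolding P_def perturbed_inv_def using a(1,2) S[OF a(1)] E by blast
    qed
    then obtain \<mu> \<nu> E where P: "\<And>k. P k (\<mu> k)" "\<And>k. P k (\<nu> k)" and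
      E: "\<And>k. E k \<in> sets M01" "\<And>k. measure (\<mu> k) (E k) = 1" "\<And>k. measure (\<nu> k) (E k) = 0" by metis
    obtain r where r: "strict_mono (r :: nat \<Rightarrow> nat)" "weak_conv01 (\<mu> \<circ> r) \<mu>T" "prob01 \<mu>T"
      "\<And>k. prob01 (\<mu> k)" "\<And>k. var_le (\<mu> k) (C / (1 - \<rho>))"
      using conv[OF P(1)[unfolded P_def]] by blast
    \<comment> \<open>Passing to r first yields a common subsequence for both measures;
      \<open>r k \<ge> k\<close> keeps \<delta> below 1 / (k + 1).\<close>
    define \<nu>' where "\<nu>' = (\<lambda>k. \<nu> (r k))"
    have P\<nu>: "P k (\<nu>' k)" for k
    proof -
      have "real (Suc k) \<le> real (Suc (r k))" using seq_suble[OF r(1), of k] by simp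
      then have "1 / real (Suc (r k)) \<le> 1 / real (Suc k)" by (intro divide_left_mono) auto
      then show ?thesis using P(2)[of "r k"] unfolding P_def perturbed_inv_def \<nu>'_def by (meson order_less_le_trans)
    qed
    obtain s where s: "strict_mono (s :: nat \<Rightarrow> nat)" "weak_conv01 (\<nu>' \<circ> s) \<mu>T" "prob01 \<mu>T"
      "\<And>k. prob01 (\<nu>' k)" "\<And>k. var_le (\<nu>' k) (C / (1 - \<rho>))"
      using conv[OF P\<nu>[unfolded P_def]] by blast
    show False
      by (rule var_le_not_singular[where \<mu> = "\<mu> \<circ> r \<circ> s" and \<nu> = "\<nu>' \<circ> s" and \<sigma> = \<mu>T
            and D = "C / (1 - \<rho>)" and E = "\<lambda>k. E (r (s k))"])
        (use r s E weak_conv01_subseq[OF r(2) s(1)] in \<open>auto simp: \<nu>'_def\<close>)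
  qed
  then obtain \<delta>0 where \<delta>0: "\<delta>0 > 0" "\<And>a a' c \<delta> \<mu> \<nu>. admissible n \<alpha> a a' c \<delta> \<Longrightarrow> \<delta> < \<delta>0 \<Longrightarrow>
    inv01 (tau n \<alpha> a a' c \<circ> T) \<mu> \<Longrightarrow> inv01 (tau n \<alpha> a a' c \<circ> T) \<nu> \<Longrightarrow> \<mu> = \<nu>" by blast
  have ex1: "\<exists>!\<mu>. prob01 \<mu> \<and> bv01 \<mu> \<and> invariant01 (tau n \<alpha> a a' c \<circ> T) \<mu>"
    if "admissible n \<alpha> a a' c \<delta>" "\<delta> < \<delta>0" for a a' c \<delta>
    unfolding inv01_iff[OF S[OF that(1)], symmetric]
    using inv01_exists[OF S[OF that(1)]] \<delta>0(2)[OF that] by metis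
  moreover have "\<exists>\<delta>1>0. \<forall>a a' c \<delta> \<mu>. admissible n \<alpha> a a' c \<delta> \<and> \<delta> < \<delta>1 \<and>
      prob01 \<mu> \<and> bv01 \<mu> \<and> invariant01 (tau n \<alpha> a a' c \<circ> T) \<mu> \<longrightarrow> \<bar>integral\<^sup>L \<mu> f - integral\<^sup>L \<mu>T f\<bar> < \<epsilon>"
    if f: "continuous_on {0..1} f" and "\<epsilon> > 0" for f :: "real \<Rightarrow> real" and \<epsilon> :: real
  proof (rule ccontr)
    assume neg: "\<not> ?thesis"
    have "\<exists>\<mu>. perturbed_inv n \<alpha> T \<rho> C (1 / real (Suc k)) \<mu> \<and> \<not> \<bar>integral\<^sup>L \<mu> f - integral\<^sup>L \<mu>T f\<bar> < \<epsilon>" for k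
    proof -
      have "1 / real (Suc k) > 0" by simp
      then obtain a a' c \<delta> \<mu> where a: "admissible n \<alpha> a a' c \<delta>" "\<delta> < 1 / real (Suc k)"
        "prob01 \<mu> \<and> bv01 \<mu> \<and> invariant01 (tau n \<alpha> a a' c \<circ> T) \<mu>" "\<not> \<bar>integral\<^sup>L \<mu> f - integral\<^sup>L \<mu>T f\<bar> < \<epsilon>"
        using neg by blast
      have "inv01 (tau n \<alpha> a a' c \<circ> T) \<mu>" using a(3) inv01_iff[OF S[OF a(1)]] by blast
      then show ?thesis unfolding perturbed_inv_def using a S[OF a(1)] by blast
    qed
    then obtain \<mu> where \<mu>: "\<And>k. perturbed_inv n \<alpha> T \<rho> C (1 / real (Suc k)) (\<mu> k)"
      "\<And>k. \<not> \<bar>integral\<^sup>L (\<mu> k) f - integral\<^sup>L \<mu>T f\<bar> < \<epsilon>" by metis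
    obtain r where "strict_mono (r :: nat \<Rightarrow> nat)" "weak_conv01 (\<mu> \<circ> r) \<mu>T" "prob01 \<mu>T"
      "\<And>k. prob01 (\<mu> k)" "\<And>k. var_le (\<mu> k) (C / (1 - \<rho>))"
      using conv[OF \<mu>(1)] by blast
    then have "(\<lambda>k. integral\<^sup>L (\<mu> (r k)) f) \<longlonglongrightarrow> integral\<^sup>L \<mu>T f" using f by (simp add: weak_conv01_def)
    from LIMSEQ_D[OF this \<open>\<epsilon> > 0\<close>] show False using \<mu>(2) by auto
  qed
  ultimately show ?thesis using \<delta>0(1) by (intro exI[of _ \<delta>0]) blast
qed

end
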